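(* Let $n \ge 3$ and $u_+=0$. Then, for any $\rho_+>0$ and $\theta_+>0$, there exist positive constants $\epsilon_0$ and $C$ satisfying the following: (I) Let $u_->0$. If $|u_-|+|\rho_--\rho_+|+|\theta_--\theta_+| \le \epsilon_0$, there exists a unique smooth solution $(\rho,u,\theta)$ of the stationary problem below (with the inflow boundary condition $(\rho,u,\theta)(r_0)=(\rho_-,u_-,\theta_-)$) satisfying $$|\rho(r)-\rho_+|,\ |\theta(r)-\theta_+|\le Cr^{-(n-2)}(|u_-|+|\rho_--\rho_+|+|\theta_--\theta_+|),$$ $$C^{-1}r^{-(n-1)}|u_-| \le |u(r)| \le Cr^{-(n-1)}|u_-|, \qquad r\ge r_0.$$ (II) Let $u_-< 0$. If $|u_-|+|\theta_--\theta_+|\le \epsilon_0$, there exists a unique smooth solution $(\rho, u, \theta)$ of the stationary problem below (with the outflow boundary condition $(u,\theta)(r_0)=(u_-,\theta_-)$) satisfying $$|\rho(r)-\rho_+|,\ |\theta(r)-\theta_+|\le Cr^{-(n-2)}(|u_-|+|\theta_--\theta_+|),$$ $$C^{-1}r^{-(n-1)}|u_-| \le |u(r)|\le Cr^{-(n-1)}|u_-|, \qquad r\ge r_0.$$ Here the stationary problem is: for $r\ge r_0$, $$\frac{(r^{n-1}\rho u)_r}{r^{n-1}}=0,\qquad \frac{(r^{n-1}\rho u^2)_r}{r^{n-1}}+ p_r =\mu \Big(\frac{(r^{n-1}u)_r}{r^{n-1}}\Big)_r,$$ $$\frac{\{r^{n-1}\rho u (e + \tfrac{1}{2}u^2)\}_r}{r^{n-1}}+\frac{(r^{n-1}pu)_r}{r^{n-1}}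 = \kappa\frac{(r^{n-1}\theta_r)_r}{r^{n-1}} +\mu \Big(\frac{(r^{n-1}u)_r}{r^{n-1}}\Big)_r u +\Psi,$$ $$\lim_{r\to \infty} (\rho, u, \theta)(r) =(\rho_+, u_+, \theta_+),$$ $$(\rho, u, \theta)(r_0)=(\rho_-, u_-, \theta_-)\ (u_->0),\qquad (u, \theta)(r_0)=(u_-, \theta_-)\ (u_- \le 0),$$ with $p= R\rho\theta$, $e=c_V \theta$, $\Psi = 2\nu u_r^2 +2\nu(n-1)(u/r)^2+\lambda(u_r+\tfrac{n-1}{r}u)^2$.
   Context: Radially symmetric stationary solutions $(\rho(r),u(r),\theta(r))$, $r=|x|$, of the compressible Navier–Stokes equations for a viscous heat-conductive polytropic ideal gas in the exterior domain $\{x\in\mathbb{R}^n: |x|>r_0\}$ ($r_0>0$), with velocity field $U=\frac{x}{r}u(r)$, density $\rho>0$, absolute temperature $\theta>0$. Constants $c_V>0$, $R>0$ (specific heat at constant volume and gas constant), viscosity coefficients $\nu,\lambda$ and heat conductivity $\kappa$ are constants with $\nu>0$, $2\nu+n\lambda\ge 0$, $\kappa>0$, and $\mu:=2\nu+\lambda>0$. $\rho_\pm>0$, $u_\pm$, $\theta_\pm$ are given constants; $u_->0$ is the inflow problem, $u_-<0$ the outflow problem. *)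

theory Defs
  imports "HOL-Analysis.Analysis"
begin

definition C_infty_on :: "real set \<Rightarrow> (real \<Rightarrow> real) \<Rightarrow> bool" where
  "C_infty_on S f \<longleftrightarrow>
     (\<exists>D :: nat \<Rightarrow> real \<Rightarrow> real. (\<forall>x\<in>S. D 0 x = f x) \<and>
        (\<forall>k. \<forall>x\<in>S. (D k has_real_derivative D (Suc k) x) (at x within S)))"

definition dr :: "real \<Rightarrow> (real \<Rightarrow> real) \<Rightarrow> real \<Rightarrow> real" where
  "dr r0 f r = vector_derivative f (at r within {r0..})"

definition stationary_sol ::
  "nat \<Rightarrow> real \<Rightarrow> real \<Rightarrow> real \<Rightarrow> real \<Rightarrow> real \<Rightarrow> real \<Rightarrow> real \<Rightarrow> real \<Rightarrow> real \<Rightarrow>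
   (real \<Rightarrow> real) \<Rightarrow> (real \<Rightarrow> real) \<Rightarrow> (real \<Rightarrow> real) \<Rightarrow> bool" where
  "stationary_sol n r0 cV R nu lam kappa rho_p u_p theta_p rho u theta \<longleftrightarrow>
     (let mu = 2 * nu + lam;
          p = (\<lambda>s. R * rho s * theta s);
          e = (\<lambda>s. cV * theta s);
          Psi = (\<lambda>s. 2 * nu * (dr r0 u s)^2 + 2 * nu * (real n - 1) * (u s / s)^2
                      + lam * (dr r0 u s + (real n - 1) / s * u s)^2);
          divu = (\<lambda>s. dr r0 (\<lambda>t. t^(n-1) * u t) s / s^(n-1))
      in C_infty_on {r0..} rho \<and> C_infty_on {r0..} u \<and> C_infty_on {r0..} theta \<and>
         (\<forall>r\<ge>r0. rho r > 0 \<and> theta r > 0) \<and>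
         (\<forall>r\<ge>r0.
            dr r0 (\<lambda>s. s^(n-1) * rho s * u s) r / r^(n-1) = 0 \<and>
            dr r0 (\<lambda>s. s^(n-1) * rho s * (u s)^2) r / r^(n-1) + dr r0 p r
              = mu * dr r0 divu r \<and>
            dr r0 (\<lambda>s. s^(n-1) * rho s * u s * (e s + (u s)^2 / 2)) r / r^(n-1)
              + dr r0 (\<lambda>s. s^(n-1) * p s * u s) r / r^(n-1)
              = kappa * dr r0 (\<lambda>s. s^(n-1) * dr r0 theta s) r / r^(n-1)
                + mu * dr r0 divu r * u r + Psi r) \<and>
         (rho \<longlongrightarrow> rho_p) at_top \<and> (u \<longlongrightarrow> u_p) at_top \<and> (theta \<longlongrightarrow> theta_p) at_top)"

end

theory Submission
  imports Defs
begin

text \<open>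
  Write \<open>v = 1 / \<rho>\<close> and let \<open>M = r ^ (n - 1) \<rho> u\<close> be the constant mass flux. The momentum equation and the equation
  of total energy integrate once; the integration constant of the former vanishes because \<open>v\<close> converges, and in the
  latter the pressure work \<open>p v = R \<theta>\<close> combines with the momentum flux. What remains is a first-order system: a
  relaxation equation \<open>v' = - (\<beta> r ^ (n - 1) / M) (v - v\<^sub>+ - g)\<close>, singularly perturbed as \<open>M\<close> tends to \<open>0\<close>, and
  a heat equation \<open>\<kappa> r ^ (n - 1) \<theta>' = H - E\<close> with \<open>H = O(M)\<close> and a free constant \<open>E\<close>.

  Comparison with \<open>r ^ - (n - 2)\<close> bounds the solutions of the relaxation equation by their forcing, uniformly in
  \<open>M\<close>: for \<open>M > 0\<close> it is stable and takes an initial value, for \<open>M < 0\<close> it has exactly one bounded solution. The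
  constant \<open>E\<close> fits the boundary temperature. In the norm weighted by \<open>r ^ (n - 2)\<close> the resulting solution map is
  a contraction for small data, also when \<open>M\<close> is determined by the boundary value of \<open>v\<close>, and every stationary
  solution in the class is a fixed point.
\<close>

section \<open>Linear equations on a half line\<close>

text \<open>The difficulty is uniformity as the boundary velocity tends to 0: the relaxation rate
  blows up, at \<open>M = 0\<close> the equation for \<open>v\<close> degenerates to the algebraic
  relation \<open>v = v\<^sub>+ + g\<close>, and for inflow a boundary value of \<open>v\<close> is
  still prescribed. Hence nothing is expanded around \<open>M = 0\<close>; powers of
  \<open>r\<close> act as barriers whose constants see only the size of the forcing. The weight
  comes from the decaying radial harmonic function \<open>r ^ - (n - 2)\<close> in dimension
  \<open>n\<close>, which the free constant \<open>E\<close> adds to the temperature. To leading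
  order the pressure is constant, so a change of temperature moves \<open>v\<close> by an amount of
  the same order. The heat source in turn carries the factor \<open>M\<close>. A triangular scheme,
  temperature before volume, therefore leaves only small factors. In the momentum equation the
  derivative of \<open>M u\<close> is divided by \<open>r ^ (n - 1)\<close> and is not exact;
  integrating it leaves a nonlocal term, the tail integral of \<open>v / r ^ (2 n - 1)\<close>.
  Together with the unknown \<open>M\<close> of the outflow problem it makes the nonlinear terms
  functionals of whole functions.\<close>

lemma nondecreasing_if_deriv_nonneg:
  fixes f :: "real \<Rightarrow> real"
  assumes D: "\<And>r. a \<le> r \<Longrightarrow> (f has_real_derivative f' r) (at r within {a..})"
    and nn: "\<And>r. a \<le> r \<Longrightarrow> 0 \<le> f' r" and "a \<le> x" "x \<le> y"
  shows "f x \<le> f y"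
proof (rule DERIV_nonneg_imp_increasing_open[OF \<open>x \<le> y\<close>])
  fix z assume z: "x < z" "z < y"
  have "at z within {a..} = at z"
    using z assms(3) by (intro at_within_interior) (auto simp: interior_real_atLeast)
  then show "\<exists>l. (f has_real_derivative l) (at z) \<and> 0 \<le> l"
    using D[of z] nn[of z] z assms(3) by auto
next
  show "continuous_on {x..y} f"
    using assms(3) D by (intro continuous_on_subset[OF DERIV_continuous_on[of "{a..}" f f']]) auto
qed

lemma nonneg_if_nonincreasing_tendsto_0:
  fixes f :: "real \<Rightarrow> real"
  assumes D: "\<And>r. a \<le> r \<Longrightarrow> (f has_real_derivative f' r) (at r within {a..})"
    and np: "\<And>r. a \<le> r \<Longrightarrow> f' r \<le> 0" and lim: "(f \<longlongrightarrow> 0) at_top" and "a \<le> x"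
  shows "0 \<le> f x"
proof -
  have "f y \<le> f x" if "x \<le> y" for y
    using nondecreasing_if_deriv_nonneg[of a "\<lambda>r. - f r" "\<lambda>r. - f' r" x y] D np that \<open>a \<le> x\<close>
    by (auto intro: DERIV_minus)
  then have "\<forall>\<^sub>F y in at_top. f y \<le> f x"
    unfolding eventually_at_top_linorder by blast
  then show ?thesis
    by (rule tendsto_upperbound[OF lim]) simp
qed

text \<open>Both \<open>W + F\<close> and \<open>W - F\<close> are nonincreasing with limit 0, hence
  nonnegative. The comparison runs from infinity, so no value of \<open>F\<close> at
  \<open>a\<close> enters; with \<open>W = 0\<close> it yields uniqueness.\<close>

lemma abs_le_if_deriv_dominated:
  fixes F :: "real \<Rightarrow> real"
  assumes F: "\<And>r. a \<le> r \<Longrightarrow> (F has_real_derivative f r) (at r within {a..})" "(F \<longlongrightarrow> 0) at_top"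
    and W: "\<And>r. a \<le> r \<Longrightarrow> (W has_real_derivative W' r) (at r within {a..})" "(W \<longlongrightarrow> 0) at_top"
    and le: "\<And>r. a \<le> r \<Longrightarrow> \<bar>f r\<bar> \<le> - W' r" and "a \<le> x"
  shows "\<bar>F x\<bar> \<le> W x"
proof -
  have "0 \<le> W x + F x"
  proof (rule nonneg_if_nonincreasing_tendsto_0[OF _ _ _ \<open>a \<le> x\<close>])
    show "((\<lambda>r. W r + F r) has_real_derivative W' r + f r) (at r within {a..})" if "a \<le> r" for r
      using F(1) W(1) that by (intro DERIV_add)
    show "W' r + f r \<le> 0" if "a \<le> r" for r using le[OF that] by linarith
    show "((\<lambda>r. W r + F r) \<longlongrightarrow> 0) at_top" using tendsto_add[OF W(2) F(2)] by simp
  qed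
  moreover have "0 \<le> W x - F x"
  proof (rule nonneg_if_nonincreasing_tendsto_0[OF _ _ _ \<open>a \<le> x\<close>])
    show "((\<lambda>r. W r - F r) has_real_derivative W' r - f r) (at r within {a..})" if "a \<le> r" for r
      using F(1) W(1) that by (intro DERIV_diff)
    show "W' r - f r \<le> 0" if "a \<le> r" for r using le[OF that] by linarith
    show "((\<lambda>r. W r - F r) \<longlongrightarrow> 0) at_top" using tendsto_diff[OF W(2) F(2)] by simp
  qed
  ultimately show ?thesis by linarith
qed

lemma antiderivative_atLeast:
  fixes f :: "real \<Rightarrow> real"
  assumes "continuous_on {a..} f"
  obtains F where "F a = 0" "\<And>r. a \<le> r \<Longrightarrow> (F has_real_derivative f r) (at r within {a..})"
proof -
  have "((\<lambda>x. integral {a..x} f) has_real_derivative f r) (at r within {a..})" if r: "a \<le> r" for r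
  proof -
    have "((\<lambda>x. integral {a..x} f) has_real_derivative f r) (at r within {a..r+1})"
      using assms r by (intro integral_has_real_derivative) (auto intro: continuous_on_subset)
    moreover have "at r within {a..r+1} = at r within {a..}"
      by (rule at_within_nhd[of _ "{..<r+1}"]) auto
    ultimately show ?thesis by simp
  qed
  then show ?thesis using that[of "\<lambda>x. integral {a..x} f"] by simp
qed

text \<open>Convergence at infinity comes from monotonicity: for an antiderivative \<open>G\<close>,
  \<open>G - W\<close> increases while \<open>G + W\<close> decreases, so \<open>G - W\<close> is
  bounded above and converges, and its limit is subtracted from \<open>G\<close>.\<close>

lemma vanishing_antiderivative_exists:
  fixes f :: "real \<Rightarrow> real"
  assumes cont: "continuous_on {a..} f"
    and W: "\<And>r. a \<le> r \<Longrightarrow> (W has_real_derivative W' r) (at r within {a..})" "(W \<longlongrightarrow> 0) at_top"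
    and le: "\<And>r. a \<le> r \<Longrightarrow> \<bar>f r\<bar> \<le> - W' r"
  obtains F where "\<And>r. a \<le> r \<Longrightarrow> (F has_real_derivative f r) (at r within {a..})" "(F \<longlongrightarrow> 0) at_top"
proof -
  obtain G where G: "G a = 0" "\<And>r. a \<le> r \<Longrightarrow> (G has_real_derivative f r) (at r within {a..})"
    using antiderivative_atLeast[OF cont] by blast
  have up: "G x - W x \<le> G y - W y" and dn: "G y + W y \<le> G x + W x" if "a \<le> x" "x \<le> y" for x y
  proof -
    show "G x - W x \<le> G y - W y"
    proof (rule nondecreasing_if_deriv_nonneg[OF _ _ that])
      show "((\<lambda>r. G r - W r) has_real_derivative f r - W' r) (at r within {a..})" if "a \<le> r" for r
        using G(2) W(1) that by (intro DERIV_diff)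
      show "0 \<le> f r - W' r" if "a \<le> r" for r using le[OF that] by linarith
    qed
    have "- (G x + W x) \<le> - (G y + W y)"
    proof (rule nondecreasing_if_deriv_nonneg[OF _ _ that])
      show "((\<lambda>r. - (G r + W r)) has_real_derivative - (f r + W' r)) (at r within {a..})" if "a \<le> r" for r
        using G(2) W(1) that by (intro DERIV_minus DERIV_add)
      show "0 \<le> - (f r + W' r)" if "a \<le> r" for r using le[OF that] by linarith
    qed
    then show "G y + W y \<le> G x + W x" by linarith
  qed
  have Wnn: "0 \<le> W r" if "a \<le> r" for r
    using nonneg_if_nonincreasing_tendsto_0[of a W W' r] W le that by (smt (verit))
  \<comment> \<open>Composing with \<open>max a\<close> turns monotonicity on the half line into
    monotonicity on all reals, as the supremum argument requires.\<close>
  define h where "h = (\<lambda>r. G (max a r) - W (max a r))"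
  have "\<exists>L. (h \<longlongrightarrow> L) at_top"
  proof -
    have m: "mono h" unfolding h_def by (intro monoI up) auto
    have bdd: "h x \<le> G a + W a" for x
      using dn[of a "max a x"] Wnn[of "max a x"] by (auto simp: h_def)
    have "(h \<longlongrightarrow> (SUP x. h x)) at_top"
    proof (rule increasing_tendsto)
      show "\<forall>\<^sub>F x in at_top. h x \<le> (SUP x. h x)"
        using bdd by (intro always_eventually allI cSUP_upper bdd_aboveI2) auto
      fix y assume "y < (SUP x. h x)"
      then obtain x where "y < h x"
        using less_cSUP_iff[of UNIV h y] bdd_aboveI2[of UNIV h, OF bdd] by auto
      then show "\<forall>\<^sub>F x in at_top. y < h x"
        unfolding eventually_at_top_linorder using monoD[OF m] less_le_trans by blast
    qed
    then show ?thesis by blast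
  qed
  then obtain L where L: "(h \<longlongrightarrow> L) at_top" by blast
  have "((\<lambda>r. h r + W r - L) \<longlongrightarrow> L + 0 - L) at_top"
    by (intro tendsto_intros L W)
  moreover have "\<forall>\<^sub>F r in at_top. h r + W r - L = G r - L"
    by (rule eventually_mono[OF eventually_ge_at_top[of a]]) (simp add: h_def max_def)
  ultimately have "((\<lambda>r. G r - L) \<longlongrightarrow> 0) at_top"
    by (simp add: tendsto_cong)
  moreover have "((\<lambda>r. G r - L) has_real_derivative f r) (at r within {a..})" if "a \<le> r" for r
    using DERIV_diff[OF G(2)[OF that] DERIV_const[of L]] by simp
  ultimately show ?thesis using that by blast
qed

section \<open>Inverse powers as barriers, and the heat equation on the half line\<close>

lemma DERIV_inverse_power:
  fixes x :: real assumes "x > 0"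
  shows "((\<lambda>s. 1 / s ^ j) has_real_derivative - real j / x ^ Suc j) (at x within S)"
proof -
  have "((\<lambda>s. 1 / s ^ j) has_real_derivative - (real j * x ^ (j - 1)) / (x ^ j * x ^ j)) (at x within S)"
    using assms by (auto intro!: derivative_eq_intros)
  moreover have "(real j * x ^ (j - 1)) / (x ^ j * x ^ j) = real j / x ^ Suc j"
    using assms by (cases j) (auto simp: field_simps)
  ultimately show ?thesis by simp
qed

lemma tendsto_inverse_power_at_top:
  assumes "0 < j"
  shows "((\<lambda>r::real. c / r ^ j) \<longlongrightarrow> 0) at_top"
proof -
  have "filterlim (\<lambda>r::real. r ^ j) at_top at_top"
    using assms by (intro filterlim_pow_at_top filterlim_ident) auto
  then show ?thesis
    by (intro real_tendsto_divide_at_top[OF tendsto_const])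
qed

lemma tendsto_0_if_decay:
  fixes f :: "real \<Rightarrow> real"
  assumes "\<And>r. a \<le> r \<Longrightarrow> \<bar>f r\<bar> \<le> B / r ^ k" "0 < k"
  shows "(f \<longlongrightarrow> 0) at_top"
proof (rule Lim_null_comparison[OF _ tendsto_inverse_power_at_top[OF \<open>0 < k\<close>, of B]])
  show "\<forall>\<^sub>F r in at_top. norm (f r) \<le> B / r ^ k"
    by (rule eventually_mono[OF eventually_ge_at_top[of a]]) (use assms in simp)
qed

lemma vanishing_antiderivative_decay:
  fixes f F :: "real \<Rightarrow> real"
  assumes F: "\<And>r. a \<le> r \<Longrightarrow> (F has_real_derivative f r) (at r within {a..})" "(F \<longlongrightarrow> 0) at_top"
    and le: "\<And>r. a \<le> r \<Longrightarrow> \<bar>f r\<bar> \<le> A / r ^ Suc k" and "0 < a" "0 < k" "a \<le> x"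
  shows "\<bar>F x\<bar> \<le> A / k / x ^ k"
proof (rule abs_le_if_deriv_dominated[OF F _ _ _ \<open>a \<le> x\<close>])
  show "((\<lambda>r. A / k / r ^ k) has_real_derivative - (A / r ^ Suc k)) (at r within {a..})" if "a \<le> r" for r
    using DERIV_cmult[OF DERIV_inverse_power[of r k "{a..}"], of "A / k"] assms(4,5) that by simp
  show "((\<lambda>r. A / k / r ^ k) \<longlongrightarrow> 0) at_top"
    by (rule tendsto_inverse_power_at_top[OF \<open>0 < k\<close>])
  show "\<bar>f r\<bar> \<le> - (- (A / r ^ Suc k))" if "a \<le> r" for r using le[OF that] by simp
qed

lemma decaying_antiderivative_exists:
  fixes f :: "real \<Rightarrow> real"
  assumes cont: "continuous_on {a..} f"
    and le: "\<And>r. a \<le> r \<Longrightarrow> \<bar>f r\<bar> \<le> A / r ^ Suc k" and "0 < a" "0 < k"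
  obtains F where "\<And>r. a \<le> r \<Longrightarrow> (F has_real_derivative f r) (at r within {a..})" "(F \<longlongrightarrow> 0) at_top"
proof (rule vanishing_antiderivative_exists[OF cont])
  show "((\<lambda>r. A / k / r ^ k) has_real_derivative - (A / r ^ Suc k)) (at r within {a..})" if "a \<le> r" for r
    using DERIV_cmult[OF DERIV_inverse_power[of r k "{a..}"], of "A / k"] assms(3,4) that by simp
  show "((\<lambda>r. A / k / r ^ k) \<longlongrightarrow> 0) at_top"
    by (rule tendsto_inverse_power_at_top[OF \<open>0 < k\<close>])
  show "\<bar>f r\<bar> \<le> - (- (A / r ^ Suc k))" if "a \<le> r" for r using le[OF that] by simp
qed (use that in blast)

text \<open>Up to a multiple \<open>c / r ^ k\<close> of the decaying radial harmonic function, the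
  solution is the vanishing antiderivative \<open>F\<close> of the source term. No size is assumed
  for \<open>E\<close>: it is encoded in \<open>c\<close>, which is recovered from
  \<open>Q a\<close>. Thus \<open>A / (\<kappa> * k)\<close> enters twice, through \<open>F\<close>
  and through \<open>c\<close>.\<close>

lemma heat_equation_estimate:
  fixes H Q :: "real \<Rightarrow> real"
  assumes pos: "0 < a" "0 < k" "0 < \<kappa>"
    and cont: "continuous_on {a..} H" and le: "\<And>r. a \<le> r \<Longrightarrow> \<bar>H r\<bar> \<le> A"
    and Q: "\<And>r. a \<le> r \<Longrightarrow> (Q has_real_derivative (H r - E) / (\<kappa> * r ^ Suc k)) (at r within {a..})"
      "(Q \<longlongrightarrow> 0) at_top" and "a \<le> x"
  shows "\<bar>Q x\<bar> \<le> (a ^ k * \<bar>Q a\<bar> + 2 * A / (\<kappa> * k)) / x ^ k"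
proof -
  let ?f = "\<lambda>r. H r / (\<kappa> * r ^ Suc k)"
  have f_cont: "continuous_on {a..} ?f"
    using pos by (intro continuous_intros cont) auto
  have f_le: "\<bar>?f r\<bar> \<le> (A / \<kappa>) / r ^ Suc k" if "a \<le> r" for r
    using le[OF that] pos that by (simp add: abs_mult divide_simps)
  obtain F where F: "\<And>r. a \<le> r \<Longrightarrow> (F has_real_derivative ?f r) (at r within {a..})" "(F \<longlongrightarrow> 0) at_top"
    using decaying_antiderivative_exists[OF f_cont f_le pos(1,2)] by blast
  have F_le: "\<bar>F r\<bar> \<le> A / (\<kappa> * k) / r ^ k" if "a \<le> r" for r
    using vanishing_antiderivative_decay[OF F f_le pos(1,2) that] by simp
  define c where "c = E / (\<kappa> * k)"
  have eq: "Q r = F r + c / r ^ k" if "a \<le> r" for r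
  proof -
    \<comment> \<open>Comparison with the barrier 0: \<open>Q\<close> and
      \<open>F + c / r ^ k\<close> have the same derivative and the same limit at infinity.\<close>
    have "\<bar>Q r - F r - c * (1 / r ^ k)\<bar> \<le> 0"
    proof (rule abs_le_if_deriv_dominated[OF _ _ DERIV_const tendsto_const _ that])
      show "((\<lambda>r. Q r - F r - c * (1 / r ^ k)) has_real_derivative 0) (at r within {a..})" if "a \<le> r" for r
        using DERIV_diff[OF DERIV_diff[OF Q(1)[OF that] F(1)[OF that]]
              DERIV_cmult[OF DERIV_inverse_power[of r k "{a..}"], of c]] pos that
        by (simp add: c_def field_simps)
      have "((\<lambda>r. Q r - F r - c / r ^ k) \<longlongrightarrow> 0 - 0 - 0) at_top"
        using pos by (intro tendsto_intros Q F tendsto_inverse_power_at_top)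
      then show "((\<lambda>r. Q r - F r - c * (1 / r ^ k)) \<longlongrightarrow> 0) at_top" by simp
    qed auto
    then show ?thesis by simp
  qed
  have "c = a ^ k * (Q a - F a)" using eq[of a] pos by simp
  then have "\<bar>c\<bar> \<le> a ^ k * (\<bar>Q a\<bar> + \<bar>F a\<bar>)"
    using pos by (simp add: abs_mult mult_left_mono)
  moreover have "a ^ k * \<bar>F a\<bar> \<le> A / (\<kappa> * k)"
    using F_le[of a] pos by (simp add: field_simps)
  ultimately have c_le: "\<bar>c\<bar> \<le> a ^ k * \<bar>Q a\<bar> + A / (\<kappa> * k)"
    by (simp add: algebra_simps)
  have "\<bar>Q x\<bar> \<le> \<bar>F x\<bar> + \<bar>c\<bar> / x ^ k"
    using eq[OF \<open>a \<le> x\<close>] pos \<open>a \<le> x\<close> by (metis abs_divide abs_of_pos abs_triangle_ineq less_le_trans zero_less_power)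
  also have "\<dots> \<le> A / (\<kappa> * k) / x ^ k + (a ^ k * \<bar>Q a\<bar> + A / (\<kappa> * k)) / x ^ k"
    using F_le[OF \<open>a \<le> x\<close>] c_le pos \<open>a \<le> x\<close> by (intro add_mono divide_right_mono) auto
  finally show ?thesis by (simp add: add_divide_distrib)
qed

text \<open>\<open>E\<close> plays the role of a shooting parameter: adding \<open>c / r ^ k\<close>
  shifts the boundary value freely without disturbing the limit at infinity, and appears in the
  equation as \<open>E = c * \<kappa> * k\<close>.\<close>

lemma heat_equation_exists:
  fixes H :: "real \<Rightarrow> real"
  assumes pos: "0 < a" "0 < k" "0 < \<kappa>"
    and cont: "continuous_on {a..} H" and le: "\<And>r. a \<le> r \<Longrightarrow> \<bar>H r\<bar> \<le> A"
  obtains Q E where "Q a = q0"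
    "\<And>r. a \<le> r \<Longrightarrow> (Q has_real_derivative (H r - E) / (\<kappa> * r ^ Suc k)) (at r within {a..})"
    "(Q \<longlongrightarrow> 0) at_top"
proof -
  let ?f = "\<lambda>r. H r / (\<kappa> * r ^ Suc k)"
  have f_cont: "continuous_on {a..} ?f"
    using pos by (intro continuous_intros cont) auto
  have f_le: "\<bar>?f r\<bar> \<le> (A / \<kappa>) / r ^ Suc k" if "a \<le> r" for r
    using le[OF that] pos that by (simp add: abs_mult divide_simps)
  obtain F where F: "\<And>r. a \<le> r \<Longrightarrow> (F has_real_derivative ?f r) (at r within {a..})" "(F \<longlongrightarrow> 0) at_top"
    using decaying_antiderivative_exists[OF f_cont f_le pos(1,2)] by blast
  define c where "c = a ^ k * (q0 - F a)"
  show ?thesis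
  proof (rule that)
    show "F a + c * (1 / a ^ k) = q0" using pos by (simp add: c_def)
    show "((\<lambda>r. F r + c * (1 / r ^ k)) has_real_derivative (H r - c * \<kappa> * k) / (\<kappa> * r ^ Suc k))
        (at r within {a..})" if "a \<le> r" for r
      using DERIV_add[OF F(1)[OF that] DERIV_cmult[OF DERIV_inverse_power[of r k "{a..}"], of c]] pos that
      by (simp add: field_simps)
    have "((\<lambda>r. F r + c / r ^ k) \<longlongrightarrow> 0 + 0) at_top"
      using pos by (intro tendsto_intros F tendsto_inverse_power_at_top)
    then show "((\<lambda>r. F r + c * (1 / r ^ k)) \<longlongrightarrow> 0) at_top" by simp
  qed
qed

section \<open>The singularly perturbed relaxation equation\<close>

lemma DERIV_exp_power:
  fixes r :: real
  assumes "\<gamma> = \<beta> / (real (k + 2) * M)"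
  shows "((\<lambda>r. exp (\<gamma> * r ^ (k + 2))) has_real_derivative \<beta> * r ^ Suc k / M * exp (\<gamma> * r ^ (k + 2))) (at r within S)"
proof -
  have "\<gamma> * real (k + 2) = \<beta> / M" by (simp add: assms del: of_nat_add)
  then have "\<gamma> * (real (k + 2) * r ^ Suc k) = \<beta> * r ^ Suc k / M"
    by (metis mult.assoc mult.commute times_divide_eq_left)
  moreover have "((\<lambda>r. exp (\<gamma> * r ^ (k + 2))) has_real_derivative
      exp (\<gamma> * r ^ (k + 2)) * (\<gamma> * (real (k + 2) * r ^ Suc k))) (at r within S)"
    by (rule derivative_eq_intros refl)+ simp
  ultimately show ?thesis by (simp add: mult.commute)
qed

text \<open>The barrier \<open>2 * A / r ^ k\<close> is a supersolution: half of it pays for the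
  forcing, the other half for its own decrease, as soon as the rate
  \<open>\<beta> * r ^ Suc k / M\<close> is at least \<open>2 * k / r\<close>. By monotonicity in
  \<open>r\<close> this has to be checked at \<open>a\<close> only, which is \<open>small\<close>.
  The resulting bound does not contain \<open>M\<close>.\<close>

lemma relaxation_estimate_stable:
  fixes y g :: "real \<Rightarrow> real"
  assumes pos: "0 < a" "0 < \<beta>" "0 < M" and small: "2 * real k * M \<le> \<beta> * a ^ (k + 2)"
    and y: "\<And>r. a \<le> r \<Longrightarrow> (y has_real_derivative - (\<beta> * r ^ Suc k / M) * (y r - g r)) (at r within {a..})"
    and g: "\<And>r. a \<le> r \<Longrightarrow> \<bar>g r\<bar> \<le> A / r ^ k" and ya: "\<bar>y a\<bar> \<le> 2 * A / a ^ k" and "a \<le> x"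
  shows "\<bar>y x\<bar> \<le> 2 * A / x ^ k"
proof -
  define \<gamma> where "\<gamma> = \<beta> / (real (k + 2) * M)"
  have A: "0 \<le> A" using g[of a] pos by (smt (verit) divide_neg_pos zero_less_power)
  have main: "z x \<le> 2 * A / x ^ k"
    if z: "\<And>r. a \<le> r \<Longrightarrow> (z has_real_derivative - (\<beta> * r ^ Suc k / M) * (z r - h r)) (at r within {a..})"
      and h: "\<And>r. a \<le> r \<Longrightarrow> h r \<le> A / r ^ k" and za: "z a \<le> 2 * A / a ^ k" for z h
  proof -
    let ?e = "\<lambda>r. exp (\<gamma> * r ^ (k + 2))"
    have "?e a * (2 * A * (1 / a ^ k) - z a) \<le> ?e x * (2 * A * (1 / x ^ k) - z x)"
    proof (rule nondecreasing_if_deriv_nonneg[OF _ _ order_refl \<open>a \<le> x\<close>])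
      fix r assume r: "a \<le> r"
      show "((\<lambda>r. ?e r * (2 * A * (1 / r ^ k) - z r)) has_real_derivative
         (\<beta> * r ^ Suc k / M * ?e r) * (2 * A * (1 / r ^ k) - z r) +
         (2 * A * (- real k / r ^ Suc k) - - (\<beta> * r ^ Suc k / M) * (z r - h r)) * ?e r) (at r within {a..})"
        using r pos by (intro DERIV_mult DERIV_diff DERIV_cmult z DERIV_exp_power DERIV_inverse_power \<gamma>_def) auto
      have b: "0 < \<beta> * r ^ Suc k / M" using r pos by simp
      have "a ^ (k + 2) \<le> r ^ (k + 2)" using r pos by (intro power_mono) auto
      then have "2 * real k * M \<le> \<beta> * r ^ (k + 2)"
        using small pos by (smt (verit) mult_left_mono)
      then have kr: "2 * real k / r ^ Suc k \<le> (\<beta> * r ^ Suc k / M) * (1 / r ^ k)"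
        using r pos by (simp add: field_simps)
      \<comment> \<open>With the integrating factor pulled out, the derivative splits into two
        nonnegative terms: the rate times the slack in the forcing bound, and \<open>A\<close> times
        the slack from \<open>kr\<close>.\<close>
      have "(\<beta> * r ^ Suc k / M * ?e r) * (2 * A * (1 / r ^ k) - z r) +
         (2 * A * (- real k / r ^ Suc k) - - (\<beta> * r ^ Suc k / M) * (z r - h r)) * ?e r
        = ?e r * ((\<beta> * r ^ Suc k / M) * (A / r ^ k - h r)
           + A * ((\<beta> * r ^ Suc k / M) * (1 / r ^ k) - 2 * real k / r ^ Suc k))"
      proof -
        have "(b * e) * (2 * A * w - z r) + (2 * A * (- t) - - b * (z r - h r)) * e
          = e * (b * (A * w - h r) + A * (b * w - 2 * t))" for b e w t :: real
          by (simp add: algebra_simps)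
        from this[of "\<beta> * r ^ Suc k / M" "?e r" "1 / r ^ k" "real k / r ^ Suc k"]
        show ?thesis by simp
      qed
      also have "\<dots> \<ge> 0"
        using b kr h[OF r] A by (intro mult_nonneg_nonneg add_nonneg_nonneg) auto
      finally show "0 \<le> (\<beta> * r ^ Suc k / M * ?e r) * (2 * A * (1 / r ^ k) - z r) +
         (2 * A * (- real k / r ^ Suc k) - - (\<beta> * r ^ Suc k / M) * (z r - h r)) * ?e r" .
    qed
    moreover have "0 \<le> ?e a * (2 * A * (1 / a ^ k) - z a)" using za by simp
    ultimately have "0 \<le> ?e x * (2 * A * (1 / x ^ k) - z x)" by linarith
    then show ?thesis by (simp add: zero_le_mult_iff)
  qed
  have "y x \<le> 2 * A / x ^ k"
    by (rule main[OF y]) (use g ya in \<open>auto simp: abs_le_iff\<close>)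
  moreover have "- y x \<le> 2 * A / x ^ k"
  proof (rule main)
    show "((\<lambda>r. - y r) has_real_derivative - (\<beta> * r ^ Suc k / M) * (- y r - - g r)) (at r within {a..})"
      if "a \<le> r" for r
    proof (rule DERIV_cong[OF DERIV_minus[OF y[OF that]]])
      have "- (- b * (y r - g r)) = - b * (- y r - - g r)" for b
        by (simp add: algebra_simps)
      then show "- (- (\<beta> * r ^ Suc k / M) * (y r - g r)) = - (\<beta> * r ^ Suc k / M) * (- y r - - g r)" .
    qed
  qed (use g ya in \<open>auto simp: abs_le_iff\<close>)
  ultimately show ?thesis by linarith
qed

lemma tendsto_exp_power_0:
  assumes "\<gamma> < 0" "0 < j"
  shows "((\<lambda>r::real. exp (\<gamma> * r ^ j)) \<longlongrightarrow> 0) at_top"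
proof -
  have "filterlim (\<lambda>r::real. r ^ j) at_top at_top"
    using assms by (intro filterlim_pow_at_top filterlim_ident) auto
  then have "filterlim (\<lambda>r::real. \<gamma> * r ^ j) at_bot at_top"
    using assms by (intro filterlim_tendsto_neg_mult_at_bot[OF tendsto_const]) auto
  then show ?thesis
    by (rule filterlim_compose[OF exp_at_bot])
qed

text \<open>Nonzero solutions of the homogeneous equation grow like
  \<open>exp (\<bar>\<gamma>\<bar> * r ^ (k + 2))\<close>, so boundedness of \<open>y\<close> takes
  the place of a boundary value. The integrating factor now decays and sends any bounded difference
  to 0 at infinity, from where the comparison starts.\<close>

lemma relaxation_estimate_unstable:
  fixes y g :: "real \<Rightarrow> real"
  assumes pos: "0 < a" "0 < \<beta>" "M < 0"
    and y: "\<And>r. a \<le> r \<Longrightarrow> (y has_real_derivative - (\<beta> * r ^ Suc k / M) * (y r - g r)) (at r within {a..})"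
    and g: "\<And>r. a \<le> r \<Longrightarrow> \<bar>g r\<bar> \<le> A / r ^ k" and bdd: "\<And>r. a \<le> r \<Longrightarrow> \<bar>y r\<bar> \<le> B" and "a \<le> x"
  shows "\<bar>y x\<bar> \<le> A / x ^ k"
proof -
  define \<gamma> where "\<gamma> = \<beta> / (real (k + 2) * M)"
  have \<gamma>: "\<gamma> < 0" using pos by (simp add: \<gamma>_def divide_less_0_iff mult_less_0_iff del: of_nat_add)
  have A: "0 \<le> A" using g[of a] pos by (smt (verit) divide_neg_pos zero_less_power)
  have main: "z x \<le> A / x ^ k"
    if z: "\<And>r. a \<le> r \<Longrightarrow> (z has_real_derivative - (\<beta> * r ^ Suc k / M) * (z r - h r)) (at r within {a..})"
      and h: "\<And>r. a \<le> r \<Longrightarrow> h r \<le> A / r ^ k" and bz: "\<And>r. a \<le> r \<Longrightarrow> \<bar>z r\<bar> \<le> B" for z h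
  proof -
    let ?e = "\<lambda>r. exp (\<gamma> * r ^ (k + 2))"
    let ?c = "A / x ^ k"
    have "0 \<le> ?e x * (?c - z x)"
    \<comment> \<open>The half line is restarted at \<open>x\<close>: there the constant
      \<open>A / x ^ k\<close> dominates the forcing throughout, so a constant barrier suffices and
      its value at \<open>x\<close> is the claim.\<close>
    proof (rule nonneg_if_nonincreasing_tendsto_0[where f = "\<lambda>r. ?e r * (?c - z r)", OF _ _ _ order_refl])
      fix r assume r: "x \<le> r"
      then have ar: "a \<le> r" using \<open>a \<le> x\<close> by simp
      have z': "(z has_real_derivative - (\<beta> * r ^ Suc k / M) * (z r - h r)) (at r within {x..})"
        by (rule DERIV_subset[OF z[OF ar]]) (use \<open>a \<le> x\<close> in auto)
      show "((\<lambda>r. ?e r * (?c - z r)) has_real_derivative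
         (\<beta> * r ^ Suc k / M * ?e r) * (?c - z r) +
         (0 - - (\<beta> * r ^ Suc k / M) * (z r - h r)) * ?e r) (at r within {x..})"
        by (intro DERIV_mult DERIV_diff DERIV_const z' DERIV_exp_power \<gamma>_def)
      have b: "\<beta> * r ^ Suc k / M < 0" using ar pos by (simp add: divide_less_0_iff mult_less_0_iff)
      have "h r \<le> A / r ^ k" by (rule h[OF ar])
      also have "\<dots> \<le> ?c"
        using r pos \<open>a \<le> x\<close> A by (intro divide_left_mono power_mono mult_pos_pos) auto
      finally have "0 \<le> ?e r * (?c - h r)" by simp
      have "(\<beta> * r ^ Suc k / M * ?e r) * (?c - z r) +
         (0 - - (\<beta> * r ^ Suc k / M) * (z r - h r)) * ?e r = (\<beta> * r ^ Suc k / M) * (?e r * (?c - h r))"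
      proof -
        have "(b * e) * (c - z r) + (0 - - b * (z r - h r)) * e = b * (e * (c - h r))" for b c e :: real
          by (simp add: algebra_simps)
        then show ?thesis .
      qed
      also have "\<dots> \<le> 0"
        using b \<open>0 \<le> ?e r * (?c - h r)\<close> by (intro mult_nonpos_nonneg) auto
      finally show "(\<beta> * r ^ Suc k / M * ?e r) * (?c - z r) +
         (0 - - (\<beta> * r ^ Suc k / M) * (z r - h r)) * ?e r \<le> 0" .
    next
      have "((\<lambda>r. ?e r * (\<bar>?c\<bar> + B)) \<longlongrightarrow> 0 * (\<bar>?c\<bar> + B)) at_top"
        using \<gamma> by (intro tendsto_intros tendsto_exp_power_0) auto
      then have lim: "((\<lambda>r. ?e r * (\<bar>?c\<bar> + B)) \<longlongrightarrow> 0) at_top" by simp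
      show "((\<lambda>r. ?e r * (?c - z r)) \<longlongrightarrow> 0) at_top"
      proof (rule Lim_null_comparison[OF _ lim])
        show "\<forall>\<^sub>F r in at_top. norm (?e r * (?c - z r)) \<le> ?e r * (\<bar>?c\<bar> + B)"
        proof (rule eventually_mono[OF eventually_ge_at_top[of a]])
          fix r assume "a \<le> r"
          then have "\<bar>?c - z r\<bar> \<le> \<bar>?c\<bar> + B" using bz[of r] by linarith
          then show "norm (?e r * (?c - z r)) \<le> ?e r * (\<bar>?c\<bar> + B)"
            by (simp add: abs_mult)
        qed
      qed
    qed
    then show ?thesis by (simp add: zero_le_mult_iff)
  qed
  have "y x \<le> A / x ^ k"
    by (rule main[OF y]) (use g bdd in \<open>auto simp: abs_le_iff\<close>)
  moreover have "- y x \<le> A / x ^ k"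
  proof (rule main)
    show "((\<lambda>r. - y r) has_real_derivative - (\<beta> * r ^ Suc k / M) * (- y r - - g r)) (at r within {a..})"
      if "a \<le> r" for r
    proof (rule DERIV_cong[OF DERIV_minus[OF y[OF that]]])
      have "- (- b * (y r - g r)) = - b * (- y r - - g r)" for b
        by (simp add: algebra_simps)
      then show "- (- (\<beta> * r ^ Suc k / M) * (y r - g r)) = - (\<beta> * r ^ Suc k / M) * (- y r - - g r)" .
    qed
  qed (use g bdd in \<open>auto simp: abs_le_iff\<close>)
  ultimately show ?thesis by linarith
qed

lemma relaxation_estimate:
  fixes y g :: "real \<Rightarrow> real"
  assumes pos: "0 < a" "0 < \<beta>" "M \<noteq> 0" and small: "2 * real k * M \<le> \<beta> * a ^ (k + 2)"
    and y: "\<And>r. a \<le> r \<Longrightarrow> (y has_real_derivative - (\<beta> * r ^ Suc k / M) * (y r - g r)) (at r within {a..})"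
    and g: "\<And>r. a \<le> r \<Longrightarrow> \<bar>g r\<bar> \<le> A / r ^ k"
    and ya: "0 < M \<Longrightarrow> \<bar>y a\<bar> \<le> 2 * A / a ^ k"
    and bdd: "\<And>r. a \<le> r \<Longrightarrow> \<bar>y r\<bar> \<le> B" and "a \<le> x"
  shows "\<bar>y x\<bar> \<le> 2 * A / x ^ k"
proof (cases "0 < M")
  case True
  then show ?thesis
    using relaxation_estimate_stable[OF pos(1,2) True small y g _ \<open>a \<le> x\<close>] ya by blast
next
  case False
  then have M: "M < 0" using pos(3) by simp
  have "\<bar>y x\<bar> \<le> A / x ^ k"
    by (rule relaxation_estimate_unstable[OF pos(1,2) M y g bdd \<open>a \<le> x\<close>])
  moreover have "0 \<le> A / x ^ k" using calculation by linarith
  ultimately show ?thesis by simp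
qed

text \<open>Variation of constants; the sign of \<open>M\<close> decides whether the weighted
  forcing \<open>?f\<close> is integrated from \<open>a\<close> or from infinity. In the second case
  the integral converges because the integrating factor decays.\<close>

lemma relaxation_exists:
  fixes g :: "real \<Rightarrow> real"
  assumes pos: "0 < a" "0 < \<beta>" "M \<noteq> 0" and small: "2 * real k * M \<le> \<beta> * a ^ (k + 2)"
    and cont: "continuous_on {a..} g" and g: "\<And>r. a \<le> r \<Longrightarrow> \<bar>g r\<bar> \<le> A / r ^ k"
    and y0: "0 < M \<Longrightarrow> \<bar>y0\<bar> \<le> 2 * A / a ^ k"
  obtains y where
    "\<And>r. a \<le> r \<Longrightarrow> (y has_real_derivative - (\<beta> * r ^ Suc k / M) * (y r - g r)) (at r within {a..})"
    "0 < M \<Longrightarrow> y a = y0" "\<And>r. a \<le> r \<Longrightarrow> \<bar>y r\<bar> \<le> 2 * A / r ^ k"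
proof -
  define \<gamma> where "\<gamma> = \<beta> / (real (k + 2) * M)"
  let ?e = "\<lambda>r. exp (\<gamma> * r ^ (k + 2))"
  let ?f = "\<lambda>r. \<beta> * r ^ Suc k / M * ?e r * g r"
  have A: "0 \<le> A" using g[of a] pos by (smt (verit) divide_neg_pos zero_less_power)
  have f_cont: "continuous_on {a..} ?f"
    using pos by (intro continuous_intros cont) auto
  have sol: "((\<lambda>r. exp (- \<gamma> * r ^ (k + 2)) * Y r) has_real_derivative
      - (\<beta> * r ^ Suc k / M) * (exp (- \<gamma> * r ^ (k + 2)) * Y r - g r)) (at r within {a..})"
    if Y: "(Y has_real_derivative ?f r) (at r within {a..})" for Y r
  proof -
    have "- \<gamma> = \<beta> / (real (k + 2) * - M)" by (simp add: \<gamma>_def)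
    from DERIV_mult[OF DERIV_exp_power[OF this] Y]
    have "((\<lambda>r. exp (- \<gamma> * r ^ (k + 2)) * Y r) has_real_derivative
       \<beta> * r ^ Suc k / - M * exp (- \<gamma> * r ^ (k + 2)) * Y r + ?f r * exp (- \<gamma> * r ^ (k + 2))) (at r within {a..})" .
    moreover have "?f r * exp (- \<gamma> * r ^ (k + 2)) = \<beta> * r ^ Suc k / M * g r"
      using exp_add[of "\<gamma> * r ^ (k + 2)" "- \<gamma> * r ^ (k + 2)"] by (simp add: mult.commute mult.left_commute)
    ultimately show ?thesis
      by (elim DERIV_cong) (simp only:, simp add: algebra_simps)
  qed
  show ?thesis
  proof (cases "0 < M")
    case True
    obtain G where G: "G a = 0" "\<And>r. a \<le> r \<Longrightarrow> (G has_real_derivative ?f r) (at r within {a..})"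
      using antiderivative_atLeast[OF f_cont] by blast
    define y where "y r = exp (- \<gamma> * r ^ (k + 2)) * (G r + y0 * ?e a)" for r
    have y: "(y has_real_derivative - (\<beta> * r ^ Suc k / M) * (y r - g r)) (at r within {a..})" if "a \<le> r" for r
      unfolding y_def
      by (rule sol) (use DERIV_add[OF G(2)[OF that] DERIV_const[of "y0 * ?e a"]] in simp)
    have ya: "y a = y0" using G by (simp add: y_def mult.commute mult.left_commute flip: exp_add)
    show ?thesis
      using that[OF y ya] relaxation_estimate_stable[OF pos(1,2) True small y g] ya y0[OF True] by auto
  next
    case False
    then have M: "M < 0" using pos(3) by simp
    have \<gamma>: "\<gamma> < 0" using pos M by (simp add: \<gamma>_def divide_less_0_iff mult_less_0_iff del: of_nat_add)
    \<comment> \<open>\<open>?A * ?e r\<close> is the barrier at infinity: its derivative dominates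
      the integrand because \<open>\<bar>g r\<bar>\<close> never exceeds \<open>A / a ^ k\<close>.
      The bound it gives for \<open>y\<close> has no decay, but it suffices to enter the estimate
      for bounded solutions.\<close>
    let ?A = "A / a ^ k"
    have W: "((\<lambda>r. ?A * ?e r) has_real_derivative ?A * (\<beta> * r ^ Suc k / M * ?e r)) (at r within {a..})" for r
      by (intro DERIV_cmult DERIV_exp_power \<gamma>_def)
    have "((\<lambda>r. ?A * ?e r) \<longlongrightarrow> ?A * 0) at_top"
      using \<gamma> by (intro tendsto_intros tendsto_exp_power_0) auto
    then have W0: "((\<lambda>r. ?A * ?e r) \<longlongrightarrow> 0) at_top" by simp
    have le: "\<bar>?f r\<bar> \<le> - (?A * (\<beta> * r ^ Suc k / M * ?e r))" if "a \<le> r" for r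
    proof -
      have b: "\<beta> * r ^ Suc k / M < 0" using that pos M by (simp add: divide_less_0_iff mult_less_0_iff)
      have "A / r ^ k \<le> ?A"
        using that pos A by (intro divide_left_mono power_mono mult_pos_pos) auto
      then have gA: "\<bar>g r\<bar> \<le> ?A" using g[OF that] by linarith
      have "\<bar>?f r\<bar> = (- (\<beta> * r ^ Suc k / M) * ?e r) * \<bar>g r\<bar>"
        using b by (simp only: abs_mult abs_of_neg abs_exp_cancel)
      also have "\<dots> \<le> (- (\<beta> * r ^ Suc k / M) * ?e r) * ?A"
        using b gA by (intro mult_left_mono mult_nonneg_nonneg) auto
      finally show ?thesis by (simp add: algebra_simps)
    qed
    obtain Y where Y: "\<And>r. a \<le> r \<Longrightarrow> (Y has_real_derivative ?f r) (at r within {a..})" "(Y \<longlongrightarrow> 0) at_top"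
      using vanishing_antiderivative_exists[OF f_cont W W0 le] by blast
    define y where "y r = exp (- \<gamma> * r ^ (k + 2)) * Y r" for r
    have y: "(y has_real_derivative - (\<beta> * r ^ Suc k / M) * (y r - g r)) (at r within {a..})" if "a \<le> r" for r
      unfolding y_def by (rule sol) (rule Y(1)[OF that])
    have bdd: "\<bar>y r\<bar> \<le> ?A" if "a \<le> r" for r
    proof -
      have "\<bar>Y r\<bar> \<le> ?A * ?e r"
        by (rule abs_le_if_deriv_dominated[OF Y W W0 le that])
      then have "exp (- \<gamma> * r ^ (k + 2)) * \<bar>Y r\<bar> \<le> exp (- \<gamma> * r ^ (k + 2)) * (?A * ?e r)"
        by (intro mult_left_mono) auto
      also have "\<dots> = ?A" by (simp add: mult.commute mult.left_commute flip: exp_add)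
      finally show ?thesis by (simp add: y_def abs_mult)
    qed
    show ?thesis
      using that[OF y] relaxation_estimate[OF pos small y g _ bdd] False by blast
  qed
qed

section \<open>A weighted contraction principle and the Lipschitz terms\<close>

text \<open>Banach's fixed point theorem for the multivalued solution map of a linearised problem: functions agreeing on
  \<open>S\<close> are not identified, so the fixed point is a pair of functions that agree on \<open>S\<close>.\<close>

lemma relational_contraction:
  fixes St :: "(real \<Rightarrow> 'a::banach) \<Rightarrow> (real \<Rightarrow> 'a) \<Rightarrow> bool" and w :: "real \<Rightarrow> real" and K B :: real and S :: "real set"
  defines "X \<equiv> \<lambda>f. continuous_on S f \<and> (\<forall>r\<in>S. norm (f r) \<le> K * w r)"
  assumes w: "\<And>r. r \<in> S \<Longrightarrow> 0 \<le> w r" "\<And>r. r \<in> S \<Longrightarrow> w r \<le> B" and K: "0 \<le> K"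
    and ex: "\<And>f. X f \<Longrightarrow> \<exists>g. X g \<and> St f g"
    and contr: "\<And>f1 f2 g1 g2 D r. X f1 \<Longrightarrow> X f2 \<Longrightarrow> St f1 g1 \<Longrightarrow> St f2 g2 \<Longrightarrow> 0 \<le> D \<Longrightarrow>
      (\<And>r. r \<in> S \<Longrightarrow> norm (f1 r - f2 r) \<le> D * w r) \<Longrightarrow> r \<in> S \<Longrightarrow> norm (g1 r - g2 r) \<le> D / 2 * w r"
  obtains f g where "X f" "X g" "St f g" "\<And>r. r \<in> S \<Longrightarrow> f r = g r"
proof -
  \<comment> \<open>Iteration from 0 with an arbitrary image inside \<open>X\<close> at each stage;
    by \<open>contr\<close> the choice matters only off \<open>S\<close>.\<close>
  define z where "z = rec_nat (\<lambda>r. 0) (\<lambda>i f. SOME g. X g \<and> St f g)"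
  have X0: "X (z 0)" using w K by (auto simp: X_def z_def)
  have step: "X (z (Suc i)) \<and> St (z i) (z (Suc i))" if "X (z i)" for i
    using someI_ex[OF ex[OF that]] by (simp add: z_def)
  have X: "X (z i)" for i by (induction i) (use X0 step in auto)
  have diff: "norm (z (Suc i) r - z i r) \<le> 2 * K / 2 ^ i * w r" if "r \<in> S" for i r
    using that
  proof (induction i arbitrary: r)
    case 0
    have "norm (z (Suc 0) r - z 0 r) \<le> K * w r"
      using X[of "Suc 0"] 0 by (simp add: X_def z_def)
    also have "\<dots> \<le> 2 * K * w r" using K w(1)[OF 0] by simp
    finally show ?case by simp
  next
    case (Suc i)
    have "norm (z (Suc (Suc i)) r - z (Suc i) r) \<le> (2 * K / 2 ^ i) / 2 * w r"
      by (rule contr[of "z (Suc i)" "z i"]) (use X step K Suc in auto)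
    then show ?case by (simp add: mult.commute)
  qed
  have sum: "(\<Sum>i<n. z (Suc i) r - z i r) = z n r" for n r
    by (induction n) (auto simp: z_def)
  have far: "norm (z (n + j) r - z n r) \<le> 4 * K / 2 ^ n * (1 - 1 / 2 ^ j) * w r" if "r \<in> S" for n j r
  proof (induction j)
    case (Suc j)
    have "norm (z (n + Suc j) r - z n r) \<le> norm (z (Suc (n + j)) r - z (n + j) r) + norm (z (n + j) r - z n r)"
      using norm_triangle_ineq[of "z (Suc (n + j)) r - z (n + j) r" "z (n + j) r - z n r"] by simp
    also have "\<dots> \<le> 2 * K / 2 ^ (n + j) * w r + 4 * K / 2 ^ n * (1 - 1 / 2 ^ j) * w r"
      using diff[OF that] Suc by (intro add_mono) auto
    also have "\<dots> = 4 * K / 2 ^ n * (1 - 1 / 2 ^ Suc j) * w r"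
      by (simp add: field_simps power_add)
    finally show ?case .
  qed simp
  define f where "f r = (\<Sum>i. z (Suc i) r - z i r)" for r
  \<comment> \<open>Since \<open>z 0\<close> is 0, the iterates are the partial sums of their
    increments, to which the M-test applies; the bound \<open>B\<close> of the weight makes the
    majorant independent of \<open>r\<close>.\<close>
  have "uniform_limit S (\<lambda>n r. \<Sum>i<n. z (Suc i) r - z i r) f sequentially"
    unfolding f_def
  proof (rule Weierstrass_m_test)
    show "norm (z (Suc i) r - z i r) \<le> 2 * K * B * (1 / 2) ^ i" if "r \<in> S" for i r
    proof -
      have "2 * K / 2 ^ i * w r \<le> 2 * K / 2 ^ i * B" using K w(2)[OF that] by (intro mult_left_mono) auto
      then show ?thesis using diff[OF that, of i] by (simp add: power_divide mult.assoc mult.commute)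
    qed
    show "summable (\<lambda>i. 2 * K * B * (1 / 2) ^ i)"
      by (intro summable_mult summable_geometric) simp
  qed
  then have ul: "uniform_limit S z f sequentially" by (simp add: sum)
  have lim: "(\<lambda>n. z n r) \<longlonglongrightarrow> f r" if "r \<in> S" for r
    using tendsto_uniform_limitI[OF ul that] .
  have Xf: "X f"
    unfolding X_def
  proof (intro conjI ballI)
    show "continuous_on S f"
      by (rule uniform_limit_theorem[OF _ ul]) (use X in \<open>auto simp: X_def\<close>)
    show "norm (f r) \<le> K * w r" if "r \<in> S" for r
      by (rule Lim_bounded[OF tendsto_norm[OF lim[OF that]], of 0]) (use X that in \<open>auto simp: X_def\<close>)
  qed
  have near: "norm (z n r - f r) \<le> 4 * K / 2 ^ n * w r" if "r \<in> S" for n r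
  proof -
    have "(\<lambda>j. norm (z n r - z (j + n) r)) \<longlonglongrightarrow> norm (z n r - f r)"
      by (intro tendsto_intros LIMSEQ_ignore_initial_segment lim that)
    then show ?thesis
    proof (rule Lim_bounded[of _ _ 0], intro allI impI)
      fix j
      have "norm (z n r - z (j + n) r) \<le> 4 * K / 2 ^ n * (1 - 1 / 2 ^ j) * w r"
        using far[OF that, of n j] by (simp add: norm_minus_commute add.commute)
      also have "\<dots> \<le> 4 * K / 2 ^ n * 1 * w r"
        using K w(1)[OF that] by (intro mult_right_mono mult_left_mono) auto
      finally show "norm (z n r - z (j + n) r) \<le> 4 * K / 2 ^ n * w r" by simp
    qed
  qed
  obtain g where g: "X g" "St f g" using ex[OF Xf] by blast
  have "f r = g r" if "r \<in> S" for r
  proof -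
    \<comment> \<open>\<open>z (Suc n)\<close> is an image of \<open>z n\<close>, and
      \<open>g\<close> is an image of \<open>f\<close>. As \<open>z n\<close> approaches
      \<open>f\<close>, contraction drives \<open>z (Suc n)\<close> to \<open>g\<close> as well, so
      \<open>f\<close> and \<open>g\<close> are limits of the same sequence.\<close>
    have le: "norm (z (Suc n) r - g r) \<le> 2 * K * w r * (1 / 2) ^ n" for n
    proof -
      have "norm (z (Suc n) r - g r) \<le> 4 * K / 2 ^ n / 2 * w r"
        by (rule contr[of "z n" f]) (use X Xf g step near that K in auto)
      then show ?thesis by (simp add: power_divide)
    qed
    have "(\<lambda>n. 2 * K * w r * (1 / 2 :: real) ^ n) \<longlonglongrightarrow> 2 * K * w r * 0"
      by (intro tendsto_intros LIMSEQ_realpow_zero) auto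
    then have "(\<lambda>n. 2 * K * w r * (1 / 2 :: real) ^ n) \<longlonglongrightarrow> 0" by simp
    then have "(\<lambda>n. z (Suc n) r - g r) \<longlonglongrightarrow> 0"
      by (rule Lim_null_comparison[rotated]) (intro always_eventually allI le)
    moreover have "(\<lambda>n. z (Suc n) r - g r) \<longlonglongrightarrow> f r - g r"
      by (intro tendsto_intros LIMSEQ_Suc lim that)
    ultimately show ?thesis using LIMSEQ_unique by fastforce
  qed
  then show ?thesis using that Xf g by blast
qed

lemma abs_mult_diff_le:
  fixes a b a' b' :: real
  assumes "\<bar>a\<bar> \<le> A" "\<bar>b'\<bar> \<le> B" "\<bar>a - a'\<bar> \<le> x" "\<bar>b - b'\<bar> \<le> y"
  shows "\<bar>a * b - a' * b'\<bar> \<le> A * y + x * B"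
proof -
  have "a * b - a' * b' = a * (b - b') + (a - a') * b'" by (simp add: algebra_simps)
  then have "\<bar>a * b - a' * b'\<bar> \<le> \<bar>a\<bar> * \<bar>b - b'\<bar> + \<bar>a - a'\<bar> * \<bar>b'\<bar>"
    by (metis abs_mult abs_triangle_ineq)
  also have "\<dots> \<le> A * y + x * B"
    using assms by (intro add_mono mult_mono) auto
  finally show ?thesis .
qed

section \<open>Parameters and the calculus of bounded Lipschitz functionals\<close>

locale gas_parameters =
  fixes k :: nat and r0 cV R nu mu kappa vp tp :: real
  assumes k_pos: "0 < k" and r0_pos: "0 < r0" and cV_pos: "0 < cV" and R_pos: "0 < R"
    and nu_pos: "0 < nu" and mu_pos: "0 < mu" and kappa_pos: "0 < kappa"
    and vp_pos: "0 < vp" and tp_pos: "0 < tp"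
begin

text \<open>Here \<open>n = k + 2\<close>, and \<open>p\<close>, \<open>q\<close> are the deviations of the specific volume \<open>1 / \<rho>\<close> and of the temperature
  from their limits \<open>vp\<close> and \<open>tp\<close>; the number \<open>u\<close> is the boundary velocity.\<close>

definition adm :: "(real \<Rightarrow> real) \<Rightarrow> (real \<Rightarrow> real) \<Rightarrow> bool" where
  "adm p q \<longleftrightarrow> continuous_on {r0..} p \<and> continuous_on {r0..} q \<and>
     (\<forall>r\<ge>r0. \<bar>p r\<bar> \<le> vp / 2 \<and> \<bar>q r\<bar> \<le> 1)"

definition close :: "real \<Rightarrow> (real \<Rightarrow> real) \<Rightarrow> (real \<Rightarrow> real) \<Rightarrow> (real \<Rightarrow> real) \<Rightarrow> (real \<Rightarrow> real) \<Rightarrow> bool" where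
  "close D p q p' q' \<longleftrightarrow> (\<forall>r\<ge>r0. \<bar>p r - p' r\<bar> \<le> D / r ^ k \<and> \<bar>q r - q' r\<bar> \<le> D / r ^ k)"

text \<open>\<open>F\<close> takes whole functions \<open>p\<close> and \<open>q\<close>, so that
  tail integrals and boundary values are covered. Distances of arguments are weighted as in
  \<open>close\<close>, values are not, and one \<open>c\<close> serves as bound and as Lipschitz
  constant, uniformly in \<open>\<bar>u\<bar> \<le> 1\<close>. Closure under sums and products then
  spares explicit constants for the long flux expressions.\<close>

definition BL :: "(real \<Rightarrow> (real \<Rightarrow> real) \<Rightarrow> (real \<Rightarrow> real) \<Rightarrow> real \<Rightarrow> real) \<Rightarrow> real \<Rightarrow> bool" where
  "BL F c \<longleftrightarrow> (\<forall>u p q. \<bar>u\<bar> \<le> 1 \<longrightarrow> adm p q \<longrightarrow>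
     continuous_on {r0..} (F u p q) \<and> (\<forall>r\<ge>r0. \<bar>F u p q r\<bar> \<le> c) \<and>
     (\<forall>p' q' D r. 0 \<le> D \<longrightarrow> adm p' q' \<longrightarrow> close D p q p' q' \<longrightarrow> r0 \<le> r \<longrightarrow>
        \<bar>F u p q r - F u p' q' r\<bar> \<le> c * D))"

definition bounded_lipschitz :: "(real \<Rightarrow> (real \<Rightarrow> real) \<Rightarrow> (real \<Rightarrow> real) \<Rightarrow> real \<Rightarrow> real) \<Rightarrow> bool" where
  "bounded_lipschitz F \<longleftrightarrow> (\<exists>c\<ge>0. BL F c)"

lemma BLI:
  assumes "\<And>u p q. \<bar>u\<bar> \<le> 1 \<Longrightarrow> adm p q \<Longrightarrow> continuous_on {r0..} (F u p q)"
    and "\<And>u p q r. \<bar>u\<bar> \<le> 1 \<Longrightarrow> adm p q \<Longrightarrow> r0 \<le> r \<Longrightarrow> \<bar>F u p q r\<bar> \<le> c"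
    and "\<And>u p q p' q' D r. \<bar>u\<bar> \<le> 1 \<Longrightarrow> adm p q \<Longrightarrow> adm p' q' \<Longrightarrow> 0 \<le> D \<Longrightarrow> close D p q p' q' \<Longrightarrow> r0 \<le> r \<Longrightarrow>
        \<bar>F u p q r - F u p' q' r\<bar> \<le> c * D"
  shows "BL F c"
  using assms unfolding BL_def by blast

lemma BLD:
  assumes "BL F c" "\<bar>u\<bar> \<le> 1" "adm p q"
  shows "continuous_on {r0..} (F u p q)" "r0 \<le> r \<Longrightarrow> \<bar>F u p q r\<bar> \<le> c"
    "adm p' q' \<Longrightarrow> 0 \<le> D \<Longrightarrow> close D p q p' q' \<Longrightarrow> r0 \<le> r \<Longrightarrow> \<bar>F u p q r - F u p' q' r\<bar> \<le> c * D"
  using assms unfolding BL_def by blast+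

lemma BL_mono:
  assumes "BL F c" "c \<le> c'"
  shows "BL F c'"
proof (rule BLI)
  fix u :: real and p q assume a: "\<bar>u\<bar> \<le> 1" "adm p q"
  note F = BLD[OF assms(1) a]
  show "continuous_on {r0..} (F u p q)" by (rule F)
  show "\<bar>F u p q r\<bar> \<le> c'" if "r0 \<le> r" for r using F(2)[OF that] assms(2) by linarith
  show "\<bar>F u p q r - F u p' q' r\<bar> \<le> c' * D"
    if "adm p' q'" "0 \<le> D" "close D p q p' q'" "r0 \<le> r" for p' q' D r
    using F(3)[OF that] mult_right_mono[OF assms(2) that(2)] by linarith
qed

lemma bl_obtain:
  assumes "bounded_lipschitz F"
  obtains c where "0 \<le> c" "BL F c"
  using assms unfolding bounded_lipschitz_def by blast

lemma bl_I: "0 \<le> c \<Longrightarrow> BL F c \<Longrightarrow> bounded_lipschitz F"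
  unfolding bounded_lipschitz_def by blast

lemma inv_pow_le: "r0 \<le> r \<Longrightarrow> 1 / r ^ j \<le> 1 / r0 ^ j"
  using r0_pos by (intro divide_left_mono power_mono mult_pos_pos) auto

lemma close_le:
  assumes "close D p q p' q'" "0 \<le> D" "r0 \<le> r"
  shows "\<bar>p r - p' r\<bar> \<le> 1 / r0 ^ k * D" "\<bar>q r - q' r\<bar> \<le> 1 / r0 ^ k * D"
proof -
  have "D / r ^ k \<le> 1 / r0 ^ k * D"
    using mult_right_mono[OF inv_pow_le[OF assms(3), of k] assms(2)] by simp
  then show "\<bar>p r - p' r\<bar> \<le> 1 / r0 ^ k * D" "\<bar>q r - q' r\<bar> \<le> 1 / r0 ^ k * D"
    using assms unfolding close_def by (meson order_trans)+
qed

lemma bl_const: "bounded_lipschitz (\<lambda>u p q r. a)"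
  by (rule bl_I[of "\<bar>a\<bar>"], simp, rule BLI) auto

lemma bl_u: "bounded_lipschitz (\<lambda>u p q r. u)"
  by (rule bl_I[of 1], simp, rule BLI) auto

lemma bl_inv_pow: "bounded_lipschitz (\<lambda>u p q r. 1 / r ^ j)"
proof (rule bl_I[of "1 / r0 ^ j"], use r0_pos in simp, rule BLI)
  show "continuous_on {r0..} (\<lambda>r. 1 / r ^ j)" using r0_pos by (intro continuous_intros) auto
  show "\<bar>1 / r ^ j\<bar> \<le> 1 / r0 ^ j" if "r0 \<le> r" for r
    using inv_pow_le[OF that, of j] that r0_pos by simp
qed (use r0_pos in auto)

lemma bl_p: "bounded_lipschitz (\<lambda>u p q r. p r)"
proof -
  define c where "c = vp / 2 + 1 / r0 ^ k"
  have c: "vp / 2 \<le> c" "1 / r0 ^ k \<le> c" "0 \<le> c" using vp_pos r0_pos by (auto simp: c_def)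
  show ?thesis
  proof (rule bl_I[OF c(3)], rule BLI)
    fix u :: real and p q assume a: "\<bar>u\<bar> \<le> 1" "adm p q"
    show "continuous_on {r0..} p" using a by (simp add: adm_def)
    show "\<bar>p r\<bar> \<le> c" if "r0 \<le> r" for r using a c that by (force simp: adm_def)
    show "\<bar>p r - p' r\<bar> \<le> c * D" if "0 \<le> D" "close D p q p' q'" "r0 \<le> r" for p' q' D r
      using close_le(1)[OF that(2,1,3)] mult_right_mono[OF c(2) that(1)] by linarith
  qed
qed

lemma bl_q: "bounded_lipschitz (\<lambda>u p q r. q r)"
proof -
  define c where "c = 1 + 1 / r0 ^ k"
  have c: "1 \<le> c" "1 / r0 ^ k \<le> c" "0 \<le> c" using r0_pos by (auto simp: c_def)
  show ?thesis
  proof (rule bl_I[OF c(3)], rule BLI)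
    fix u :: real and p q assume a: "\<bar>u\<bar> \<le> 1" "adm p q"
    show "continuous_on {r0..} q" using a by (simp add: adm_def)
    show "\<bar>q r\<bar> \<le> c" if "r0 \<le> r" for r using a c that by (force simp: adm_def)
    show "\<bar>q r - q' r\<bar> \<le> c * D" if "0 \<le> D" "close D p q p' q'" "r0 \<le> r" for p' q' D r
      using close_le(2)[OF that(2,1,3)] mult_right_mono[OF c(2) that(1)] by linarith
  qed
qed

lemma bl_add:
  assumes "bounded_lipschitz F" "bounded_lipschitz G"
  shows "bounded_lipschitz (\<lambda>u p q r. F u p q r + G u p q r)"
proof -
  obtain c d where c: "0 \<le> c" "BL F c" and d: "0 \<le> d" "BL G d" using assms bl_obtain by metis
  show ?thesis
  proof (rule bl_I[of "c + d"], use c d in simp, rule BLI)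
    fix u :: real and p q assume a: "\<bar>u\<bar> \<le> 1" "adm p q"
    note F = BLD[OF c(2) a] and G = BLD[OF d(2) a]
    show "continuous_on {r0..} (\<lambda>r. F u p q r + G u p q r)" by (intro continuous_intros F G)
    show "\<bar>F u p q r + G u p q r\<bar> \<le> c + d" if "r0 \<le> r" for r
      using F(2)[OF that] G(2)[OF that] by linarith
    show "\<bar>F u p q r + G u p q r - (F u p' q' r + G u p' q' r)\<bar> \<le> (c + d) * D"
      if "adm p' q'" "0 \<le> D" "close D p q p' q'" "r0 \<le> r" for p' q' D r
      using F(3)[OF that] G(3)[OF that] unfolding distrib_right by linarith
  qed
qed

lemma bl_mult:
  assumes "bounded_lipschitz F" "bounded_lipschitz G"
  shows "bounded_lipschitz (\<lambda>u p q r. F u p q r * G u p q r)"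
proof -
  obtain c d where c: "0 \<le> c" "BL F c" and d: "0 \<le> d" "BL G d" using assms bl_obtain by metis
  show ?thesis
  proof (rule bl_I[of "2 * c * d"], use c d in simp, rule BLI)
    fix u :: real and p q assume a: "\<bar>u\<bar> \<le> 1" "adm p q"
    note F = BLD[OF c(2) a] and G = BLD[OF d(2) a]
    show "continuous_on {r0..} (\<lambda>r. F u p q r * G u p q r)" by (intro continuous_intros F G)
    show "\<bar>F u p q r * G u p q r\<bar> \<le> 2 * c * d" if "r0 \<le> r" for r
    proof -
      have "\<bar>F u p q r * G u p q r\<bar> \<le> c * d"
        unfolding abs_mult using F(2)[OF that] G(2)[OF that] c by (intro mult_mono) auto
      moreover have "0 \<le> c * d" using c d by simp
      ultimately show ?thesis by linarith
    qed
    show "\<bar>F u p q r * G u p q r - F u p' q' r * G u p' q' r\<bar> \<le> (2 * c * d) * D"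
      if "adm p' q'" "0 \<le> D" "close D p q p' q'" "r0 \<le> r" for p' q' D r
      using abs_mult_diff_le[OF F(2)[OF that(4)] BLD(2)[OF d(2) a(1) that(1,4)] F(3)[OF that] G(3)[OF that]]
      by (simp add: algebra_simps)
  qed
qed

lemma bl_diff:
  assumes "bounded_lipschitz F" "bounded_lipschitz G"
  shows "bounded_lipschitz (\<lambda>u p q r. F u p q r - G u p q r)"
  using bl_add[OF assms(1) bl_mult[OF bl_const[of "-1"] assms(2)]] by simp

lemma bl_power:
  assumes "bounded_lipschitz F"
  shows "bounded_lipschitz (\<lambda>u p q r. F u p q r ^ j)"
  by (induction j) (auto intro: bl_const bl_mult assms)

lemma bl_at_r0:
  assumes "bounded_lipschitz F"
  shows "bounded_lipschitz (\<lambda>u p q r. F u p q r0)"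
proof -
  obtain c where c: "0 \<le> c" "BL F c" using assms bl_obtain by metis
  show ?thesis
    by (rule bl_I[OF c(1)], rule BLI) (simp_all add: BLD[OF c(2)])
qed

lemma adm_v:
  assumes "adm p q" "r0 \<le> r"
  shows "vp / 2 \<le> vp + p r" "vp + p r \<le> 3 * vp / 2" "0 < vp + p r"
  using assms vp_pos by (auto simp: adm_def abs_le_iff dest!: spec[of _ r])

lemma bl_inv_v: "bounded_lipschitz (\<lambda>u p q r. 1 / (vp + p r))"
proof -
  define c where "c = 2 / vp + 4 / vp\<^sup>2 * (1 / r0 ^ k)"
  have c: "2 / vp \<le> c" "4 / vp\<^sup>2 * (1 / r0 ^ k) \<le> c" "0 \<le> c" using vp_pos r0_pos by (auto simp: c_def)
  show ?thesis
  proof (rule bl_I[OF c(3)], rule BLI)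
    fix u :: real and p q assume a: "\<bar>u\<bar> \<le> 1" "adm p q"
    show "continuous_on {r0..} (\<lambda>r. 1 / (vp + p r))"
      using a adm_v(3)[OF a(2)] by (intro continuous_intros) (auto simp: adm_def, fastforce)
    have inv: "1 / (vp + p r) \<le> 2 / vp" if "adm p q" "r0 \<le> r" for p q r
      using adm_v[OF that] vp_pos by (simp add: field_simps)
    show "\<bar>1 / (vp + p r)\<bar> \<le> c" if "r0 \<le> r" for r
      using inv[OF a(2) that] adm_v(3)[OF a(2) that] c by simp
    show "\<bar>1 / (vp + p r) - 1 / (vp + p' r)\<bar> \<le> c * D"
      if "adm p' q'" "0 \<le> D" "close D p q p' q'" "r0 \<le> r" for p' q' D r
    proof -
      note v = adm_v(3)[OF a(2) that(4)] adm_v(3)[OF that(1,4)]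
      have "1 / (vp + p r) - 1 / (vp + p' r) = (1 / (vp + p r) * (1 / (vp + p' r))) * (p' r - p r)"
        using v by (simp add: field_simps)
      then have "\<bar>1 / (vp + p r) - 1 / (vp + p' r)\<bar> = (1 / (vp + p r) * (1 / (vp + p' r))) * \<bar>p r - p' r\<bar>"
        using v by (simp add: abs_mult abs_minus_commute)
      also have "\<dots> \<le> (2 / vp * (2 / vp)) * (1 / r0 ^ k * D)"
        using inv[OF a(2) that(4)] inv[OF that(1,4)] close_le(1)[OF that(3,2,4)] v vp_pos
        by (intro mult_mono) auto
      also have "\<dots> = (4 / vp\<^sup>2 * (1 / r0 ^ k)) * D" by (simp add: power2_eq_square)
      also have "\<dots> \<le> c * D" by (rule mult_right_mono[OF c(2) that(2)])
      finally show ?thesis .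
    qed
  qed
qed

text \<open>The tail integral of \<open>(vp + p) / s ^ (2 k + 3)\<close> from \<open>r\<close> to infinity.\<close>

definition I :: "(real \<Rightarrow> real) \<Rightarrow> real \<Rightarrow> real" where
  "I p = (SOME F. (\<forall>r\<ge>r0. (F has_real_derivative - ((vp + p r) / r ^ (2 * k + 3))) (at r within {r0..})) \<and>
     (F \<longlongrightarrow> 0) at_top)"

lemma I_props:
  assumes "adm p q"
  shows I_deriv: "r0 \<le> r \<Longrightarrow> (I p has_real_derivative - ((vp + p r) / r ^ (2 * k + 3))) (at r within {r0..})"
    and I_lim: "(I p \<longlongrightarrow> 0) at_top"
proof -
  have "continuous_on {r0..} (\<lambda>r. - ((vp + p r) / r ^ (2 * k + 3)))"
    using assms r0_pos by (intro continuous_intros) (auto simp: adm_def)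
  moreover have "\<bar>- ((vp + p r) / r ^ (2 * k + 3))\<bar> \<le> (3 * vp / 2) / r ^ Suc (2 * k + 2)" if "r0 \<le> r" for r
    using adm_v[OF assms that] r0_pos that by (simp add: abs_mult divide_simps numeral_3_eq_3)
  ultimately have ex: "\<exists>F. (\<forall>r\<ge>r0. (F has_real_derivative - ((vp + p r) / r ^ (2 * k + 3))) (at r within {r0..})) \<and>
     (F \<longlongrightarrow> 0) at_top"
    by (rule decaying_antiderivative_exists[of r0 _ "3 * vp / 2" "2 * k + 2"]) (use r0_pos in auto)
  show "r0 \<le> r \<Longrightarrow> (I p has_real_derivative - ((vp + p r) / r ^ (2 * k + 3))) (at r within {r0..})"
    using someI_ex[OF ex] unfolding I_def by simp
  show "(I p \<longlongrightarrow> 0) at_top"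
    using someI_ex[OF ex] unfolding I_def by simp
qed

text \<open>The tail integral enters the relaxation forcing, which must be of order
  \<open>1 / r ^ k\<close>; it is written there as \<open>J p r * (1 / r ^ k)\<close> with
  \<open>J p\<close> bounded.\<close>

definition J :: "(real \<Rightarrow> real) \<Rightarrow> real \<Rightarrow> real" where "J p r = r ^ k * I p r"

text \<open>The factor \<open>r ^ k\<close> is harmless because the tail integral decays like
  \<open>1 / r ^ (2 * k + 2)\<close>. The difference of two tail integrals is the tail integral of a
  difference, so the Lipschitz bound is the same decay estimate again.\<close>

lemma bl_J: "bounded_lipschitz (\<lambda>u p q r. J p r)"
proof -
  define e where "e = 1 / (real (2 * k + 2)) * (1 / r0 ^ (k + 2))"
  define c where "c = (3 * vp / 2) * e + 1 / r0 ^ k * e"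
  have e: "0 \<le> e" using r0_pos by (simp add: e_def)
  have c: "(3 * vp / 2) * e \<le> c" "1 / r0 ^ k * e \<le> c" "0 \<le> c" using vp_pos r0_pos e by (auto simp: c_def)
  have shrink: "r ^ k * x \<le> A * e" if "x \<le> A / real (2 * k + 2) / r ^ (2 * k + 2)" "0 \<le> A" "r0 \<le> r" for r x A
  proof -
    have "r ^ k * x \<le> r ^ k * (A / real (2 * k + 2) / r ^ (2 * k + 2))"
      using that r0_pos by (intro mult_left_mono) auto
    also have "\<dots> = A * (1 / real (2 * k + 2) * (1 / r ^ (k + 2)))"
      using that r0_pos by (simp add: divide_simps mult_2 power_add del: of_nat_add of_nat_mult)
    also have "\<dots> \<le> A * e"
      unfolding e_def using that by (intro mult_left_mono[OF mult_left_mono[OF inv_pow_le]]) auto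
    finally show ?thesis .
  qed
  show ?thesis
  proof (rule bl_I[OF c(3)], rule BLI)
    fix u :: real and p q assume a: "\<bar>u\<bar> \<le> 1" "adm p q"
    have "continuous_on {r0..} (I p)"
      by (rule DERIV_continuous_on) (use I_deriv[OF a(2)] in auto)
    then show "continuous_on {r0..} (J p)"
      unfolding J_def by (intro continuous_intros)
    show "\<bar>J p r\<bar> \<le> c" if "r0 \<le> r" for r
    proof -
      have "\<bar>I p r\<bar> \<le> (3 * vp / 2) / real (2 * k + 2) / r ^ (2 * k + 2)"
      proof (rule vanishing_antiderivative_decay[OF I_deriv[OF a(2)] I_lim[OF a(2)] _ r0_pos _ that])
        show "\<bar>- ((vp + p r) / r ^ (2 * k + 3))\<bar> \<le> (3 * vp / 2) / r ^ Suc (2 * k + 2)" if "r0 \<le> r" for r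
          using adm_v[OF a(2) that] r0_pos that by (simp add: abs_mult divide_simps numeral_3_eq_3)
      qed auto
      then have "r ^ k * \<bar>I p r\<bar> \<le> (3 * vp / 2) * e" using vp_pos by (intro shrink that) auto
      then show ?thesis using c(1) that r0_pos by (simp add: J_def abs_mult)
    qed
    show "\<bar>J p r - J p' r\<bar> \<le> c * D"
      if "adm p' q'" "0 \<le> D" "close D p q p' q'" "r0 \<le> r" for p' q' D r
    proof -
      have "\<bar>I p r - I p' r\<bar> \<le> (1 / r0 ^ k * D) / real (2 * k + 2) / r ^ (2 * k + 2)"
      proof (rule vanishing_antiderivative_decay[OF DERIV_diff[OF I_deriv[OF a(2)] I_deriv[OF that(1)]] _ _ r0_pos _ that(4)])
        show "((\<lambda>r. I p r - I p' r) \<longlongrightarrow> 0) at_top"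
          using tendsto_diff[OF I_lim[OF a(2)] I_lim[OF that(1)]] by simp
        fix r assume r: "r0 \<le> r"
        have "- ((vp + p r) / r ^ (2 * k + 3)) - - ((vp + p' r) / r ^ (2 * k + 3)) = (p' r - p r) / r ^ Suc (2 * k + 2)"
          by (simp add: numeral_3_eq_3 diff_divide_distrib add_divide_distrib)
        then have "\<bar>- ((vp + p r) / r ^ (2 * k + 3)) - - ((vp + p' r) / r ^ (2 * k + 3))\<bar> = \<bar>p r - p' r\<bar> / r ^ Suc (2 * k + 2)"
          using r r0_pos by (simp add: abs_divide abs_minus_commute)
        also have "\<dots> \<le> (1 / r0 ^ k * D) / r ^ Suc (2 * k + 2)"
          using close_le(1)[OF that(3,2) r] r r0_pos by (intro divide_right_mono) auto
        finally show "\<bar>- ((vp + p r) / r ^ (2 * k + 3)) - - ((vp + p' r) / r ^ (2 * k + 3))\<bar> \<le> (1 / r0 ^ k * D) / r ^ Suc (2 * k + 2)" .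
      qed auto
      then have "r ^ k * \<bar>I p r - I p' r\<bar> \<le> (1 / r0 ^ k * D) * e"
        using that r0_pos by (intro shrink that) auto
      also have "\<dots> = (1 / r0 ^ k * e) * D" by simp
      also have "\<dots> \<le> c * D" by (rule mult_right_mono[OF c(2) that(2)])
      finally show ?thesis
        using that(4) r0_pos by (simp add: J_def abs_mult flip: right_diff_distrib)
    qed
  qed
qed

text \<open>The conserved mass flux \<open>r ^ (n - 1) \<rho> u\<close> is \<open>u * mt p\<close>. In the outflow problem it is an unknown, determined by
  the boundary value of \<open>p\<close>.\<close>

definition mt :: "(real \<Rightarrow> real) \<Rightarrow> real" where "mt p = r0 ^ Suc k / (vp + p r0)"

lemma bl_mt: "bounded_lipschitz (\<lambda>u p q r. mt p)"
  using bl_mult[OF bl_const[of "r0 ^ Suc k"] bl_at_r0[OF bl_inv_v]] by (simp add: mt_def)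

text \<open>\<open>u * h u p q r\<close> is the integrated energy flux without the constant
  contributed by the far state, which goes into the free constant \<open>E\<close>. Every summand of
  the flux carries the mass flux, so a factor \<open>u\<close> can be taken out and the heat source
  is visibly of order \<open>u\<close>.\<close>

definition h :: "real \<Rightarrow> (real \<Rightarrow> real) \<Rightarrow> (real \<Rightarrow> real) \<Rightarrow> real \<Rightarrow> real" where
  "h u p q r = mt p * (cV * q r + (R * tp / vp) * p r
     + (u * mt p)\<^sup>2 * (real (k + 1) * (vp + p r) * J p r * (1 / r ^ k) - (vp + p r)\<^sup>2 / 2 * (1 / r ^ (2 * k + 2)))
     + 2 * nu * real (k + 1) * (u * mt p) * (vp + p r)\<^sup>2 * (1 / r ^ (k + 2)))"

lemma bl_h: "bounded_lipschitz h"
proof -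
  have "bounded_lipschitz (\<lambda>u p q r. mt p * (cV * q r + (R * tp / vp) * p r
     + (u * mt p)\<^sup>2 * (real (k + 1) * (vp + p r) * J p r * (1 / r ^ k) - (vp + p r)\<^sup>2 * (1 / 2) * (1 / r ^ (2 * k + 2)))
     + 2 * nu * real (k + 1) * (u * mt p) * (vp + p r)\<^sup>2 * (1 / r ^ (k + 2))))"
    by (intro bl_add bl_mult bl_diff bl_power bl_const bl_u bl_p bl_q bl_inv_pow bl_J bl_mt)
  then show ?thesis by (simp add: h_def[abs_def])
qed

text \<open>\<open>u\<^sup>2 * Qt p r / r ^ k\<close> is the integrated momentum flux, including the
  nonlocal correction by the tail integral.\<close>

definition Qt :: "(real \<Rightarrow> real) \<Rightarrow> real \<Rightarrow> real" where
  "Qt p r = (mt p)\<^sup>2 * ((vp + p r) * (1 / r ^ (k + 2)) - real (k + 1) * J p r)"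

lemma bl_Qt: "bounded_lipschitz (\<lambda>u p q r. Qt p r)"
  unfolding Qt_def by (intro bl_add bl_mult bl_diff bl_power bl_const bl_p bl_inv_pow bl_J bl_mt)

end

section \<open>The contraction\<close>

lemma abs_mult_le:
  fixes a b :: real
  assumes "\<bar>a\<bar> \<le> A" "\<bar>b\<bar> \<le> B"
  shows "\<bar>a * b\<bar> \<le> A * B"
  unfolding abs_mult using assms by (intro mult_mono) auto

lemma abs_add3_le:
  fixes a b e :: real
  assumes "\<bar>a\<bar> \<le> A" "\<bar>b\<bar> \<le> B" "\<bar>e\<bar> \<le> E"
  shows "\<bar>a + b + e\<bar> \<le> A + B + E"
  using assms by linarith

context gas_parameters
begin

text \<open>Rate of the momentum equation linearised at the far state:
  \<open>R * tp / vp\<^sup>2\<close> is minus the derivative of the pressure with respect to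
  specific volume, and \<open>mu\<close> is the viscosity it is balanced against.\<close>

definition beta :: real where "beta = R * tp / (mu * vp\<^sup>2)"

lemma beta_pos: "0 < beta"
  using R_pos tp_pos mu_pos vp_pos by (simp add: beta_def)

text \<open>Chosen such that the integrated momentum equation reads \<open>p' = - (beta r ^ (n - 1) / M) (p - g)\<close> with
  \<open>M\<close> the mass flux; \<open>p\<close> enters \<open>g\<close> only quadratically or multiplied by \<open>M\<close>.\<close>

definition g :: "real \<Rightarrow> (real \<Rightarrow> real) \<Rightarrow> (real \<Rightarrow> real) \<Rightarrow> real \<Rightarrow> real" where
  "g u p Q r = (p r)\<^sup>2 * (1 / (vp + p r)) + vp\<^sup>2 / tp * (Q r * (1 / (vp + p r)))
     + vp\<^sup>2 / (R * tp) * (u\<^sup>2 * (Qt p r * (1 / r ^ k)))"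

text \<open>The new temperature \<open>Q\<close> is already used in the equation for \<open>P\<close>: its coefficient there is not small.
  Only in the inflow case \<open>0 < u\<close> is the relaxation equation stable, so that \<open>P r0\<close> may be prescribed; for
  \<open>u < 0\<close> boundedness selects the solution.\<close>

definition step :: "real \<Rightarrow> real \<Rightarrow> real \<Rightarrow> (real \<Rightarrow> real) \<Rightarrow> (real \<Rightarrow> real) \<Rightarrow> (real \<Rightarrow> real) \<Rightarrow> (real \<Rightarrow> real) \<Rightarrow> bool" where
  "step u p0 q0 p q P Q \<longleftrightarrow>
     (\<exists>B. \<forall>r\<ge>r0. \<bar>P r\<bar> \<le> B / r ^ k \<and> \<bar>Q r\<bar> \<le> B / r ^ k) \<and> Q r0 = q0 \<and> (0 < u \<longrightarrow> P r0 = p0) \<and>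
     (\<exists>E. \<forall>r\<ge>r0. (Q has_real_derivative (u * h u p q r - E) / (kappa * r ^ Suc k)) (at r within {r0..})) \<and>
     (\<forall>r\<ge>r0. (P has_real_derivative - (beta * r ^ Suc k / (u * mt p)) * (P r - g u p Q r)) (at r within {r0..}))"

definition in_ball :: "real \<Rightarrow> (real \<Rightarrow> real) \<Rightarrow> (real \<Rightarrow> real) \<Rightarrow> bool" where
  "in_ball A p q \<longleftrightarrow> continuous_on {r0..} p \<and> continuous_on {r0..} q \<and>
     (\<forall>r\<ge>r0. \<bar>p r\<bar> \<le> A / r ^ k \<and> \<bar>q r\<bar> \<le> A / r ^ k)"

lemma mt_pos: "adm p q \<Longrightarrow> 0 < mt p"
  using adm_v(3)[of p q r0] r0_pos by (simp add: mt_def)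

end

text \<open>A single \<open>c\<close> majorises everything that depends on the parameters alone, so
  that the later estimates are polynomials in \<open>c\<close>, \<open>K\<close> and
  \<open>d\<close>. It is fixed before the data and the ball are chosen.\<close>

locale gas_bounds = gas_parameters +
  fixes c :: real
  assumes c_ge: "1 \<le> c" "r0 ^ k \<le> c" "1 / r0 ^ k \<le> c" "2 / (kappa * k) \<le> c" "vp\<^sup>2 / tp \<le> c" "vp\<^sup>2 / (R * tp) \<le> c"
    and BL_h: "BL h c" and BL_Qt: "BL (\<lambda>u p q. Qt p) c"
    and BL_inv_v: "BL (\<lambda>u p q r. 1 / (vp + p r)) c" and BL_mt: "BL (\<lambda>u p q r. mt p) c"

lemma (in gas_parameters) gas_bounds_exists: "\<exists>c. gas_bounds k r0 cV R nu mu kappa vp tp c"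
proof -
  obtain c1 c2 c3 c4 where c: "0 \<le> c1" "BL h c1" "0 \<le> c2" "BL (\<lambda>u p q. Qt p) c2"
    "0 \<le> c3" "BL (\<lambda>u p q r. 1 / (vp + p r)) c3" "0 \<le> c4" "BL (\<lambda>u p q r. mt p) c4"
    using bl_h bl_Qt bl_inv_v bl_mt unfolding bounded_lipschitz_def by metis
  define c where "c = 1 + r0 ^ k + 1 / r0 ^ k + 2 / (kappa * k) + vp\<^sup>2 / tp + vp\<^sup>2 / (R * tp) + c1 + c2 + c3 + c4"
  have nn: "0 \<le> r0 ^ k" "0 \<le> 1 / r0 ^ k" "0 \<le> 2 / (kappa * k)" "0 \<le> vp\<^sup>2 / tp" "0 \<le> vp\<^sup>2 / (R * tp)"
    using r0_pos kappa_pos tp_pos R_pos by auto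
  have "gas_bounds k r0 cV R nu mu kappa vp tp c"
  proof (unfold_locales)
    show "1 \<le> c" "r0 ^ k \<le> c" "1 / r0 ^ k \<le> c" "2 / (kappa * k) \<le> c" "vp\<^sup>2 / tp \<le> c" "vp\<^sup>2 / (R * tp) \<le> c"
      using nn c(1,3,5,7) unfolding c_def by linarith+
    have "c1 \<le> c" "c2 \<le> c" "c3 \<le> c" "c4 \<le> c"
      using nn c(1,3,5,7) unfolding c_def by linarith+
    then show "BL h c" "BL (\<lambda>u p q. Qt p) c" "BL (\<lambda>u p q r. 1 / (vp + p r)) c" "BL (\<lambda>u p q r. mt p) c"
      using c BL_mono by blast+
  qed
  then show ?thesis by blast
qed

text \<open>\<open>d\<close> is the size of the data and \<open>K * d\<close> the radius of the
  ball. In \<open>small\<close>, the two bounds on \<open>K * d * c\<close> make the ball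
  admissible, \<open>K * K * d \<le> 1\<close> absorbs the quadratic term of \<open>g\<close>, the
  condition with \<open>beta\<close> is that of the stable relaxation estimate for mass fluxes up to
  \<open>d * c\<close>, and the last one is the contraction factor.\<close>

locale gas_small = gas_bounds +
  fixes K d u p0 q0 :: real
  assumes K_pos: "0 < K" and d_pos: "0 < d" and u: "u \<noteq> 0" "\<bar>u\<bar> \<le> d"
    and p0: "0 < u \<Longrightarrow> \<bar>p0\<bar> \<le> d" and q0: "\<bar>q0\<bar> \<le> d"
    and small: "d \<le> 1" "K * d \<le> 1" "K * K * d \<le> 1" "K * d * c \<le> vp / 2" "K * d * c \<le> 1"
      "2 * real k * (d * c) \<le> beta * r0 ^ (k + 2)"
      "(6 * K * c ^ 2 + 32 * c ^ 6) * d \<le> 1 / 4"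
begin

section \<open>Bounds and contraction of the solution map for small data\<close>

lemma u1: "\<bar>u\<bar> \<le> 1" using u small(1) by linarith

lemma w_le: "r0 \<le> r \<Longrightarrow> 1 / r ^ k \<le> c" and w_pos: "r0 \<le> r \<Longrightarrow> 0 < 1 / r ^ k"
  using inv_pow_le[of r k] c_ge(3) r0_pos by (linarith, simp)

lemma c_pow: "c ^ i \<le> c ^ j" if "i \<le> j" using c_ge(1) that by (rule power_increasing[rotated])

lemma c_pos: "0 < c" using c_ge(1) by linarith

lemma adm_ball:
  assumes "in_ball (K * d) p q"
  shows "adm p q"
  unfolding adm_def
proof (intro conjI allI impI)
  fix r assume r: "r0 \<le> r"
  have "K * d / r ^ k \<le> K * d * c"
    using mult_left_mono[OF w_le[OF r], of "K * d"] K_pos d_pos by simp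
  then show "\<bar>p r\<bar> \<le> vp / 2" "\<bar>q r\<bar> \<le> 1"
    using assms small(4,5) r unfolding in_ball_def by (meson order_trans)+
qed (use assms in \<open>auto simp: in_ball_def\<close>)

lemma mt_small:
  assumes "adm p q"
  shows "2 * real k * (u * mt p) \<le> beta * r0 ^ (k + 2)"
proof -
  have "u * mt p \<le> d * c"
    using BLD(2)[OF BL_mt u1 assms order_refl] mt_pos[OF assms] u d_pos c_pos
    by (intro order_trans[OF abs_ge_self[of "u * mt p"]] abs_mult_le) auto
  then have "2 * real k * (u * mt p) \<le> 2 * real k * (d * c)"
    by (intro mult_left_mono) auto
  then show ?thesis using small(6) by linarith
qed

text \<open>On the whole ball the heat source is at most \<open>d * c\<close>, since
  \<open>u\<close> is a factor and \<open>h\<close> is bounded. The result is therefore free of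
  \<open>K\<close>, which is what later permits choosing \<open>K\<close> large enough for a self
  map.\<close>

lemma step_temperature_bound:
  assumes b: "in_ball (K * d) p q" and Q: "Q r0 = q0" "(Q \<longlongrightarrow> 0) at_top"
    "\<And>r. r0 \<le> r \<Longrightarrow> (Q has_real_derivative (u * h u p q r - E) / (kappa * r ^ Suc k)) (at r within {r0..})"
    and "r0 \<le> r"
  shows "\<bar>Q r\<bar> \<le> 2 * c ^ 2 * d * (1 / r ^ k)"
proof -
  note adm = adm_ball[OF b]
  have cont: "continuous_on {r0..} (\<lambda>r. u * h u p q r)"
    by (intro continuous_intros BLD(1)[OF BL_h u1 adm])
  have le: "\<bar>u * h u p q r\<bar> \<le> d * c" if "r0 \<le> r" for r
    by (intro abs_mult_le u BLD(2)[OF BL_h u1 adm that])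
  have "\<bar>Q r\<bar> \<le> (r0 ^ k * \<bar>Q r0\<bar> + 2 * (d * c) / (kappa * k)) / r ^ k"
    by (rule heat_equation_estimate[OF r0_pos k_pos kappa_pos cont le Q(3,2) \<open>r0 \<le> r\<close>])
  also have "\<dots> = (r0 ^ k * \<bar>Q r0\<bar> + (2 / (kappa * k)) * (d * c)) * (1 / r ^ k)" by simp
  also have "\<dots> \<le> (c * d + c * (d * c)) * (1 / r ^ k)"
    using c_ge q0 Q(1) r0_pos d_pos c_pos \<open>r0 \<le> r\<close>
    by (intro mult_right_mono add_mono mult_mono) auto
  also have "\<dots> \<le> (2 * c ^ 2 * d) * (1 / r ^ k)"
  proof (intro mult_right_mono)
    have "c * d \<le> c ^ 2 * d" using c_pow[of 1 2] d_pos by (intro mult_right_mono) auto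
    then show "c * d + c * (d * c) \<le> 2 * c ^ 2 * d" by (simp add: power2_eq_square algebra_simps)
  qed (use r0_pos \<open>r0 \<le> r\<close> in auto)
  finally show ?thesis .
qed

lemma g_bound:
  assumes b: "in_ball (K * d) p q" and Q: "\<bar>Q r\<bar> \<le> 2 * c ^ 2 * d * (1 / r ^ k)" and r: "r0 \<le> r"
  shows "\<bar>g u p Q r\<bar> \<le> 4 * c ^ 4 * d * (1 / r ^ k)"
proof -
  note adm = adm_ball[OF b]
  let ?w = "1 / r ^ k" and ?s = "1 / (vp + p r)"
  have s: "\<bar>?s\<bar> \<le> c" by (rule BLD(2)[OF BL_inv_v u1 adm r])
  have w: "0 < ?w" "?w \<le> c" using w_pos[OF r] w_le[OF r] .
  have p: "\<bar>p r\<bar> \<le> K * d * ?w" using b r by (simp add: in_ball_def)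
  have 1: "\<bar>(p r)\<^sup>2 * ?s\<bar> \<le> c ^ 2 * d * ?w"
  proof -
    have "\<bar>p r * p r * ?s\<bar> \<le> K * d * ?w * (K * d * ?w) * c"
      by (intro abs_mult_le p s)
    \<comment> \<open>The square brings two factors \<open>K * d\<close>; one \<open>d\<close> is
      spent on \<open>K * K * d \<le> 1\<close>, leaving a bound linear in \<open>d\<close> and
      without \<open>K\<close>.\<close>
    also have "\<dots> = (K * K * d) * (d * ?w) * (?w * c)" by (simp add: algebra_simps)
    also have "\<dots> \<le> 1 * (d * ?w) * (c * c)"
      using small(3) w d_pos c_pos K_pos by (intro mult_mono) auto
    finally show ?thesis by (simp add: power2_eq_square algebra_simps)
  qed
  have 2: "\<bar>vp\<^sup>2 / tp * (Q r * ?s)\<bar> \<le> 2 * c ^ 4 * d * ?w"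
  proof -
    have "\<bar>vp\<^sup>2 / tp * (Q r * ?s)\<bar> \<le> c * ((2 * c ^ 2 * d * ?w) * c)"
      using c_ge(5) tp_pos by (intro abs_mult_le Q s) simp
    then show ?thesis by (simp add: power_def algebra_simps eval_nat_numeral)
  qed
  have 3: "\<bar>vp\<^sup>2 / (R * tp) * (u\<^sup>2 * (Qt p r * ?w))\<bar> \<le> c ^ 2 * d * ?w"
  proof -
    have "\<bar>vp\<^sup>2 / (R * tp) * ((u * u) * (Qt p r * ?w))\<bar> \<le> c * ((1 * d) * (c * ?w))"
      using c_ge(6) R_pos tp_pos u u1 w by (intro abs_mult_le BLD(2)[OF BL_Qt u1 adm r]) auto
    then show ?thesis by (simp add: power2_eq_square algebra_simps)
  qed
  have "c ^ 2 * d * ?w \<le> c ^ 4 * d * ?w"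
    using c_pow[of 2 4] d_pos w by (intro mult_right_mono) auto
  then have "c ^ 2 * d * ?w + 2 * c ^ 4 * d * ?w + c ^ 2 * d * ?w \<le> c ^ 4 * d * ?w + 2 * c ^ 4 * d * ?w + c ^ 4 * d * ?w"
    by (intro add_mono order_refl)
  also have "\<dots> = 4 * c ^ 4 * d * ?w" by simp
  finally show ?thesis unfolding g_def by (rule order_trans[OF abs_add3_le[OF 1 2 3]])
qed

text \<open>The unspecified \<open>B\<close> in \<open>step\<close> is a qualitative condition: it
  gives the limit needed by the heat estimate here, and the boundedness needed by the relaxation
  estimate in the next lemma.\<close>

lemma step_Q_lim:
  assumes "step u p0 q0 p q P Q"
  shows "(Q \<longlongrightarrow> 0) at_top"
  using assms k_pos tendsto_0_if_decay[of r0 Q _ k] unfolding step_def by blast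

lemma step_P_bdd:
  assumes "step u p0 q0 p q P Q"
  obtains B where "\<And>r. r0 \<le> r \<Longrightarrow> \<bar>P r\<bar> \<le> B"
proof -
  obtain B where B: "\<And>r. r0 \<le> r \<Longrightarrow> \<bar>P r\<bar> \<le> B / r ^ k" using assms unfolding step_def by blast
  have "\<bar>P r\<bar> \<le> \<bar>B\<bar> * c" if "r0 \<le> r" for r
  proof -
    have "B * (1 / r ^ k) \<le> \<bar>B\<bar> * c"
      using w_le[OF that] w_pos[OF that] by (intro mult_mono) auto
    then show ?thesis using B[OF that] by simp
  qed
  then show ?thesis using that by blast
qed

lemma step_Q_bound:
  assumes b: "in_ball (K * d) p q" and s: "step u p0 q0 p q P Q" and r: "r0 \<le> r"
  shows "\<bar>Q r\<bar> \<le> 2 * c ^ 2 * d * (1 / r ^ k)"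
  using step_temperature_bound[OF b _ step_Q_lim[OF s] _ r] s unfolding step_def by blast

text \<open>The prescribed boundary value has to start below the barrier of the stable relaxation
  estimate, which it does since \<open>r0 ^ k \<le> c\<close>.\<close>

lemma p0_le: "0 < u \<Longrightarrow> \<bar>p0\<bar> \<le> 2 * (4 * c ^ 4 * d) / r0 ^ k"
proof -
  assume "0 < u"
  then have "\<bar>p0\<bar> \<le> d" by (rule p0)
  moreover have "d * r0 ^ k \<le> 8 * c ^ 4 * d"
  proof -
    have "c \<le> c ^ 4" using c_pow[of 1 4] by simp
    then have "r0 ^ k \<le> 8 * c ^ 4" using c_ge(2) c_pos by linarith
    then show ?thesis using d_pos by simp
  qed
  then have "d \<le> 2 * (4 * c ^ 4 * d) / r0 ^ k" using r0_pos by (simp add: pos_le_divide_eq)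
  ultimately show ?thesis by linarith
qed

lemma u_mt_pos: "adm p q \<Longrightarrow> 0 < u * mt p \<longleftrightarrow> 0 < u" "adm p q \<Longrightarrow> u * mt p \<noteq> 0"
  using mt_pos[of p q] u by (auto simp: zero_less_mult_iff)

lemma step_P_bound:
  assumes b: "in_ball (K * d) p q" and s: "step u p0 q0 p q P Q" and r: "r0 \<le> r"
  shows "\<bar>P r\<bar> \<le> 8 * c ^ 4 * d * (1 / r ^ k)"
proof -
  note adm = adm_ball[OF b]
  obtain B where B: "\<And>r. r0 \<le> r \<Longrightarrow> \<bar>P r\<bar> \<le> B" using step_P_bdd[OF s] by blast
  have g: "\<bar>g u p Q r\<bar> \<le> (4 * c ^ 4 * d) / r ^ k" if "r0 \<le> r" for r
    using g_bound[where Q = Q, OF b step_Q_bound[OF b s that] that] by simp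
  have P: "(P has_real_derivative - (beta * r ^ Suc k / (u * mt p)) * (P r - g u p Q r)) (at r within {r0..})"
    if "r0 \<le> r" for r using s that unfolding step_def by blast
  have Pa: "0 < u * mt p \<Longrightarrow> \<bar>P r0\<bar> \<le> 2 * (4 * c ^ 4 * d) / r0 ^ k"
    using s p0_le u_mt_pos[OF adm] unfolding step_def by auto
  have "\<bar>P r\<bar> \<le> 2 * (4 * c ^ 4 * d) / r ^ k"
    by (rule relaxation_estimate[OF r0_pos beta_pos u_mt_pos(2)[OF adm] mt_small[OF adm] P g Pa B r])
  then show ?thesis by simp
qed

lemma step_exists:
  assumes b: "in_ball (K * d) p q"
  obtains P Q where "step u p0 q0 p q P Q" "in_ball (8 * c ^ 4 * d) P Q"
proof -
  note adm = adm_ball[OF b]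
  have cont: "continuous_on {r0..} (\<lambda>r. u * h u p q r)"
    by (intro continuous_intros BLD(1)[OF BL_h u1 adm])
  have le: "\<bar>u * h u p q r\<bar> \<le> d * c" if "r0 \<le> r" for r
    by (intro abs_mult_le u BLD(2)[OF BL_h u1 adm that])
  obtain Q E where Q: "Q r0 = q0"
    "\<And>r. r0 \<le> r \<Longrightarrow> (Q has_real_derivative (u * h u p q r - E) / (kappa * r ^ Suc k)) (at r within {r0..})"
    "(Q \<longlongrightarrow> 0) at_top"
    using heat_equation_exists[OF r0_pos k_pos kappa_pos cont le] by metis
  have Q_le: "\<bar>Q r\<bar> \<le> 2 * c ^ 2 * d * (1 / r ^ k)" if "r0 \<le> r" for r
    by (rule step_temperature_bound[OF b Q(1,3,2) that])
  have Q_cont: "continuous_on {r0..} Q" by (rule DERIV_continuous_on) (use Q(2) in auto)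
  have g_cont: "continuous_on {r0..} (g u p Q)"
    unfolding g_def using r0_pos b
    by (intro continuous_intros Q_cont BLD(1)[OF BL_inv_v u1 adm] BLD(1)[OF BL_Qt u1 adm]) (auto simp: in_ball_def)
  have g: "\<bar>g u p Q r\<bar> \<le> (4 * c ^ 4 * d) / r ^ k" if "r0 \<le> r" for r
    using g_bound[where Q = Q, OF b Q_le[OF that] that] by simp
  obtain P where P: "\<And>r. r0 \<le> r \<Longrightarrow> (P has_real_derivative - (beta * r ^ Suc k / (u * mt p)) * (P r - g u p Q r)) (at r within {r0..})"
    "0 < u * mt p \<Longrightarrow> P r0 = p0" "\<And>r. r0 \<le> r \<Longrightarrow> \<bar>P r\<bar> \<le> 2 * (4 * c ^ 4 * d) / r ^ k"
    using relaxation_exists[OF r0_pos beta_pos u_mt_pos(2)[OF adm] mt_small[OF adm] g_cont g p0_le]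
      u_mt_pos(1)[OF adm] by metis
  have P_cont: "continuous_on {r0..} P" by (rule DERIV_continuous_on) (use P(1) in auto)
  have Q8: "\<bar>Q r\<bar> \<le> 8 * c ^ 4 * d / r ^ k" if "r0 \<le> r" for r
  proof -
    have "2 * c ^ 2 * d * (1 / r ^ k) \<le> 8 * c ^ 4 * d * (1 / r ^ k)"
      using c_pow[of 2 4] d_pos w_pos[OF that] c_pos
      by (intro mult_right_mono mult_mono) auto
    then show ?thesis using Q_le[OF that] by simp
  qed
  have ball: "in_ball (8 * c ^ 4 * d) P Q"
    using P_cont Q_cont P(3) Q8 unfolding in_ball_def by (simp add: mult.assoc)
  then have "\<forall>r\<ge>r0. \<bar>P r\<bar> \<le> (8 * c ^ 4 * d) / r ^ k \<and> \<bar>Q r\<bar> \<le> (8 * c ^ 4 * d) / r ^ k"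
    unfolding in_ball_def by blast
  then have "step u p0 q0 p q P Q"
    unfolding step_def using Q(1,2) P(1,2) u_mt_pos(1)[OF adm] by blast
  then show ?thesis using ball that by blast
qed

text \<open>The difference solves a heat equation with source
  \<open>u * (h u p q r - h u p' q' r)\<close>, boundary value 0 and free constant
  \<open>E - E'\<close>, whose size does not matter. The factor \<open>u\<close> makes the Lipschitz
  constant proportional to \<open>d\<close>.\<close>

lemma step_Q_contraction:
  assumes b: "in_ball (K * d) p q" "in_ball (K * d) p' q'" and s: "step u p0 q0 p q P Q" "step u p0 q0 p' q' P' Q'"
    and D: "0 \<le> D" "close D p q p' q'" and r: "r0 \<le> r"
  shows "\<bar>Q r - Q' r\<bar> \<le> c ^ 2 * d * D * (1 / r ^ k)"
proof -
  note adm = adm_ball[OF b(1)] adm_ball[OF b(2)]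
  obtain E E' where
    Q: "\<And>r. r0 \<le> r \<Longrightarrow> (Q has_real_derivative (u * h u p q r - E) / (kappa * r ^ Suc k)) (at r within {r0..})" and
    Q': "\<And>r. r0 \<le> r \<Longrightarrow> (Q' has_real_derivative (u * h u p' q' r - E') / (kappa * r ^ Suc k)) (at r within {r0..})"
    using s unfolding step_def by metis
  have cont: "continuous_on {r0..} (\<lambda>r. u * (h u p q r - h u p' q' r))"
    by (intro continuous_intros BLD(1)[OF BL_h u1 adm(1)] BLD(1)[OF BL_h u1 adm(2)])
  have le: "\<bar>u * (h u p q r - h u p' q' r)\<bar> \<le> d * (c * D)" if "r0 \<le> r" for r
    by (intro abs_mult_le u BLD(3)[OF BL_h u1 adm(1) adm(2) D that])
  have "\<bar>Q r - Q' r\<bar> \<le> (r0 ^ k * \<bar>Q r0 - Q' r0\<bar> + 2 * (d * (c * D)) / (kappa * k)) / r ^ k"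
  proof (rule heat_equation_estimate[OF r0_pos k_pos kappa_pos cont le _ _ r])
    show "((\<lambda>r. Q r - Q' r) has_real_derivative (u * (h u p q r - h u p' q' r) - (E - E')) / (kappa * r ^ Suc k))
       (at r within {r0..})" if "r0 \<le> r" for r
    proof (rule DERIV_cong[OF DERIV_diff[OF Q[OF that] Q'[OF that]]])
      have "u * h u p q r - E - (u * h u p' q' r - E') = u * (h u p q r - h u p' q' r) - (E - E')"
        by (simp add: algebra_simps)
      then show "(u * h u p q r - E) / (kappa * r ^ Suc k) - (u * h u p' q' r - E') / (kappa * r ^ Suc k)
          = (u * (h u p q r - h u p' q' r) - (E - E')) / (kappa * r ^ Suc k)"
        by (metis diff_divide_distrib)
    qed
    show "((\<lambda>r. Q r - Q' r) \<longlongrightarrow> 0) at_top"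
      using tendsto_diff[OF step_Q_lim[OF s(1)] step_Q_lim[OF s(2)]] by simp
  qed
  also have "Q r0 - Q' r0 = 0" using s unfolding step_def by simp
  also have "(r0 ^ k * \<bar>0\<bar> + 2 * (d * (c * D)) / (kappa * k)) / r ^ k = (2 / (kappa * k)) * (d * (c * D)) * (1 / r ^ k)" by simp
  also have "\<dots> \<le> c * (d * (c * D)) * (1 / r ^ k)"
    using c_ge(4) d_pos c_pos D w_pos[OF r] by (intro mult_right_mono) auto
  finally show ?thesis by (simp add: power2_eq_square algebra_simps)
qed

text \<open>Each term of \<open>g\<close> yields a factor \<open>d\<close>: the square because
  \<open>p\<close> and \<open>p'\<close> are of size \<open>K * d\<close>, the temperature term
  because \<open>Q\<close> and \<open>Q - Q'\<close> are of order \<open>d\<close>, the flux term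
  through \<open>u\<^sup>2\<close>.\<close>

lemma g_lipschitz:
  assumes b: "in_ball (K * d) p q" "in_ball (K * d) p' q'" and s: "step u p0 q0 p q P Q" "step u p0 q0 p' q' P' Q'"
    and D: "0 \<le> D" "close D p q p' q'" and r: "r0 \<le> r"
  shows "\<bar>g u p Q r - g u p' Q' r\<bar> \<le> (3 * K * c ^ 2 + 4 * c ^ 4) * d * D * (1 / r ^ k)"
proof -
  note adm = adm_ball[OF b(1)] adm_ball[OF b(2)]
  let ?w = "1 / r ^ k" and ?s = "1 / (vp + p r)" and ?s' = "1 / (vp + p' r)"
  have s': "\<bar>?s'\<bar> \<le> c" by (rule BLD(2)[OF BL_inv_v u1 adm(2) r])
  have ds: "\<bar>?s - ?s'\<bar> \<le> c * D" by (rule BLD(3)[OF BL_inv_v u1 adm(1) adm(2) D r])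
  have w: "0 < ?w" "?w \<le> c" using w_pos[OF r] w_le[OF r] .
  have p: "\<bar>p r\<bar> \<le> K * d * ?w" "\<bar>p' r\<bar> \<le> K * d * ?w" using b r by (auto simp: in_ball_def)
  have dp: "\<bar>p r - p' r\<bar> \<le> D * ?w" using D r by (simp add: close_def)
  have Q: "\<bar>Q r\<bar> \<le> 2 * c ^ 2 * d * ?w" by (rule step_Q_bound[OF b(1) s(1) r])
  have dQ: "\<bar>Q r - Q' r\<bar> \<le> c ^ 2 * d * D * ?w" by (rule step_Q_contraction[OF b s D r])
  have 1: "\<bar>(p r)\<^sup>2 * ?s - (p' r)\<^sup>2 * ?s'\<bar> \<le> 3 * K * c ^ 2 * d * D * ?w"
  proof -
    have "\<bar>p r * p r\<bar> \<le> K * d * ?w * (K * d * ?w)" by (intro abs_mult_le p)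
    moreover have "\<bar>p r * p r - p' r * p' r\<bar> \<le> (K * d * ?w) * (D * ?w) + (D * ?w) * (K * d * ?w)"
      by (rule abs_mult_diff_le[OF p dp dp])
    ultimately have "\<bar>p r * p r * ?s - p' r * p' r * ?s'\<bar> \<le>
        K * d * ?w * (K * d * ?w) * (c * D) + ((K * d * ?w) * (D * ?w) + (D * ?w) * (K * d * ?w)) * c"
      by (rule abs_mult_diff_le[OF _ s' _ ds])
    also have "\<dots> = (K * (d * (D * (?w * c)))) * ((K * d) * ?w + 2 * ?w)" by (simp add: algebra_simps)
    also have "\<dots> \<le> (K * (d * (D * (?w * c)))) * (1 * c + 2 * c)"
      using small(2) w d_pos c_pos K_pos D by (intro mult_left_mono add_mono mult_mono) auto
    finally show ?thesis by (simp add: power2_eq_square algebra_simps)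
  qed
  have 2: "\<bar>vp\<^sup>2 / tp * (Q r * ?s) - vp\<^sup>2 / tp * (Q' r * ?s')\<bar> \<le> 3 * c ^ 4 * d * D * ?w"
  proof -
    have "\<bar>Q r * ?s - Q' r * ?s'\<bar> \<le> 2 * c ^ 2 * d * ?w * (c * D) + c ^ 2 * d * D * ?w * c"
      by (rule abs_mult_diff_le[OF Q s' dQ ds])
    then have "\<bar>vp\<^sup>2 / tp * (Q r * ?s - Q' r * ?s')\<bar> \<le> c * (2 * c ^ 2 * d * ?w * (c * D) + c ^ 2 * d * D * ?w * c)"
      using c_ge(5) tp_pos by (intro abs_mult_le) simp_all
    then show ?thesis by (simp add: right_diff_distrib) (simp add: algebra_simps eval_nat_numeral)
  qed
  have 3: "\<bar>vp\<^sup>2 / (R * tp) * (u\<^sup>2 * (Qt p r * ?w)) - vp\<^sup>2 / (R * tp) * (u\<^sup>2 * (Qt p' r * ?w))\<bar> \<le> c ^ 2 * d * D * ?w"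
  proof -
    have "\<bar>vp\<^sup>2 / (R * tp) * ((u * u) * ((Qt p r - Qt p' r) * ?w))\<bar> \<le> c * ((1 * d) * ((c * D) * ?w))"
      using c_ge(6) R_pos tp_pos u u1 w by (intro abs_mult_le BLD(3)[OF BL_Qt u1 adm(1) adm(2) D r]) auto
    moreover have "vp\<^sup>2 / (R * tp) * (u\<^sup>2 * (Qt p r * ?w)) - vp\<^sup>2 / (R * tp) * (u\<^sup>2 * (Qt p' r * ?w))
       = vp\<^sup>2 / (R * tp) * ((u * u) * ((Qt p r - Qt p' r) * ?w))"
      unfolding power2_eq_square[of u] by (simp only: right_diff_distrib left_diff_distrib)
    ultimately show ?thesis by (simp only:) (simp add: power2_eq_square algebra_simps)
  qed
  have 4: "c ^ 2 * d * D * ?w \<le> c ^ 4 * d * D * ?w"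
    using c_pow[of 2 4] d_pos w D by (intro mult_right_mono) auto
  have "g u p Q r - g u p' Q' r = ((p r)\<^sup>2 * ?s - (p' r)\<^sup>2 * ?s') + (vp\<^sup>2 / tp * (Q r * ?s) - vp\<^sup>2 / tp * (Q' r * ?s'))
      + (vp\<^sup>2 / (R * tp) * (u\<^sup>2 * (Qt p r * ?w)) - vp\<^sup>2 / (R * tp) * (u\<^sup>2 * (Qt p' r * ?w)))"
    unfolding g_def by (simp only: add_diff_add)
  also have "\<bar>\<dots>\<bar> \<le> 3 * K * c ^ 2 * d * D * ?w + 3 * c ^ 4 * d * D * ?w + c ^ 2 * d * D * ?w"
    by (rule abs_add3_le[OF 1 2 3])
  also have "\<dots> \<le> 3 * K * c ^ 2 * d * D * ?w + 3 * c ^ 4 * d * D * ?w + c ^ 4 * d * D * ?w"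
    by (intro add_mono order_refl 4)
  also have "\<dots> = (3 * K * c ^ 2 + 4 * c ^ 4) * d * D * ?w"
    by (simp only: distrib_right) simp
  finally show ?thesis .
qed

text \<open>The two steps have different mass fluxes; the relative difference \<open>\<theta>\<close> of the relaxation rates is absorbed
  into the forcing.\<close>

lemma step_P_contraction:
  assumes b: "in_ball (K * d) p q" "in_ball (K * d) p' q'" and s: "step u p0 q0 p q P Q" "step u p0 q0 p' q' P' Q'"
    and D: "0 \<le> D" "close D p q p' q'" and r: "r0 \<le> r"
  shows "\<bar>P r - P' r\<bar> \<le> (6 * K * c ^ 2 + 32 * c ^ 6) * d * D * (1 / r ^ k)"
proof -
  note adm = adm_ball[OF b(1)] adm_ball[OF b(2)]
  define \<theta> where "\<theta> = (p r0 - p' r0) * (1 / (vp + p r0))"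
  note v = adm_v(3)[OF adm(1) order_refl] adm_v(3)[OF adm(2) order_refl]
  have \<theta>: "\<bar>\<theta>\<bar> \<le> c * D * c"
    unfolding \<theta>_def
  proof (intro abs_mult_le BLD(2)[OF BL_inv_v u1 adm(1) order_refl])
    show "\<bar>p r0 - p' r0\<bar> \<le> c * D"
      using close_le(1)[OF D(2,1) order_refl] mult_right_mono[OF c_ge(3) D(1)] by linarith
  qed
  have ratio: "1 / (u * mt p') = (1 / (u * mt p)) * (1 - \<theta>)"
  proof -
    have "1 - \<theta> = (vp + p' r0) / (vp + p r0)" using v by (simp add: \<theta>_def field_simps)
    then show ?thesis using v by (simp add: mt_def)
  qed
  define G where "G r = (g u p Q r - g u p' Q' r) - \<theta> * (P' r - g u p' Q' r)" for r
  have P: "(P has_real_derivative - (beta * r ^ Suc k / (u * mt p)) * (P r - g u p Q r)) (at r within {r0..})"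
    "(P' has_real_derivative - (beta * r ^ Suc k / (u * mt p')) * (P' r - g u p' Q' r)) (at r within {r0..})"
    if "r0 \<le> r" for r using s that unfolding step_def by blast+
  have dP: "((\<lambda>r. P r - P' r) has_real_derivative - (beta * r ^ Suc k / (u * mt p)) * ((P r - P' r) - G r)) (at r within {r0..})"
    if "r0 \<le> r" for r
  proof (rule DERIV_cong[OF DERIV_diff[OF P[OF that]]])
    have e: "- (x * m) * (a - ga) - - (x * (m * (1 - \<theta>))) * (a' - ga') = - (x * m) * ((a - a') - ((ga - ga') - \<theta> * (a' - ga')))"
      for x m a a' ga ga' by (simp add: algebra_simps)
    show "- (beta * r ^ Suc k / (u * mt p)) * (P r - g u p Q r) - - (beta * r ^ Suc k / (u * mt p')) * (P' r - g u p' Q' r)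
      = - (beta * r ^ Suc k / (u * mt p)) * ((P r - P' r) - G r)"
      using e[of "beta * r ^ Suc k" "1 / (u * mt p)" "P r" "g u p Q r" "P' r" "g u p' Q' r"]
      unfolding G_def ratio[symmetric] by simp
  qed
  have G_le: "\<bar>G r\<bar> \<le> ((3 * K * c ^ 2 + 16 * c ^ 6) * d * D) / r ^ k" if "r0 \<le> r" for r
  proof -
    let ?w = "1 / r ^ k"
    have 1: "\<bar>g u p Q r - g u p' Q' r\<bar> \<le> (3 * K * c ^ 2 + 4 * c ^ 4) * d * D * ?w"
      by (rule g_lipschitz[OF b s D that])
    \<comment> \<open>\<open>P'\<close> and its forcing are both of order \<open>d\<close>. This
      turns the mismatch \<open>\<theta>\<close> of the rates, which by itself is only of order
      \<open>D\<close>, into a contribution of order \<open>d * D\<close>.\<close>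
    have "\<bar>P' r - g u p' Q' r\<bar> \<le> 12 * c ^ 4 * d * ?w"
      using step_P_bound[OF b(2) s(2) that] g_bound[where Q = Q', OF b(2) step_Q_bound[OF b(2) s(2) that] that] by linarith
    then have "\<bar>\<theta> * (P' r - g u p' Q' r)\<bar> \<le> (c * D * c) * (12 * c ^ 4 * d * ?w)"
      by (intro abs_mult_le \<theta>)
    also have "\<dots> = 12 * c ^ 6 * d * D * ?w" by (simp add: algebra_simps eval_nat_numeral)
    finally have 2: "\<bar>\<theta> * (P' r - g u p' Q' r)\<bar> \<le> 12 * c ^ 6 * d * D * ?w" .
    have 3: "c ^ 4 * d * D * ?w \<le> c ^ 6 * d * D * ?w"
      using c_pow[of 4 6] d_pos w_pos[OF that] D by (intro mult_right_mono) auto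
    have "(3 * K * c ^ 2 + 4 * c ^ 4) * d * D * ?w + 12 * c ^ 6 * d * D * ?w
        \<le> (3 * K * c ^ 2 + 16 * c ^ 6) * d * D * ?w"
    proof -
      have "(3 * K * c ^ 2 + 4 * c ^ 4) * d * D * ?w + 12 * c ^ 6 * d * D * ?w
        = 3 * K * c ^ 2 * d * D * ?w + 4 * (c ^ 4 * d * D * ?w) + 12 * (c ^ 6 * d * D * ?w)"
        by (simp only: distrib_right mult.assoc)
      also have "\<dots> \<le> 3 * K * c ^ 2 * d * D * ?w + 4 * (c ^ 6 * d * D * ?w) + 12 * (c ^ 6 * d * D * ?w)"
        by (rule add_mono[OF add_mono[OF order_refl mult_left_mono[OF 3]] order_refl]) simp
      also have "\<dots> = (3 * K * c ^ 2 + 16 * c ^ 6) * d * D * ?w"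
        by (simp only: distrib_right mult.assoc) simp
      finally show ?thesis .
    qed
    moreover have "\<bar>G r\<bar> \<le> \<bar>g u p Q r - g u p' Q' r\<bar> + \<bar>\<theta> * (P' r - g u p' Q' r)\<bar>"
      unfolding G_def by (rule abs_triangle_ineq4)
    ultimately have "\<bar>G r\<bar> \<le> (3 * K * c ^ 2 + 16 * c ^ 6) * d * D * ?w"
      using add_mono[OF 1 2] by (meson order_trans)
    then show ?thesis by simp
  qed
  obtain B B' where B: "\<And>r. r0 \<le> r \<Longrightarrow> \<bar>P r\<bar> \<le> B" "\<And>r. r0 \<le> r \<Longrightarrow> \<bar>P' r\<bar> \<le> B'"
    using step_P_bdd[OF s(1)] step_P_bdd[OF s(2)] by metis
  have "\<bar>P r - P' r\<bar> \<le> 2 * ((3 * K * c ^ 2 + 16 * c ^ 6) * d * D) / r ^ k"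
  proof (rule relaxation_estimate[OF r0_pos beta_pos u_mt_pos(2)[OF adm(1)] mt_small[OF adm(1)] dP G_le _ _ r])
    show "\<bar>P r0 - P' r0\<bar> \<le> 2 * ((3 * K * c ^ 2 + 16 * c ^ 6) * d * D) / r0 ^ k" if "0 < u * mt p"
    proof -
      have "P r0 - P' r0 = 0" using that s u_mt_pos(1)[OF adm(1)] unfolding step_def by simp
      then show ?thesis using K_pos c_pos d_pos D r0_pos by simp
    qed
    show "\<bar>P r - P' r\<bar> \<le> B + B'" if "r0 \<le> r" for r using B(1)[OF that] B(2)[OF that] by linarith
  qed
  then show ?thesis by (simp add: algebra_simps add_divide_distrib)
qed

text \<open>A quarter for each component, so that the norm of the pair, at most the sum of the
  components, is halved as \<open>relational_contraction\<close> demands.\<close>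

lemma step_contraction:
  assumes b: "in_ball (K * d) p q" "in_ball (K * d) p' q'" and s: "step u p0 q0 p q P Q" "step u p0 q0 p' q' P' Q'"
    and D: "0 \<le> D" "close D p q p' q'"
  shows "close (D / 4) P Q P' Q'"
  unfolding close_def
proof (intro allI impI conjI)
  fix r assume r: "r0 \<le> r"
  have "(6 * K * c ^ 2 + 32 * c ^ 6) * d * (D * (1 / r ^ k)) \<le> 1 / 4 * (D * (1 / r ^ k))"
    using small(7) D w_pos[OF r] by (intro mult_right_mono) auto
  then show "\<bar>P r - P' r\<bar> \<le> D / 4 / r ^ k"
    using step_P_contraction[OF b s D r] by (simp add: mult.assoc)
  have "c ^ 2 * d \<le> (6 * K * c ^ 2 + 32 * c ^ 6) * d"
  proof -
    have "0 \<le> 6 * K * c ^ 2" "0 \<le> c ^ 6" using K_pos c_pos by auto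
    then have "c ^ 2 \<le> 6 * K * c ^ 2 + 32 * c ^ 6" using c_pow[of 2 6] by linarith
    then show ?thesis using d_pos by (intro mult_right_mono) auto
  qed
  then have "c ^ 2 * d * (D * (1 / r ^ k)) \<le> 1 / 4 * (D * (1 / r ^ k))"
    using small(7) D w_pos[OF r] by (intro mult_right_mono) auto
  then show "\<bar>Q r - Q' r\<bar> \<le> D / 4 / r ^ k"
    using step_Q_contraction[OF b s D r] by (simp add: mult.assoc)
qed

text \<open>Both pairs are images of themselves, so their distance can be quartered indefinitely,
  starting from \<open>2 * K * d\<close>.\<close>

lemma fixed_point_unique:
  assumes b: "in_ball (K * d) p q" "in_ball (K * d) p' q'" and s: "step u p0 q0 p q p q" "step u p0 q0 p' q' p' q'"
    and r: "r0 \<le> r"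
  shows "p r = p' r \<and> q r = q' r"
proof -
  have cl: "close (2 * K * d / 4 ^ i) p q p' q'" for i
  proof (induction i)
    case 0
    show ?case unfolding close_def
    proof (intro allI impI conjI)
      fix r assume "r0 \<le> r"
      then have "\<bar>p r\<bar> \<le> K * d / r ^ k" "\<bar>p' r\<bar> \<le> K * d / r ^ k" "\<bar>q r\<bar> \<le> K * d / r ^ k" "\<bar>q' r\<bar> \<le> K * d / r ^ k"
        using b by (auto simp: in_ball_def)
      moreover have "2 * K * d / 4 ^ 0 / r ^ k = K * d / r ^ k + K * d / r ^ k"
        by (simp flip: add_divide_distrib)
      ultimately show "\<bar>p r - p' r\<bar> \<le> 2 * K * d / 4 ^ 0 / r ^ k" "\<bar>q r - q' r\<bar> \<le> 2 * K * d / 4 ^ 0 / r ^ k"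
        by linarith+
    qed
  next
    case (Suc i)
    have "0 \<le> 2 * K * d / 4 ^ i" using K_pos d_pos by simp
    from step_contraction[OF b s this Suc] show ?case by (simp add: mult.commute)
  qed
  have lim: "(\<lambda>i. (2 * K * d / r ^ k) * (1 / 4) ^ i) \<longlonglongrightarrow> 0"
    using tendsto_mult_right_zero[OF LIMSEQ_realpow_zero[of "1 / 4 :: real"], of "2 * K * d / r ^ k"] by simp
  have "\<bar>p r - p' r\<bar> \<le> (2 * K * d / r ^ k) * (1 / 4) ^ i" "\<bar>q r - q' r\<bar> \<le> (2 * K * d / r ^ k) * (1 / 4) ^ i" for i
    using cl[of i] r unfolding close_def by (auto simp: power_divide mult.commute)
  then have "\<bar>p r - p' r\<bar> \<le> 0" "\<bar>q r - q' r\<bar> \<le> 0"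
    using LIMSEQ_le_const[OF lim] by blast+
  then show ?thesis by simp
qed

text \<open>Images have components of size \<open>8 * c ^ 4 * d\<close>, hence norm at most
  \<open>16 * c ^ 4 * d\<close> as pairs; the assumption on \<open>K\<close> makes the ball
  invariant.\<close>

lemma fixed_point_exists:
  assumes K: "16 * c ^ 4 \<le> K"
  obtains p q where "step u p0 q0 p q p q" "in_ball (8 * c ^ 4 * d) p q"
proof -
  define St where "St f f' \<longleftrightarrow> step u p0 q0 (fst \<circ> f) (snd \<circ> f) (fst \<circ> f') (snd \<circ> f') \<and> in_ball (8 * c ^ 4 * d) (fst \<circ> f') (snd \<circ> f')"
    for f f' :: "real \<Rightarrow> real \<times> real"
  let ?X = "\<lambda>f :: real \<Rightarrow> real \<times> real. continuous_on {r0..} f \<and> (\<forall>r\<in>{r0..}. norm (f r) \<le> K * d * (1 / r ^ k))"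
  have ball: "in_ball (K * d) (fst \<circ> f) (snd \<circ> f)" if "?X f" for f
  proof -
    have "\<bar>fst (f r)\<bar> \<le> K * d / r ^ k" "\<bar>snd (f r)\<bar> \<le> K * d / r ^ k" if "r0 \<le> r" for r
      using \<open>?X f\<close> that norm_fst_le[of "fst (f r)" "snd (f r)"] norm_snd_le[of "snd (f r)" "fst (f r)"] by force+
    then show ?thesis using that
      unfolding in_ball_def by (auto intro!: continuous_intros simp: o_def)
  qed
  have ball_K: "in_ball (K * d) P Q" if "in_ball (8 * c ^ 4 * d) P Q" for P Q
  proof -
    have "8 * c ^ 4 * d / r ^ k \<le> K * d / r ^ k" if "r0 \<le> r" for r
    proof -
      have "0 < c ^ 4" using c_pos by simp
      then have "8 * c ^ 4 \<le> K" using K by linarith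
      then show ?thesis using d_pos that r0_pos by (intro divide_right_mono mult_right_mono) auto
    qed
    then show ?thesis using that unfolding in_ball_def by (meson order_trans)
  qed
  have ex: "\<exists>f'. ?X f' \<and> St f f'" if X: "?X f" for f
  proof -
    obtain P Q where PQ: "step u p0 q0 (fst \<circ> f) (snd \<circ> f) P Q" "in_ball (8 * c ^ 4 * d) P Q"
      using step_exists[OF ball[OF X]] by blast
    have "norm (P r, Q r) \<le> K * d * (1 / r ^ k)" if "r0 \<le> r" for r
    proof -
      have "norm (P r, Q r) \<le> \<bar>P r\<bar> + \<bar>Q r\<bar>" using norm_Pair_le[of "P r" "Q r"] by simp
      also have "\<dots> \<le> 8 * c ^ 4 * d / r ^ k + 8 * c ^ 4 * d / r ^ k"
        using PQ(2) that unfolding in_ball_def by (intro add_mono) auto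
      also have "\<dots> = (16 * c ^ 4) * d * (1 / r ^ k)" by simp
      also have "\<dots> \<le> K * d * (1 / r ^ k)"
        using K d_pos that r0_pos by (intro mult_right_mono) auto
      finally show ?thesis .
    qed
    moreover have "continuous_on {r0..} (\<lambda>r. (P r, Q r))"
      using PQ(2) unfolding in_ball_def by (intro continuous_intros) auto
    ultimately show ?thesis using PQ by (intro exI[of _ "\<lambda>r. (P r, Q r)"]) (simp add: St_def o_def)
  qed
  obtain f f' where f: "?X f" "?X f'" "St f f'" "\<And>r. r \<in> {r0..} \<Longrightarrow> f r = f' r"
  proof (rule relational_contraction[of "{r0..}" "\<lambda>r. 1 / r ^ k" c "K * d" St])
    fix f1 f2 g1 g2 :: "real \<Rightarrow> real \<times> real" and D r
    assume *: "?X f1" "?X f2" "St f1 g1" "St f2 g2" "0 \<le> D" "r \<in> {r0..}"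
      and D: "\<And>r. r \<in> {r0..} \<Longrightarrow> norm (f1 r - f2 r) \<le> D * (1 / r ^ k)"
    have "close D (fst \<circ> f1) (snd \<circ> f1) (fst \<circ> f2) (snd \<circ> f2)"
      unfolding close_def
    proof (intro allI impI conjI)
      fix r assume "r0 \<le> r"
      then have "norm (f1 r - f2 r) \<le> D / r ^ k" using D[of r] by simp
      moreover have "\<bar>fst (f1 r - f2 r)\<bar> \<le> norm (f1 r - f2 r)" "\<bar>snd (f1 r - f2 r)\<bar> \<le> norm (f1 r - f2 r)"
        using norm_fst_le[of "fst (f1 r - f2 r)" "snd (f1 r - f2 r)"]
          norm_snd_le[of "snd (f1 r - f2 r)" "fst (f1 r - f2 r)"] unfolding prod.collapse by simp_all
      ultimately show "\<bar>(fst \<circ> f1) r - (fst \<circ> f2) r\<bar> \<le> D / r ^ k" "\<bar>(snd \<circ> f1) r - (snd \<circ> f2) r\<bar> \<le> D / r ^ k"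
        by simp_all
    qed
    then have cl: "close (D / 4) (fst \<circ> g1) (snd \<circ> g1) (fst \<circ> g2) (snd \<circ> g2)"
      using * by (intro step_contraction[OF ball[OF *(1)] ball[OF *(2)]]) (auto simp: St_def)
    have "norm (g1 r - g2 r) \<le> \<bar>fst (g1 r) - fst (g2 r)\<bar> + \<bar>snd (g1 r) - snd (g2 r)\<bar>"
      using norm_Pair_le[of "fst (g1 r - g2 r)" "snd (g1 r - g2 r)"] unfolding prod.collapse by simp
    also have "\<dots> \<le> D / 4 / r ^ k + D / 4 / r ^ k"
      using cl * unfolding close_def by (intro add_mono) auto
    finally show "norm (g1 r - g2 r) \<le> D / 2 * (1 / r ^ k)" by simp
  qed (use ex w_le w_pos K_pos d_pos r0_pos in \<open>auto simp: less_imp_le\<close>)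
  define p q where "p = fst \<circ> f'" and "q = snd \<circ> f'"
  have pq: "in_ball (8 * c ^ 4 * d) p q" "step u p0 q0 (fst \<circ> f) (snd \<circ> f) p q" using f(3) by (auto simp: St_def p_def q_def)
  \<comment> \<open>\<open>p\<close> and \<open>q\<close> are an image of a pair that merely agrees
    with them on the half line. Their own image \<open>P\<close>, \<open>Q\<close> is at distance 0
    from them by contraction with \<open>D = 0\<close>, so the equations for \<open>P\<close>,
    \<open>Q\<close> become equations for \<open>p\<close>, \<open>q\<close>.\<close>
  obtain P Q where PQ: "step u p0 q0 p q P Q" using step_exists[OF ball_K[OF pq(1)]] by blast
  have cl: "close 0 (fst \<circ> f) (snd \<circ> f) p q" using f(4) by (simp add: close_def p_def q_def)
  have "close (0 / 4) p q P Q"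
    by (rule step_contraction[OF ball[OF f(1)] ball_K[OF pq(1)] pq(2) PQ order_refl cl])
  then have eq: "P r = p r" "Q r = q r" if "r0 \<le> r" for r
    using that by (auto simp: close_def)
  have tr: "(F has_real_derivative D) (at r within {r0..})"
    if "(G has_real_derivative D) (at r within {r0..})" "\<And>s. r0 \<le> s \<Longrightarrow> G s = F s" "r0 \<le> r" for F G D r
    by (rule has_field_derivative_transform_within[OF that(1), of 1]) (use that in auto)
  have g_eq: "g u p Q r = g u p q r" if "r0 \<le> r" for r using eq[OF that] by (simp add: g_def)
  have "step u p0 q0 p q p q"
    unfolding step_def
  proof (intro conjI)
    show "\<exists>B. \<forall>r\<ge>r0. \<bar>p r\<bar> \<le> B / r ^ k \<and> \<bar>q r\<bar> \<le> B / r ^ k" using pq(1) unfolding in_ball_def by blast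
    show "q r0 = q0" "0 < u \<longrightarrow> p r0 = p0" using PQ eq unfolding step_def by auto
    obtain E where E: "\<forall>r\<ge>r0. (Q has_real_derivative (u * h u p q r - E) / (kappa * r ^ Suc k)) (at r within {r0..})"
      using PQ unfolding step_def by blast
    have "\<forall>r\<ge>r0. (q has_real_derivative (u * h u p q r - E) / (kappa * r ^ Suc k)) (at r within {r0..})"
      using E tr eq by blast
    then show "\<exists>E. \<forall>r\<ge>r0. (q has_real_derivative (u * h u p q r - E) / (kappa * r ^ Suc k)) (at r within {r0..})" by blast
    show "\<forall>r\<ge>r0. (p has_real_derivative - (beta * r ^ Suc k / (u * mt p)) * (p r - g u p q r)) (at r within {r0..})"
    proof (intro allI impI)
      fix r assume r: "r0 \<le> r"
      have "(P has_real_derivative - (beta * r ^ Suc k / (u * mt p)) * (P r - g u p Q r)) (at r within {r0..})"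
        using PQ r unfolding step_def by blast
      then have "(p has_real_derivative - (beta * r ^ Suc k / (u * mt p)) * (P r - g u p Q r)) (at r within {r0..})"
        by (rule tr[OF _ eq(1) r])
      then show "(p has_real_derivative - (beta * r ^ Suc k / (u * mt p)) * (p r - g u p q r)) (at r within {r0..})"
        by (simp add: eq(1)[OF r] g_eq[OF r])
    qed
  qed
  then show ?thesis using that pq(1) by blast
qed

end

section \<open>The stationary equations\<close>

lemma at_within_atLeast_neq_bot: "a \<le> r \<Longrightarrow> at r within {a..} \<noteq> bot" for a r :: real
proof -
  assume r: "a \<le> r"
  have "{a..} \<noteq> {b}" for b
  proof
    assume eq: "{a..} = {b}"
    have "a \<in> {b}" "a + 1 \<in> {b}" unfolding eq[symmetric] by auto
    then show False by simp
  qed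
  then have "r islimpt {a..}"
    using r by (intro connected_imp_perfect) auto
  then show ?thesis by (simp add: trivial_limit_within)
qed

text \<open>\<open>dr\<close> is defined through a choice; its value is forced because the half line
  accumulates at each of its points, the endpoint \<open>a\<close> included.\<close>

lemma dr_eq:
  assumes "(f has_real_derivative D) (at r within {a..})" "a \<le> r"
  shows "dr a f r = D"
  unfolding dr_def
  using assms at_within_atLeast_neq_bot
  by (intro vector_derivative_within) (auto simp: has_real_derivative_iff_has_vector_derivative)

lemma DERIV_transform_atLeast:
  fixes f g :: "real \<Rightarrow> real"
  assumes "(f has_real_derivative D) (at r within {a..})" "\<And>s. a \<le> s \<Longrightarrow> f s = g s" "a \<le> r"
  shows "(g has_real_derivative D) (at r within {a..})"
  by (rule has_field_derivative_transform_within[OF assms(1), of 1]) (use assms in auto)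

text \<open>An order-by-order form of \<open>C_infty_on\<close>, suited to the bootstrap in which
  regularity of the right-hand side of the first-order system gains one order for the
  solution.\<close>

primrec Ck :: "real \<Rightarrow> nat \<Rightarrow> (real \<Rightarrow> real) \<Rightarrow> bool" where
  "Ck a 0 f \<longleftrightarrow> continuous_on {a..} f"
| "Ck a (Suc j) f \<longleftrightarrow> (\<exists>f'. (\<forall>r\<ge>a. (f has_real_derivative f' r) (at r within {a..})) \<and> Ck a j f')"

lemma Ck_cong:
  assumes "Ck a j f" "\<And>r. a \<le> r \<Longrightarrow> f r = g r"
  shows "Ck a j g"
proof (cases j)
  case 0
  then show ?thesis using assms continuous_on_cong[of "{a..}" "{a..}" f g] by auto
next
  case (Suc i)
  then show ?thesis using assms DERIV_transform_atLeast[of f _ _ a g] by auto blast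
qed

lemma Ck_Suc_imp: "Ck a (Suc j) f \<Longrightarrow> Ck a j f"
proof (induction j arbitrary: f)
  case 0
  then obtain f' where "\<And>r. a \<le> r \<Longrightarrow> (f has_real_derivative f' r) (at r within {a..})" by auto
  then have "continuous_on {a..} f" by (intro DERIV_continuous_on) auto
  then show ?case by simp
next
  case (Suc j)
  obtain f' where f': "\<forall>r\<ge>a. (f has_real_derivative f' r) (at r within {a..})" "Ck a (Suc j) f'"
    using Suc.prems Ck.simps(2)[of a "Suc j" f] by blast
  then have "Ck a j f'" using Suc.IH by blast
  then show ?case using f'(1) by auto
qed

lemma Ck_const: "Ck a j (\<lambda>r. c)"
proof (induction j arbitrary: c)
  case (Suc j)
  show ?case using Suc[of 0] by (auto intro!: exI[of _ "\<lambda>r. 0"])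
qed simp

lemma Ck_ident: "Ck a j (\<lambda>r. r)"
proof (cases j)
  case (Suc i)
  show ?thesis unfolding Suc using Ck_const[of a i 1] by (auto intro!: exI[of _ "\<lambda>r. 1"])
qed (simp add: continuous_on_id)

lemma Ck_add: "Ck a j f \<Longrightarrow> Ck a j g \<Longrightarrow> Ck a j (\<lambda>r. f r + g r)"
proof (induction j arbitrary: f g)
  case (Suc j)
  then obtain f' g' where
    "\<forall>r\<ge>a. (f has_real_derivative f' r) (at r within {a..})" "Ck a j f'"
    "\<forall>r\<ge>a. (g has_real_derivative g' r) (at r within {a..})" "Ck a j g'" by auto
  then show ?case using Suc.IH[of f' g']
    by (auto intro!: exI[of _ "\<lambda>r. f' r + g' r"] DERIV_add)
qed (auto intro: continuous_intros)

lemma Ck_mult: "Ck a j f \<Longrightarrow> Ck a j g \<Longrightarrow> Ck a j (\<lambda>r. f r * g r)"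
proof (induction j arbitrary: f g)
  case (Suc j)
  then obtain f' g' where d:
    "\<forall>r\<ge>a. (f has_real_derivative f' r) (at r within {a..})" "Ck a j f'"
    "\<forall>r\<ge>a. (g has_real_derivative g' r) (at r within {a..})" "Ck a j g'" by auto
  have "Ck a j (\<lambda>r. f' r * g r + g' r * f r)"
    by (rule Ck_add[OF Suc.IH[OF d(2) Ck_Suc_imp[OF Suc.prems(2)]] Suc.IH[OF d(4) Ck_Suc_imp[OF Suc.prems(1)]]])
  then show ?case using d
    by (auto intro!: exI[of _ "\<lambda>r. f' r * g r + g' r * f r"] DERIV_mult)
qed (auto intro: continuous_intros)

lemma Ck_inverse:
  assumes "\<And>r. a \<le> r \<Longrightarrow> f r \<noteq> 0"
  shows "Ck a j f \<Longrightarrow> Ck a j (\<lambda>r. 1 / f r)"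
proof (induction j)
  case 0
  then show ?case using assms by (auto intro!: continuous_intros)
next
  case (Suc j)
  then obtain f' where d: "\<forall>r\<ge>a. (f has_real_derivative f' r) (at r within {a..})" "Ck a j f'" by auto
  have "Ck a j (\<lambda>r. (-1) * f' r * (1 / f r * (1 / f r)))"
    using d(2) Suc.IH[OF Ck_Suc_imp[OF Suc.prems]] by (intro Ck_mult Ck_const)
  moreover have "((\<lambda>r. 1 / f r) has_real_derivative (-1) * f' r * (1 / f r * (1 / f r))) (at r within {a..})"
    if "a \<le> r" for r
    using d assms that by (auto intro!: derivative_eq_intros)
  ultimately show ?case
    unfolding Ck.simps by (intro exI[of _ "\<lambda>r. (-1) * f' r * (1 / f r * (1 / f r))"]) simp
qed

lemma Ck_diff: "Ck a j f \<Longrightarrow> Ck a j g \<Longrightarrow> Ck a j (\<lambda>r. f r - g r)"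
  using Ck_add[of a j f "\<lambda>r. (-1) * g r"] Ck_mult[OF Ck_const[of a j "-1"], of g] by simp

lemma Ck_power: "Ck a j f \<Longrightarrow> Ck a j (\<lambda>r. f r ^ i)"
  by (induction i) (simp_all add: Ck_const Ck_mult)

text \<open>The derivatives witnessing \<open>Ck\<close> may vary with \<open>j\<close>. Derivatives
  within the half line being unique, the iterates of \<open>dr a\<close> form one sequence that
  works for all orders.\<close>

lemma C_infty_on_if_Ck:
  assumes "\<And>j. Ck a j f"
  shows "C_infty_on {a..} f"
proof -
  have D: "(f has_real_derivative dr a f r) (at r within {a..})" if "Ck a (Suc j) f" "a \<le> r" for f r j
    using that dr_eq[of f _ r a] by auto
  have C: "Ck a j (dr a f)" if f: "Ck a (Suc j) f" for f j
  proof -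
    obtain f' where f': "\<forall>r\<ge>a. (f has_real_derivative f' r) (at r within {a..})" "Ck a j f'" using f by auto
    show ?thesis by (rule Ck_cong[OF f'(2)]) (use f'(1) dr_eq[of f _ _ a] in auto)
  qed
  have all: "Ck a j ((dr a ^^ i) f)" for i j
  proof (induction i arbitrary: j)
    case (Suc i)
    show ?case using C[OF Suc[of "Suc j"]] by simp
  qed (use assms in simp)
  show ?thesis
    unfolding C_infty_on_def
  proof (intro exI[of _ "\<lambda>i. (dr a ^^ i) f"] conjI ballI allI)
    show "((dr a ^^ i) f has_real_derivative (dr a ^^ Suc i) f x) (at x within {a..})" if "x \<in> {a..}" for i x
      using D[OF all, of x i] that by simp
  qed simp
qed

lemma C_infty_on_derivs:
  assumes "C_infty_on {a..} f"
  obtains f1 f2 where "\<And>r. a \<le> r \<Longrightarrow> (f has_real_derivative f1 r) (at r within {a..})"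
    "\<And>r. a \<le> r \<Longrightarrow> (f1 has_real_derivative f2 r) (at r within {a..})"
proof -
  obtain D where D: "\<And>x. a \<le> x \<Longrightarrow> D 0 x = f x" "\<And>k x. a \<le> x \<Longrightarrow> (D k has_real_derivative D (Suc k) x) (at x within {a..})"
    using assms unfolding C_infty_on_def by auto
  have "(f has_real_derivative D 1 r) (at r within {a..})" if "a \<le> r" for r
    by (rule DERIV_transform_atLeast[OF _ D(1) that]) (use D(2)[of r 0] that in auto)
  moreover have "(D 1 has_real_derivative D 2 r) (at r within {a..})" if "a \<le> r" for r
    using D(2)[of r 1] that by (simp add: numeral_2_eq_2)
  ultimately show ?thesis using that by blast
qed

section \<open>Reduction of the stationary equations to first integrals\<close>

lemma DERIV_inverse_power_Suc:
  "0 < r \<Longrightarrow> ((\<lambda>r::real. 1 / r ^ Suc k) has_real_derivative - (real k + 1) * (1 / r ^ Suc k) * (1 / r)) (at r within S)"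
  using DERIV_inverse_power[of r "Suc k" S] by (simp add: field_simps)

text \<open>With \<open>v = 1 / \<rho>\<close> the volume flux \<open>r ^ (n - 1) u\<close> is \<open>M v\<close>.\<close>

lemma stationary_equations_iff:
  fixes k n :: nat and rho u theta v v1 t1 W Y u1 :: "real \<Rightarrow> real" and r0 M :: real
  assumes W_def: "W = (\<lambda>r. 1 / r ^ Suc k)" and Y_def: "Y = (\<lambda>r. 1 / r)"
    and u1_def: "u1 = (\<lambda>r. M * (v1 r * W r - (real k + 1) * v r * W r * Y r))"
    and n: "n = k + 2" and r0: "0 < r0" and r: "r0 \<le> r"
    and v: "\<And>s. r0 \<le> s \<Longrightarrow> (v has_real_derivative v1 s) (at s within {r0..})" "\<And>s. r0 \<le> s \<Longrightarrow> 0 < v s"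
    and th: "\<And>s. r0 \<le> s \<Longrightarrow> (theta has_real_derivative t1 s) (at s within {r0..})"
    and rho: "\<And>s. r0 \<le> s \<Longrightarrow> rho s = 1 / v s" and u: "\<And>s. r0 \<le> s \<Longrightarrow> u s = M * v s * W s"
    and X: "((\<lambda>s. M * v1 s * W s) has_real_derivative X) (at r within {r0..})"
    and Z: "((\<lambda>s. s ^ Suc k * t1 s) has_real_derivative Z) (at r within {r0..})"
  shows "dr r0 (\<lambda>s. s^(n-1) * rho s * u s) r / r^(n-1) = 0"
    and "dr r0 (\<lambda>s. s^(n-1) * rho s * (u s)^2) r / r^(n-1) + dr r0 (\<lambda>s. R * rho s * theta s) r
              = mu * dr r0 (\<lambda>s. dr r0 (\<lambda>t. t^(n-1) * u t) s / s^(n-1)) r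
      \<longleftrightarrow> M * u1 r * W r + R * (t1 r / v r - theta r * v1 r / (v r)\<^sup>2) = mu * X"
    and "dr r0 (\<lambda>s. s^(n-1) * rho s * u s * (cV * theta s + (u s)^2 / 2)) r / r^(n-1)
              + dr r0 (\<lambda>s. s^(n-1) * (R * rho s * theta s) * u s) r / r^(n-1)
              = kappa * dr r0 (\<lambda>s. s^(n-1) * dr r0 theta s) r / r^(n-1)
                + mu * dr r0 (\<lambda>s. dr r0 (\<lambda>t. t^(n-1) * u t) s / s^(n-1)) r * u r
                + (2 * nu * (dr r0 u r)^2 + 2 * nu * (real n - 1) * (u r / r)^2
                      + lam * (dr r0 u r + (real n - 1) / r * u r)^2)
      \<longleftrightarrow> M * (cV * t1 r + (M * v r * W r) * u1 r) * W r + M * R * t1 r * W r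
            = kappa * Z * W r + mu * X * (M * v r * W r)
              + (2 * nu * (u1 r)\<^sup>2 + 2 * nu * (real k + 1) * (M * v r * W r * Y r)\<^sup>2 + lam * (M * v1 r * W r)\<^sup>2)"
proof -
  have n1: "n - 1 = Suc k" and nr: "real n - 1 = real k + 1" using n by auto
  have W': "(W has_real_derivative - (real k + 1) * W s * Y s) (at s within {r0..})" if "r0 \<le> s" for s
    unfolding W_def Y_def using DERIV_inverse_power_Suc[of s k "{r0..}"] r0 that by simp
  have pW: "s ^ Suc k * W s = 1" "0 < s" if "r0 \<le> s" for s using r0 that by (auto simp: W_def)
  have v0: "v s \<noteq> 0" if "r0 \<le> s" for s using v(2)[OF that] by simp
  have u1: "(u has_real_derivative u1 s) (at s within {r0..})" if s: "r0 \<le> s" for s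
  proof (rule DERIV_transform_atLeast[OF _ u[symmetric] s])
    show "((\<lambda>s. M * v s * W s) has_real_derivative u1 s) (at s within {r0..})"
      using DERIV_mult[OF DERIV_cmult[OF v(1)[OF s], of M] W'[OF s]]
      by (rule DERIV_cong) (simp add: u1_def algebra_simps)
  qed
  have mass: "s ^ Suc k * rho s * u s = M" if "r0 \<le> s" for s
    using v0[OF that] pW(2)[OF that] by (simp add: rho[OF that] u[OF that] W_def)
  have d1: "dr r0 (\<lambda>s. s^(n-1) * rho s * u s) r = 0"
    unfolding n1 by (rule dr_eq[OF DERIV_transform_atLeast[OF DERIV_const[of M]] r]) (use mass r in auto)
  then show "dr r0 (\<lambda>s. s^(n-1) * rho s * u s) r / r^(n-1) = 0" by simp
  have d2: "dr r0 (\<lambda>s. s^(n-1) * rho s * (u s)^2) r = M * u1 r"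
    unfolding n1
  proof (rule dr_eq[OF DERIV_transform_atLeast[OF DERIV_cmult[OF u1[OF r], of M] _ r] r])
    show "M * u s = s ^ Suc k * rho s * (u s)\<^sup>2" if "r0 \<le> s" for s
      using mass[OF that] by (simp add: power2_eq_square)
  qed
  have d3: "dr r0 (\<lambda>s. R * rho s * theta s) r = R * (t1 r / v r - theta r * v1 r / (v r)\<^sup>2)"
  proof (rule dr_eq[OF DERIV_transform_atLeast[OF DERIV_cmult[OF DERIV_divide[OF th[OF r] v(1)[OF r] v0[OF r]], of R, THEN DERIV_cong] _ r] r])
    show "R * ((t1 r * v r - theta r * v1 r) / (v r * v r)) = R * (t1 r / v r - theta r * v1 r / (v r)\<^sup>2)"
      using v0[OF r] by (simp add: field_simps power2_eq_square)
    show "R * (theta s / v s) = R * rho s * theta s" if "r0 \<le> s" for s using rho[OF that] by simp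
  qed
  have dw: "dr r0 (\<lambda>t. t^(n-1) * u t) s = M * v1 s" if s: "r0 \<le> s" for s
    unfolding n1
  proof (rule dr_eq[OF DERIV_transform_atLeast[OF DERIV_cmult[OF v(1)[OF s], of M] _ s] s])
    show "M * v s = s ^ Suc k * u s" if "r0 \<le> s" for s using u[OF that] pW[OF that] by simp
  qed
  have d4: "dr r0 (\<lambda>s. dr r0 (\<lambda>t. t^(n-1) * u t) s / s^(n-1)) r = X"
    by (rule dr_eq[OF DERIV_transform_atLeast[OF X _ r] r]) (simp only: dw, simp only: n1 W_def, simp)
  have d5: "dr r0 u r = u1 r" by (rule dr_eq[OF u1[OF r] r])
  have d6: "dr r0 (\<lambda>s. s^(n-1) * rho s * u s * (cV * theta s + (u s)^2 / 2)) r = M * (cV * t1 r + (M * v r * W r) * u1 r)"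
  proof (rule dr_eq[OF DERIV_transform_atLeast[OF _ _ r] r])
    have "((\<lambda>s. M * (cV * theta s + u s ^ 2 / 2)) has_real_derivative M * (cV * t1 r + (real 2 * (u1 r * u r ^ (2 - Suc 0))) / 2)) (at r within {r0..})"
      by (intro DERIV_cmult DERIV_add DERIV_cdivide DERIV_power th u1 r)
    then show "((\<lambda>s. M * (cV * theta s + u s ^ 2 / 2)) has_real_derivative M * (cV * t1 r + (M * v r * W r) * u1 r)) (at r within {r0..})"
      using u[OF r] by (simp add: mult.commute)
  qed (simp only: n1 mass)
  have d7: "dr r0 (\<lambda>s. s^(n-1) * (R * rho s * theta s) * u s) r = M * R * t1 r"
  proof (rule dr_eq[OF DERIV_transform_atLeast[OF DERIV_cmult[OF th[OF r], of "M * R"] _ r] r])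
    show "M * R * theta s = s^(n-1) * (R * rho s * theta s) * u s" if "r0 \<le> s" for s
      using arg_cong[OF mass[OF that], of "\<lambda>x. x * R * theta s"] unfolding n1 by (simp only: mult_ac)
  qed
  have d8: "dr r0 (\<lambda>s. s^(n-1) * dr r0 theta s) r = Z"
    by (rule dr_eq[OF DERIV_transform_atLeast[OF Z _ r] r]) (simp only: n1 dr_eq[OF th])
  have dv: "x / r ^ (n - 1) = x * W r" for x unfolding n1 W_def by simp
  show "dr r0 (\<lambda>s. s^(n-1) * rho s * (u s)^2) r / r^(n-1) + dr r0 (\<lambda>s. R * rho s * theta s) r
              = mu * dr r0 (\<lambda>s. dr r0 (\<lambda>t. t^(n-1) * u t) s / s^(n-1)) r
      \<longleftrightarrow> M * u1 r * W r + R * (t1 r / v r - theta r * v1 r / (v r)\<^sup>2) = mu * X"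
    unfolding d2 d3 d4 dv ..
  \<comment> \<open>The divergence of the velocity: the geometric term cancels against the one in
    \<open>u1\<close>.\<close>
  have e: "u1 r + (real k + 1) / r * u r = M * v1 r * W r"
    unfolding u[OF r] u1_def Y_def by (simp add: algebra_simps add_divide_distrib)
  have e2: "u r / r = M * v r * W r * Y r" by (simp add: u[OF r] Y_def)
  show "dr r0 (\<lambda>s. s^(n-1) * rho s * u s * (cV * theta s + (u s)^2 / 2)) r / r^(n-1)
              + dr r0 (\<lambda>s. s^(n-1) * (R * rho s * theta s) * u s) r / r^(n-1)
              = kappa * dr r0 (\<lambda>s. s^(n-1) * dr r0 theta s) r / r^(n-1)
                + mu * dr r0 (\<lambda>s. dr r0 (\<lambda>t. t^(n-1) * u t) s / s^(n-1)) r * u r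
                + (2 * nu * (dr r0 u r)^2 + 2 * nu * (real n - 1) * (u r / r)^2
                      + lam * (dr r0 u r + (real n - 1) / r * u r)^2)
      \<longleftrightarrow> M * (cV * t1 r + (M * v r * W r) * u1 r) * W r + M * R * t1 r * W r
            = kappa * Z * W r + mu * X * (M * v r * W r)
              + (2 * nu * (u1 r)\<^sup>2 + 2 * nu * (real k + 1) * (M * v r * W r * Y r)\<^sup>2 + lam * (M * v1 r * W r)\<^sup>2)"
    unfolding d6 d7 d8 d4 d5 nr e e2 dv unfolding u[OF r] ..
qed

text \<open>Conservation of total energy; the terms with the temperature cancel because \<open>p v = R \<theta>\<close>.\<close>

lemma energy_identity:
  fixes M v v1 th t1 J W Y s :: real
  assumes "v * s = 1" "mu = 2 * nu + lam"
    and mom: "mu * (M * v1 * W) = R * th * s - P + M\<^sup>2 * (v * W\<^sup>2 - K * J)"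
    and X: "mu * X = R * (t1 * s - th * v1 * s\<^sup>2) + M\<^sup>2 * (v1 * W\<^sup>2 - K * v * W\<^sup>2 * Y)"
  shows "M * (cV * t1 + (M * v * W) * (M * (v1 * W - K * v * W * Y))) * W + M * R * t1 * W
    = (M * cV * t1 + M * P * v1 + M ^ 3 * (K * v1 * J - v * v1 * W\<^sup>2)
        + 2 * nu * K * M\<^sup>2 * (2 * v * v1 * W * Y - (K + 1) * v\<^sup>2 * W * Y\<^sup>2)) * W
      + mu * X * (M * v * W)
      + (2 * nu * (M * (v1 * W - K * v * W * Y))\<^sup>2 + 2 * nu * K * (M * v * W * Y)\<^sup>2 + lam * (M * v1 * W)\<^sup>2)"
proof -
  \<comment> \<open>Once \<open>P\<close> and \<open>mu * X\<close> are eliminated and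
    \<open>mu\<close> is expanded, the claim is polynomial and follows from
    \<open>v * s = 1\<close>.\<close>
  have P: "P = R * th * s + M\<^sup>2 * (v * W\<^sup>2 - K * J) - mu * (M * v1 * W)" using mom by simp
  show ?thesis
    unfolding X unfolding P unfolding assms(2) using assms(1) by algebra
qed


text \<open>The function \<open>J\<close> stands for the tail integral. Differentiating
  \<open>v * W\<^sup>2\<close> gives the geometric term \<open>K * v * W\<^sup>2 * Y\<close> twice,
  while the momentum equation contains it once; \<open>K * J\<close> takes one of them back.\<close>

lemma momentum_flux_deriv:
  fixes v th J W :: "real \<Rightarrow> real" and Y K r :: real
  assumes "(v has_real_derivative v1) (at r within S)" "v r \<noteq> 0" "(th has_real_derivative t1) (at r within S)"
    "(J has_real_derivative - (v r * (W r)\<^sup>2 * Y)) (at r within S)"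
    "(W has_real_derivative - K * W r * Y) (at r within S)"
  shows "((\<lambda>r. R * th r * (1 / v r) - P + M\<^sup>2 * (v r * (W r)\<^sup>2 - K * J r)) has_real_derivative
     R * (t1 * (1 / v r) - th r * v1 * (1 / v r)\<^sup>2) + M\<^sup>2 * (v1 * (W r)\<^sup>2 - K * v r * (W r)\<^sup>2 * Y)) (at r within S)"
  by (rule derivative_eq_intros assms refl)+
    (use assms(2) in \<open>simp add: field_simps power2_eq_square\<close>)

text \<open>The terms \<open>K * v\<^sup>2 * W\<^sup>2 * Y\<close> arising from \<open>J\<close> and
  from \<open>W\<^sup>2\<close> cancel. The last summand is
  \<open>2 * nu * K * r ^ (n - 2) * u\<^sup>2\<close>: its derivative is \<open>r ^ (n - 1)\<close>
  times the excess of \<open>mu\<close> times the squared divergence over the dissipation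
  function.\<close>

lemma energy_flux_deriv:
  fixes v th J W Y :: "real \<Rightarrow> real" and K r :: real
  assumes "(v has_real_derivative v1) (at r within S)" "(th has_real_derivative t1) (at r within S)"
    "(J has_real_derivative - (v r * (W r)\<^sup>2 * Y r)) (at r within S)"
    "(W has_real_derivative - K * W r * Y r) (at r within S)" "(Y has_real_derivative - (Y r)\<^sup>2) (at r within S)"
  shows "((\<lambda>r. M * cV * th r + M * P * v r + M ^ 3 * (K * v r * J r - (v r)\<^sup>2 / 2 * (W r)\<^sup>2)
        + 2 * nu * K * M\<^sup>2 * (v r)\<^sup>2 * W r * Y r) has_real_derivative
     M * cV * t1 + M * P * v1 + M ^ 3 * (K * v1 * J r - v r * v1 * (W r)\<^sup>2)
        + 2 * nu * K * M\<^sup>2 * (2 * v r * v1 * W r * Y r - (K + 1) * (v r)\<^sup>2 * W r * (Y r)\<^sup>2)) (at r within S)"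
proof -
  have "((\<lambda>r. M * cV * th r + M * P * v r + M ^ 3 * (K * v r * J r - (v r)\<^sup>2 * (W r)\<^sup>2 * (1 / 2))
        + 2 * nu * K * M\<^sup>2 * ((v r)\<^sup>2 * W r * Y r)) has_real_derivative
     M * cV * t1 + M * P * v1 + M ^ 3 * (K * v1 * J r - v r * v1 * (W r)\<^sup>2)
        + 2 * nu * K * M\<^sup>2 * (2 * v r * v1 * W r * Y r - (K + 1) * (v r)\<^sup>2 * W r * (Y r)\<^sup>2)) (at r within S)"
    by (rule derivative_eq_intros assms refl)+ (simp add: algebra_simps power2_eq_square)
  then show ?thesis by (simp add: mult.assoc)
qed

text \<open>If \<open>l\<close> were positive, \<open>v1 r\<close> would eventually exceed
  \<open>l / 2\<close> and \<open>v\<close> would grow at least linearly. Applied to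
  \<open>v\<close> and to \<open>- v\<close>, this forces the integration constant of the momentum
  equation to vanish.\<close>

lemma limit_0_if_convergent:
  fixes v :: "real \<Rightarrow> real"
  assumes v: "\<And>r. a \<le> r \<Longrightarrow> (v has_real_derivative v1 r) (at r within {a..})" "(v \<longlongrightarrow> L) at_top"
    and v1: "((\<lambda>r. v1 r * (1 / r ^ Suc k)) \<longlongrightarrow> l) at_top"
  shows "l \<le> 0"
proof (rule ccontr)
  assume "\<not> l \<le> 0"
  then have l: "0 < l / 2" "l / 2 < l" by auto
  have "\<forall>\<^sub>F r in at_top. l / 2 < v1 r * (1 / r ^ Suc k)"
    by (rule order_tendstoD(1)[OF v1 l(2)])
  then obtain b where b: "\<And>r. b \<le> r \<Longrightarrow> l / 2 < v1 r * (1 / r ^ Suc k)"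
    unfolding eventually_at_top_linorder by blast
  define e where "e = max a (max b 1)"
  have e: "a \<le> e" "b \<le> e" "1 \<le> e" by (auto simp: e_def)
  have lower: "l / 2 \<le> v1 r" if "e \<le> r" for r
  proof -
    have r: "1 \<le> r ^ Suc k" using e that by (intro one_le_power) auto
    have "l / 2 * r ^ Suc k < v1 r"
      using b[of r] e that r by (simp add: pos_less_divide_eq del: power_Suc)
    moreover have "l / 2 * 1 \<le> l / 2 * r ^ Suc k" using l r by (intro mult_left_mono) auto
    ultimately show ?thesis by linarith
  qed
  have grow: "v e + l / 2 * (r - e) \<le> v r" if "e \<le> r" for r
  proof -
    have "v e - l / 2 * e \<le> v r - l / 2 * r"
    proof (rule nondecreasing_if_deriv_nonneg[OF _ _ order_refl that])
      show "((\<lambda>r. v r - l / 2 * r) has_real_derivative v1 r - l / 2 * 1) (at r within {e..})" if "e \<le> r" for r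
        using e that by (intro DERIV_diff DERIV_cmult DERIV_ident DERIV_subset[OF v(1)[of r]]) auto
      show "0 \<le> v1 r - l / 2 * 1" if "e \<le> r" for r using lower[OF that] by simp
    qed
    then show ?thesis unfolding right_diff_distrib by linarith
  qed
  have "\<forall>\<^sub>F r in at_top. v r < L + 1"
    by (rule order_tendstoD(2)[OF v(2)]) simp
  moreover have "\<forall>\<^sub>F r in at_top. e + 2 / l * \<bar>L + 1 - v e\<bar> \<le> r" by (rule eventually_ge_at_top)
  ultimately have "\<forall>\<^sub>F r in at_top. e + 2 / l * \<bar>L + 1 - v e\<bar> \<le> r \<and> v r < L + 1"
    by eventually_elim simp
  then obtain r where r: "e + 2 / l * \<bar>L + 1 - v e\<bar> \<le> r" "v r < L + 1"
    using eventually_happens'[OF trivial_limit_at_top_linorder] by blast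
  have "l / 2 * (2 / l * \<bar>L + 1 - v e\<bar>) \<le> l / 2 * (r - e)"
    using r l by (intro mult_left_mono) auto
  then have "\<bar>L + 1 - v e\<bar> \<le> l / 2 * (r - e)" using l by simp
  moreover have "e \<le> r"
  proof -
    have "0 \<le> 2 / l * \<bar>L + 1 - v e\<bar>" using l by simp
    then show ?thesis using r by linarith
  qed
  ultimately show False using grow[of r] r(2) by linarith
qed

lemma constant_if_deriv_0:
  fixes f :: "real \<Rightarrow> real"
  assumes "\<And>r. a \<le> r \<Longrightarrow> (f has_real_derivative 0) (at r within {a..})" "a \<le> r"
  shows "f r = f a"
proof (rule antisym)
  show "f a \<le> f r"
    by (rule nondecreasing_if_deriv_nonneg[of a f "\<lambda>_. 0", OF assms(1)]) (use assms(2) in auto)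
  have "- f a \<le> - f r"
    by (rule nondecreasing_if_deriv_nonneg[of a "\<lambda>r. - f r" "\<lambda>_. - 0", OF DERIV_minus[OF assms(1)]])
      (use assms(2) in auto)
  then show "f r \<le> f a" by simp
qed

lemma DERIV_inverse_ident: "0 < r \<Longrightarrow> ((\<lambda>r::real. 1 / r) has_real_derivative - (1 / r)\<^sup>2) (at r within S)"
  using DERIV_inverse_power[of r 1 S] by (simp add: power2_eq_square)

text \<open>The second derivatives in the stationary equations come from differentiating the two
  first-order identities, and smoothness comes from the same identities by bootstrap.\<close>

lemma stationary_if_first_order:
  fixes k :: nat and v v1 th t1 J :: "real \<Rightarrow> real"
  defines "W \<equiv> \<lambda>r. 1 / r ^ Suc k" and "Y \<equiv> \<lambda>r::real. 1 / r" and "K \<equiv> real k + 1"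
  assumes r0: "0 < r0" and mu: "mu = 2 * nu + lam" "0 < mu" and kappa: "0 < kappa" and M: "M \<noteq> 0" and vp: "0 < vp"
    and v: "\<And>r. r0 \<le> r \<Longrightarrow> (v has_real_derivative v1 r) (at r within {r0..})" "\<And>r. r0 \<le> r \<Longrightarrow> 0 < v r"
    and th: "\<And>r. r0 \<le> r \<Longrightarrow> (th has_real_derivative t1 r) (at r within {r0..})" "\<And>r. r0 \<le> r \<Longrightarrow> 0 < th r"
    and J: "\<And>r. r0 \<le> r \<Longrightarrow> (J has_real_derivative - (v r * (W r)\<^sup>2 * Y r)) (at r within {r0..})"
    and mom: "\<And>r. r0 \<le> r \<Longrightarrow> mu * (M * v1 r * W r) = R * th r * (1 / v r) - P + M\<^sup>2 * (v r * (W r)\<^sup>2 - K * J r)"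
    and en: "\<And>r. r0 \<le> r \<Longrightarrow> kappa * (r ^ Suc k * t1 r) = (M * cV * th r + M * P * v r
        + M ^ 3 * (K * v r * J r - (v r)\<^sup>2 / 2 * (W r)\<^sup>2) + 2 * nu * K * M\<^sup>2 * (v r)\<^sup>2 * W r * Y r) - E"
    and lim: "(v \<longlongrightarrow> vp) at_top" "(th \<longlongrightarrow> tp) at_top"
  shows "stationary_sol (k + 2) r0 cV R nu lam kappa (1 / vp) 0 tp (\<lambda>r. 1 / v r) (\<lambda>r. M * v r * W r) th"
proof -
  let ?G = "\<lambda>r. R * th r * (1 / v r) - P + M\<^sup>2 * (v r * (W r)\<^sup>2 - K * J r)"
  let ?H = "\<lambda>r. M * cV * th r + M * P * v r
        + M ^ 3 * (K * v r * J r - (v r)\<^sup>2 * (1 / 2) * (W r)\<^sup>2) + 2 * nu * K * M\<^sup>2 * (v r)\<^sup>2 * W r * Y r"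
  have W': "(W has_real_derivative - K * W r * Y r) (at r within {r0..})"
    and Y': "(Y has_real_derivative - (Y r)\<^sup>2) (at r within {r0..})" if "r0 \<le> r" for r
    unfolding W_def Y_def K_def using DERIV_inverse_power_Suc[of r k "{r0..}"] DERIV_inverse_ident[of r "{r0..}"] r0 that by simp_all
  have v0: "v r \<noteq> 0" if "r0 \<le> r" for r using v(2)[OF that] by simp
  have CW: "Ck r0 j W" and CY: "Ck r0 j Y" for j
    unfolding W_def Y_def using r0 by (intro Ck_inverse Ck_power Ck_ident; simp)+
  \<comment> \<open>\<open>mom\<close> and \<open>en\<close> express \<open>v1\<close> and
    \<open>t1\<close> polynomially in \<open>v\<close>, \<open>1 / v\<close>, \<open>th\<close>,
    \<open>J\<close> and powers of \<open>r\<close> and \<open>1 / r\<close>, so order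
    \<open>j\<close> for the solution gives order \<open>j + 1\<close>. \<open>J\<close> is carried
    along because it is nonlocal in \<open>v\<close>.\<close>
  have C: "Ck r0 j v \<and> Ck r0 j th \<and> Ck r0 j J" for j
  proof (induction j)
    case 0
    show ?case using v(1) th(1) J by (auto intro!: DERIV_continuous_on)
  next
    case (Suc j)
    then have c: "Ck r0 j v" "Ck r0 j th" "Ck r0 j J" "Ck r0 j (\<lambda>r. 1 / v r)" using v0 Ck_inverse by auto
    have G: "Ck r0 j (\<lambda>r. (1 / (mu * M)) * r ^ Suc k * ?G r)"
      by (intro Ck_mult Ck_add Ck_diff Ck_power Ck_const Ck_ident CW c)
    have C1: "Ck r0 j v1"
    proof (rule Ck_cong[OF G])
      show "(1 / (mu * M)) * r ^ Suc k * ?G r = v1 r" if "r0 \<le> r" for r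
        using mom[OF that, symmetric] mu M r0 that by (simp add: W_def)
    qed
    have H: "Ck r0 j (\<lambda>r. (1 / kappa) * W r * (?H r - E))"
      by (intro Ck_mult Ck_add Ck_diff Ck_power Ck_const Ck_ident CW CY c)
    have C2: "Ck r0 j t1"
    proof (rule Ck_cong[OF H])
      show "(1 / kappa) * W r * (?H r - E) = t1 r" if "r0 \<le> r" for r
      proof -
        have "?H r - E = kappa * (r ^ Suc k * t1 r)" using en[OF that] by simp
        then show ?thesis using kappa r0 that by (simp only:) (simp add: W_def)
      qed
    qed
    have "Ck r0 j (\<lambda>r. (-1) * (v r * (W r)\<^sup>2 * Y r))"
      by (intro Ck_mult Ck_power Ck_const CW CY c)
    then have C3: "Ck r0 j (\<lambda>r. - (v r * (W r)\<^sup>2 * Y r))" by simp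
    have "Ck r0 (Suc j) v" unfolding Ck.simps by (rule exI[of _ v1]) (use v(1) C1 in simp)
    moreover have "Ck r0 (Suc j) th" unfolding Ck.simps by (rule exI[of _ t1]) (use th(1) C2 in simp)
    moreover have "Ck r0 (Suc j) J" unfolding Ck.simps
      by (rule exI[of _ "\<lambda>r. - (v r * (W r)\<^sup>2 * Y r)"]) (use J C3 in simp)
    ultimately show ?case by blast
  qed
  have smooth: "C_infty_on {r0..} (\<lambda>r. 1 / v r)" "C_infty_on {r0..} (\<lambda>r. M * v r * W r)" "C_infty_on {r0..} th"
    using C v0 by (intro C_infty_on_if_Ck Ck_inverse Ck_mult Ck_const CW; simp)+
  have eqs: "dr r0 (\<lambda>s. s^(k + 2 - 1) * (1 / v s) * (M * v s * W s)) r / r^(k + 2 - 1) = 0 \<and>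
            dr r0 (\<lambda>s. s^(k + 2 - 1) * (1 / v s) * (M * v s * W s)^2) r / r^(k + 2 - 1) + dr r0 (\<lambda>s. R * (1 / v s) * th s) r
              = mu * dr r0 (\<lambda>s. dr r0 (\<lambda>t. t^(k + 2 - 1) * (M * v t * W t)) s / s^(k + 2 - 1)) r \<and>
            dr r0 (\<lambda>s. s^(k + 2 - 1) * (1 / v s) * (M * v s * W s) * (cV * th s + (M * v s * W s)^2 / 2)) r / r^(k + 2 - 1)
              + dr r0 (\<lambda>s. s^(k + 2 - 1) * (R * (1 / v s) * th s) * (M * v s * W s)) r / r^(k + 2 - 1)
              = kappa * dr r0 (\<lambda>s. s^(k + 2 - 1) * dr r0 th s) r / r^(k + 2 - 1)
                + mu * dr r0 (\<lambda>s. dr r0 (\<lambda>t. t^(k + 2 - 1) * (M * v t * W t)) s / s^(k + 2 - 1)) r * (M * v r * W r)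
                + (2 * nu * (dr r0 (\<lambda>r. M * v r * W r) r)^2 + 2 * nu * (real (k + 2) - 1) * (M * v r * W r / r)^2
                      + lam * (dr r0 (\<lambda>r. M * v r * W r) r + (real (k + 2) - 1) / r * (M * v r * W r))^2)"
    if r: "r0 \<le> r" for r
  proof -
    define X where "X = (R * (t1 r * (1 / v r) - th r * v1 r * (1 / v r)\<^sup>2) + M\<^sup>2 * (v1 r * (W r)\<^sup>2 - K * v r * (W r)\<^sup>2 * Y r)) / mu"
    define Z where "Z = (M * cV * t1 r + M * P * v1 r + M ^ 3 * (K * v1 r * J r - v r * v1 r * (W r)\<^sup>2)
        + 2 * nu * K * M\<^sup>2 * (2 * v r * v1 r * W r * Y r - (K + 1) * (v r)\<^sup>2 * W r * (Y r)\<^sup>2)) / kappa"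
    have X: "((\<lambda>s. M * v1 s * W s) has_real_derivative X) (at r within {r0..})"
      unfolding X_def
    proof (rule DERIV_transform_atLeast[OF DERIV_cdivide[OF momentum_flux_deriv[where v = v and th = th and J = J and W = W]] _ r])
      show "?G s / mu = M * v1 s * W s" if "r0 \<le> s" for s
        using mom[OF that, symmetric] mu by simp
    qed (use v(1) th(1) J W' v0 r in auto)
    have Z: "((\<lambda>s. s ^ Suc k * t1 s) has_real_derivative Z) (at r within {r0..})"
      unfolding Z_def
    proof (rule DERIV_transform_atLeast[OF DERIV_cdivide[OF DERIV_diff[OF energy_flux_deriv[where v = v and th = th and J = J and W = W and Y = Y]
         DERIV_const[of E], unfolded diff_0_right]] _ r])
      show "((M * cV * th s + M * P * v s
        + M ^ 3 * (K * v s * J s - (v s)\<^sup>2 / 2 * (W s)\<^sup>2) + 2 * nu * K * M\<^sup>2 * (v s)\<^sup>2 * W s * Y s) - E) / kappa = s ^ Suc k * t1 s"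
        if "r0 \<le> s" for s
        using en[OF that, symmetric] kappa by simp
    qed (use v(1) th(1) J W' Y' r in auto)
    define u1 where "u1 = (\<lambda>r. M * (v1 r * W r - (real k + 1) * v r * W r * Y r))"
    note iff = stationary_equations_iff[where v = v and theta = th and M = M and k = k and n = "k + 2"
          and rho = "\<lambda>r. 1 / v r" and u = "\<lambda>r. M * v r * W r",
        OF meta_eq_to_obj_eq[OF W_def] meta_eq_to_obj_eq[OF Y_def] u1_def refl r0 r v th(1) refl refl X Z]
    have muX: "mu * X = R * (t1 r * (1 / v r) - th r * v1 r * (1 / v r)\<^sup>2) + M\<^sup>2 * (v1 r * (W r)\<^sup>2 - K * v r * (W r)\<^sup>2 * Y r)"
      using mu by (simp add: X_def)
    have kZ: "kappa * Z = M * cV * t1 r + M * P * v1 r + M ^ 3 * (K * v1 r * J r - v r * v1 r * (W r)\<^sup>2)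
        + 2 * nu * K * M\<^sup>2 * (2 * v r * v1 r * W r * Y r - (K + 1) * (v r)\<^sup>2 * W r * (Y r)\<^sup>2)"
      using kappa by (simp add: Z_def)
    have vs: "v r * (1 / v r) = 1" using v0[OF r] by simp
    show ?thesis
    proof (intro conjI)
      show "dr r0 (\<lambda>s. s^(k + 2 - 1) * (1 / v s) * (M * v s * W s)) r / r^(k + 2 - 1) = 0" by (rule iff(1))
      show "dr r0 (\<lambda>s. s^(k + 2 - 1) * (1 / v s) * (M * v s * W s)^2) r / r^(k + 2 - 1) + dr r0 (\<lambda>s. R * (1 / v s) * th s) r
              = mu * dr r0 (\<lambda>s. dr r0 (\<lambda>t. t^(k + 2 - 1) * (M * v t * W t)) s / s^(k + 2 - 1)) r"
      proof (rule iff(2)[THEN iffD2])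
        show "M * u1 r * W r + R * (t1 r / v r - th r * v1 r / (v r)\<^sup>2) = mu * X"
          unfolding muX K_def u1_def by (simp add: algebra_simps power2_eq_square)
      qed
      show "dr r0 (\<lambda>s. s^(k + 2 - 1) * (1 / v s) * (M * v s * W s) * (cV * th s + (M * v s * W s)^2 / 2)) r / r^(k + 2 - 1)
              + dr r0 (\<lambda>s. s^(k + 2 - 1) * (R * (1 / v s) * th s) * (M * v s * W s)) r / r^(k + 2 - 1)
              = kappa * dr r0 (\<lambda>s. s^(k + 2 - 1) * dr r0 th s) r / r^(k + 2 - 1)
                + mu * dr r0 (\<lambda>s. dr r0 (\<lambda>t. t^(k + 2 - 1) * (M * v t * W t)) s / s^(k + 2 - 1)) r * (M * v r * W r)
                + (2 * nu * (dr r0 (\<lambda>r. M * v r * W r) r)^2 + 2 * nu * (real (k + 2) - 1) * (M * v r * W r / r)^2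
                      + lam * (dr r0 (\<lambda>r. M * v r * W r) r + (real (k + 2) - 1) / r * (M * v r * W r))^2)"
      proof (rule iff(3)[THEN iffD2])
        show "M * (cV * t1 r + (M * v r * W r) * u1 r) * W r + M * R * t1 r * W r
            = kappa * Z * W r + mu * X * (M * v r * W r)
              + (2 * nu * (u1 r)\<^sup>2 + 2 * nu * (real k + 1) * (M * v r * W r * Y r)\<^sup>2 + lam * (M * v1 r * W r)\<^sup>2)"
          using energy_identity[OF vs mu(1) mom[OF r] muX, of cV]
          unfolding kZ u1_def K_def .
      qed
    qed
  qed
  have W0: "(W \<longlongrightarrow> 0) at_top" unfolding W_def by (rule tendsto_inverse_power_at_top) simp
  have lims: "((\<lambda>r. 1 / v r) \<longlongrightarrow> 1 / vp) at_top" "((\<lambda>r. M * v r * W r) \<longlongrightarrow> 0) at_top"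
    using tendsto_divide[OF tendsto_const lim(1)] vp tendsto_mult[OF tendsto_mult[OF tendsto_const lim(1)] W0] by auto
  show ?thesis
    unfolding stationary_sol_def Let_def using smooth v(2) th(2) eqs lims lim(2) by (simp add: mu(1))
qed

lemma first_order_if_stationary:
  fixes k :: nat and rho u th J v W Y :: "real \<Rightarrow> real"
  assumes W_def: "W = (\<lambda>r. 1 / r ^ Suc k)" and Y_def: "Y = (\<lambda>r. 1 / r)" and v_def: "v = (\<lambda>r. 1 / rho r)"
    and K_def: "K = real k + 1" and M_def: "M = r0 ^ Suc k * rho r0 * u r0" and P_def: "P = R * tp / vp"
    and r0: "0 < r0" and mu: "mu = 2 * nu + lam" "0 < mu" and vp: "0 < vp" and u0: "u r0 \<noteq> 0"
    and sol: "stationary_sol (k + 2) r0 cV R nu lam kappa (1 / vp) 0 tp rho u th"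
    and J: "\<And>r. r0 \<le> r \<Longrightarrow> (J has_real_derivative - (v r * (W r)\<^sup>2 * Y r)) (at r within {r0..})" "(J \<longlongrightarrow> 0) at_top"
  obtains v1 t1 E where
    "\<And>r. r0 \<le> r \<Longrightarrow> (v has_real_derivative v1 r) (at r within {r0..})"
    "\<And>r. r0 \<le> r \<Longrightarrow> (th has_real_derivative t1 r) (at r within {r0..})"
    "\<And>r. r0 \<le> r \<Longrightarrow> u r = M * v r * W r"
    "\<And>r. r0 \<le> r \<Longrightarrow> mu * (M * v1 r * W r) = R * th r * (1 / v r) - P + M\<^sup>2 * (v r * (W r)\<^sup>2 - K * J r)"
    "\<And>r. r0 \<le> r \<Longrightarrow> kappa * (r ^ Suc k * t1 r) = (M * cV * th r + M * P * v r
        + M ^ 3 * (K * v r * J r - (v r)\<^sup>2 / 2 * (W r)\<^sup>2) + 2 * nu * K * M\<^sup>2 * (v r)\<^sup>2 * W r * Y r) - E"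
proof -
  note S = sol[unfolded stationary_sol_def Let_def]
  have smooth: "C_infty_on {r0..} rho" "C_infty_on {r0..} u" "C_infty_on {r0..} th" using S by blast+
  have pos: "0 < rho r" "0 < th r" if "r0 \<le> r" for r using S that by blast+
  have eqs: "dr r0 (\<lambda>s. s^(k + 2 - 1) * rho s * u s) r / r^(k + 2 - 1) = 0"
    "dr r0 (\<lambda>s. s^(k + 2 - 1) * rho s * (u s)^2) r / r^(k + 2 - 1) + dr r0 (\<lambda>s. R * rho s * th s) r
              = mu * dr r0 (\<lambda>s. dr r0 (\<lambda>t. t^(k + 2 - 1) * u t) s / s^(k + 2 - 1)) r"
    "dr r0 (\<lambda>s. s^(k + 2 - 1) * rho s * u s * (cV * th s + (u s)^2 / 2)) r / r^(k + 2 - 1)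
              + dr r0 (\<lambda>s. s^(k + 2 - 1) * (R * rho s * th s) * u s) r / r^(k + 2 - 1)
              = kappa * dr r0 (\<lambda>s. s^(k + 2 - 1) * dr r0 th s) r / r^(k + 2 - 1)
                + mu * dr r0 (\<lambda>s. dr r0 (\<lambda>t. t^(k + 2 - 1) * u t) s / s^(k + 2 - 1)) r * u r
                + (2 * nu * (dr r0 u r)^2 + 2 * nu * (real (k + 2) - 1) * (u r / r)^2
                      + lam * (dr r0 u r + (real (k + 2) - 1) / r * u r)^2)"
    if "r0 \<le> r" for r
    using S that unfolding mu(1) by blast+
  have lims: "(rho \<longlongrightarrow> 1 / vp) at_top" "(th \<longlongrightarrow> tp) at_top" using S by blast+
  obtain rho1 rho2 where rho: "\<And>r. r0 \<le> r \<Longrightarrow> (rho has_real_derivative rho1 r) (at r within {r0..})"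
      "\<And>r. r0 \<le> r \<Longrightarrow> (rho1 has_real_derivative rho2 r) (at r within {r0..})"
    using C_infty_on_derivs[OF smooth(1)] by blast
  obtain u' u'' where u': "\<And>r. r0 \<le> r \<Longrightarrow> (u has_real_derivative u' r) (at r within {r0..})"
      "\<And>r. r0 \<le> r \<Longrightarrow> (u' has_real_derivative u'' r) (at r within {r0..})"
    using C_infty_on_derivs[OF smooth(2)] by blast
  obtain t1 t2 where t: "\<And>r. r0 \<le> r \<Longrightarrow> (th has_real_derivative t1 r) (at r within {r0..})"
      "\<And>r. r0 \<le> r \<Longrightarrow> (t1 has_real_derivative t2 r) (at r within {r0..})"
    using C_infty_on_derivs[OF smooth(3)] by blast
  have W': "(W has_real_derivative - K * W r * Y r) (at r within {r0..})"
    and Y': "(Y has_real_derivative - (Y r)\<^sup>2) (at r within {r0..})" if "r0 \<le> r" for r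
    unfolding W_def Y_def K_def using DERIV_inverse_power_Suc[of r k "{r0..}"] DERIV_inverse_ident[of r "{r0..}"] r0 that by simp_all
  define v1 where "v1 = (\<lambda>r. - rho1 r / (rho r)\<^sup>2)"
  have v: "(v has_real_derivative v1 r) (at r within {r0..})" "0 < v r" if "r0 \<le> r" for r
    unfolding v_def v1_def using rho(1)[OF that] pos[OF that]
    by (auto intro!: derivative_eq_intros simp: power2_eq_square)
  define v2 where "v2 = (\<lambda>r. (- rho2 r * (rho r)\<^sup>2 - - rho1 r * (real 2 * (rho1 r * rho r ^ (2 - Suc 0)))) / ((rho r)\<^sup>2 * (rho r)\<^sup>2))"
  have v2: "(v1 has_real_derivative v2 r) (at r within {r0..})" if "r0 \<le> r" for r
    unfolding v1_def v2_def using pos(1)[OF that]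
    by (intro DERIV_divide[OF DERIV_minus[OF rho(2)[OF that]] DERIV_power[OF rho(1)[OF that]]]) simp
  have mass: "s ^ Suc k * rho s * u s = M" if "r0 \<le> s" for s
  proof -
    have "s ^ Suc k * rho s * u s = r0 ^ Suc k * rho r0 * u r0"
    proof (rule constant_if_deriv_0[where f = "\<lambda>s. s ^ Suc k * rho s * u s", OF _ that])
      fix r assume r: "r0 \<le> r"
      note D = DERIV_mult[OF DERIV_mult[OF DERIV_pow[of "Suc k" r "{r0..}"] rho(1)[OF r]] u'(1)[OF r]]
      show "((\<lambda>s. s ^ Suc k * rho s * u s) has_real_derivative 0) (at r within {r0..})"
        using eqs(1)[OF r] D dr_eq[OF D r] r r0 by (simp del: power_Suc)
    qed
    then show ?thesis by (simp add: M_def)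
  qed
  have M0: "M \<noteq> 0" using r0 pos[of r0] u0 by (simp add: M_def)
  have u_eq: "u s = M * v s * W s" if "r0 \<le> s" for s
    using pos[OF that] r0 that by (simp add: v_def W_def flip: mass[OF that])
  have rho_eq: "rho s = 1 / v s" for s by (simp add: v_def)
  define u1 where "u1 = (\<lambda>r. M * (v1 r * W r - (real k + 1) * v r * W r * Y r))"
  define X where "X = (\<lambda>r. M * (v2 r * W r + v1 r * (- K * W r * Y r)))"
  define Z where "Z = (\<lambda>r. (real k + 1) * r ^ k * t1 r + r ^ Suc k * t2 r)"
  have X: "((\<lambda>s. M * v1 s * W s) has_real_derivative X r) (at r within {r0..})" if "r0 \<le> r" for r
    unfolding X_def by (rule derivative_eq_intros v2[OF that] W'[OF that] refl)+ (simp add: algebra_simps)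
  have Z: "((\<lambda>s. s ^ Suc k * t1 s) has_real_derivative Z r) (at r within {r0..})" if "r0 \<le> r" for r
    unfolding Z_def by (rule derivative_eq_intros t(2)[OF that] refl)+ (simp add: algebra_simps)
  have iff: "M * u1 r * W r + R * (t1 r / v r - th r * v1 r / (v r)\<^sup>2) = mu * X r"
    "M * (cV * t1 r + (M * v r * W r) * u1 r) * W r + M * R * t1 r * W r
            = kappa * Z r * W r + mu * X r * (M * v r * W r)
              + (2 * nu * (u1 r)\<^sup>2 + 2 * nu * (real k + 1) * (M * v r * W r * Y r)\<^sup>2 + lam * (M * v1 r * W r)\<^sup>2)"
    if r: "r0 \<le> r" for r
  proof -
    note iff = stationary_equations_iff[where v = v and theta = th and M = M and k = k and n = "k + 2",
        OF W_def Y_def u1_def refl r0 r v t(1) rho_eq u_eq X[OF r] Z[OF r]]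
    show "M * u1 r * W r + R * (t1 r / v r - th r * v1 r / (v r)\<^sup>2) = mu * X r"
      by (rule iff(2)[THEN iffD1, OF _ _ _ _ eqs(2)[OF r]])
    show "M * (cV * t1 r + (M * v r * W r) * u1 r) * W r + M * R * t1 r * W r
            = kappa * Z r * W r + mu * X r * (M * v r * W r)
              + (2 * nu * (u1 r)\<^sup>2 + 2 * nu * (real k + 1) * (M * v r * W r * Y r)\<^sup>2 + lam * (M * v1 r * W r)\<^sup>2)"
      by (rule iff(3)[THEN iffD1, OF _ _ _ _ eqs(3)[OF r]])
  qed
  have mX: "mu * X r = R * (t1 r * (1 / v r) - th r * v1 r * (1 / v r)\<^sup>2) + M\<^sup>2 * (v1 r * (W r)\<^sup>2 - K * v r * (W r)\<^sup>2 * Y r)"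
    if r: "r0 \<le> r" for r
    using iff(1)[OF r, symmetric] unfolding u1_def K_def by (simp add: algebra_simps power2_eq_square)
  define G where "G = (\<lambda>r. R * th r * (1 / v r) - P + M\<^sup>2 * (v r * (W r)\<^sup>2 - K * J r))"
  \<comment> \<open>\<open>F\<close> is the integration constant of the momentum equation. As
    \<open>P\<close> is the far pressure, \<open>G\<close> tends to 0, so \<open>v1 * W\<close>
    converges to a multiple of this constant.\<close>
  define F where "F = (\<lambda>r. mu * (M * v1 r * W r) - G r)"
  have F: "F r = F r0" if "r0 \<le> r" for r
  proof (rule constant_if_deriv_0[OF _ that])
    fix r assume r: "r0 \<le> r"
    have "v r \<noteq> 0" using v(2)[OF r] by simp
    from DERIV_diff[OF DERIV_cmult[OF X[OF r], of mu] momentum_flux_deriv[where R = R and P = P and M = M, OF v(1)[OF r] this t(1)[OF r] J(1)[OF r] W'[OF r]]]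
    show "(F has_real_derivative 0) (at r within {r0..})"
      unfolding F_def G_def mX[OF r] by (rule DERIV_cong) simp
  qed
  have W0: "(W \<longlongrightarrow> 0) at_top" unfolding W_def by (rule tendsto_inverse_power_at_top) simp
  have v_lim: "(v \<longlongrightarrow> vp) at_top"
    unfolding v_def using tendsto_divide[OF tendsto_const lims(1), of 1] vp by simp
  have "(G \<longlongrightarrow> R * tp * (1 / vp) - P + M\<^sup>2 * (vp * 0\<^sup>2 - K * 0)) at_top"
    unfolding G_def using vp by (intro tendsto_intros lims v_lim W0 J) auto
  then have G_lim: "(G \<longlongrightarrow> 0) at_top" by (simp add: P_def)
  define l where "l = F r0 / (mu * M)"
  have "((\<lambda>r. (F r0 + G r) / (mu * M)) \<longlongrightarrow> (F r0 + 0) / (mu * M)) at_top"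
    using mu M0 by (intro tendsto_intros G_lim) auto
  moreover have "\<forall>\<^sub>F r in at_top. (F r0 + G r) / (mu * M) = v1 r * (1 / r ^ Suc k)"
  proof (rule eventually_mono[OF eventually_ge_at_top[of r0]])
    fix r assume "r0 \<le> r"
    then have "F r0 + G r = mu * (M * v1 r * W r)" using F[of r] by (simp add: F_def)
    then show "(F r0 + G r) / (mu * M) = v1 r * (1 / r ^ Suc k)"
      using mu M0 by (simp add: W_def)
  qed
  ultimately have v1_lim: "((\<lambda>r. v1 r * (1 / r ^ Suc k)) \<longlongrightarrow> l) at_top"
    by (simp add: tendsto_cong l_def)
  have "l \<le> 0" by (rule limit_0_if_convergent[OF v(1) v_lim v1_lim])
  moreover have "- l \<le> 0"
  proof (rule limit_0_if_convergent)
    show "((\<lambda>r. - v r) has_real_derivative - v1 r) (at r within {r0..})" if "r0 \<le> r" for r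
      by (rule DERIV_minus[OF v(1)[OF that]])
    show "((\<lambda>r. - v r) \<longlongrightarrow> - vp) at_top" by (intro tendsto_intros v_lim)
    show "((\<lambda>r. - v1 r * (1 / r ^ Suc k)) \<longlongrightarrow> - l) at_top" using tendsto_minus[OF v1_lim] by simp
  qed
  ultimately have "l = 0" by simp
  then have "F r0 = 0" using mu M0 by (simp add: l_def)
  then have mom: "mu * (M * v1 r * W r) = R * th r * (1 / v r) - P + M\<^sup>2 * (v r * (W r)\<^sup>2 - K * J r)" if "r0 \<le> r" for r
    using F[OF that] by (simp add: F_def G_def)
  \<comment> \<open>\<open>N\<close> is the first integral of the energy equation; its constant
    value survives as the free \<open>E\<close>.\<close>
  define N where "N = (\<lambda>r. (M * cV * th r + M * P * v r
        + M ^ 3 * (K * v r * J r - (v r)\<^sup>2 / 2 * (W r)\<^sup>2) + 2 * nu * K * M\<^sup>2 * (v r)\<^sup>2 * W r * Y r) - kappa * (r ^ Suc k * t1 r))"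
  have N: "N r = N r0" if "r0 \<le> r" for r
  proof (rule constant_if_deriv_0[OF _ that])
    fix r assume r: "r0 \<le> r"
    have vs: "v r * (1 / v r) = 1" using v(2)[OF r] by simp
    have W0: "W r \<noteq> 0" using r r0 by (simp add: W_def)
    have "(M * cV * t1 r + M * P * v1 r + M ^ 3 * (K * v1 r * J r - v r * v1 r * (W r)\<^sup>2)
        + 2 * nu * K * M\<^sup>2 * (2 * v r * v1 r * W r * Y r - (K + 1) * (v r)\<^sup>2 * W r * (Y r)\<^sup>2)) * W r = kappa * Z r * W r"
      using trans[OF energy_identity[OF vs mu(1) mom[OF r] mX[OF r], of cV, symmetric] iff(2)[OF r, unfolded u1_def, folded K_def]]
      unfolding add_right_cancel .
    then have kZ: "kappa * Z r = M * cV * t1 r + M * P * v1 r + M ^ 3 * (K * v1 r * J r - v r * v1 r * (W r)\<^sup>2)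
        + 2 * nu * K * M\<^sup>2 * (2 * v r * v1 r * W r * Y r - (K + 1) * (v r)\<^sup>2 * W r * (Y r)\<^sup>2)"
      using W0 by (metis mult_right_cancel)
    from DERIV_diff[OF energy_flux_deriv[where M = M and cV = cV and P = P and nu = nu, OF v(1)[OF r] t(1)[OF r] J(1)[OF r] W'[OF r] Y'[OF r]] DERIV_cmult[OF Z[OF r], of kappa]]
    show "(N has_real_derivative 0) (at r within {r0..})"
      unfolding N_def kZ by (rule DERIV_cong) simp
  qed
  show ?thesis
  proof (rule that[of v1 t1 "N r0", OF v(1) t(1) u_eq mom])
    show "kappa * (r ^ Suc k * t1 r) = (M * cV * th r + M * P * v r
        + M ^ 3 * (K * v r * J r - (v r)\<^sup>2 / 2 * (W r)\<^sup>2) + 2 * nu * K * M\<^sup>2 * (v r)\<^sup>2 * W r * Y r) - N r0"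
      if "r0 \<le> r" for r
      unfolding N[OF that, symmetric] by (simp add: N_def)
  qed
qed

section \<open>Stationary solutions as fixed points\<close>

context gas_parameters
begin

lemma powers_W:
  fixes r :: real
  shows "1 / r ^ (k + 2) = (1 / r ^ Suc k) * (1 / r)" "1 / r ^ (2 * k + 2) = (1 / r ^ Suc k)\<^sup>2"
    "1 / r ^ (2 * k + 3) = (1 / r ^ Suc k)\<^sup>2 * (1 / r)"
  by (simp_all add: power2_eq_square power_add mult_2 mult_2_right numeral_3_eq_3 mult_ac)

text \<open>The splitting into linear relaxation and forcing is exact: with
  \<open>s = 1 / (vp + p r)\<close> one has
  \<open>(p r)\<^sup>2 * s - p r = vp * (vp * s - 1)\<close>, so
  \<open>mu * beta * (g u p q r - p r)\<close> restores the full pressure difference together with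
  the momentum flux.\<close>

lemma momentum_rhs:
  assumes adm: "adm p q" and r: "r0 \<le> r" and u: "u \<noteq> 0" and M: "M = u * mt p"
  shows "mu * (M * (- (beta * r ^ Suc k / (u * mt p)) * (p r - g u p q r)) * (1 / r ^ Suc k))
    = R * (tp + q r) * (1 / (vp + p r)) - R * tp / vp
      + M\<^sup>2 * ((vp + p r) * (1 / r ^ Suc k)\<^sup>2 - (real k + 1) * I p r)"
proof -
  define s where "s = 1 / (vp + p r)"
  have rpos: "0 < r" using r r0_pos by simp
  have s: "(vp + p r) * s = 1" using adm_v(3)[OF adm r] by (simp add: s_def)
  have M0: "u * mt p \<noteq> 0" using u mt_pos[OF adm] by simp
  have lhs: "mu * (M * (- (beta * r ^ Suc k / (u * mt p)) * (p r - g u p q r)) * (1 / r ^ Suc k)) = mu * beta * (g u p q r - p r)"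
    using M0 rpos by (simp add: M field_simps)
  have mb: "mu * beta = R * tp / vp\<^sup>2" using mu_pos by (simp add: beta_def)
  have g: "g u p q r = (p r)\<^sup>2 * s + vp\<^sup>2 / tp * (q r * s)
      + vp\<^sup>2 / (R * tp) * (M\<^sup>2 * ((vp + p r) * (1 / r ^ Suc k)\<^sup>2 - (real k + 1) * I p r))"
  proof -
    have "1 / r ^ (k + 2) * (1 / r ^ k) = (1 / r ^ Suc k)\<^sup>2"
      using rpos by (simp add: field_simps power2_eq_square)
    moreover have "u\<^sup>2 * (Qt p r * (1 / r ^ k)) =
        M\<^sup>2 * ((vp + p r) * (1 / r ^ (k + 2) * (1 / r ^ k)) - real (k + 1) * (J p r * (1 / r ^ k)))"
      unfolding Qt_def M power_mult_distrib by (simp only: left_diff_distrib right_diff_distrib mult.assoc)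
    moreover have "J p r * (1 / r ^ k) = I p r" using rpos by (simp add: J_def)
    ultimately show ?thesis unfolding g_def s_def by (simp only: of_nat_add of_nat_1)
  qed
  have "R * tp / vp\<^sup>2 * ((p r)\<^sup>2 * s + vp\<^sup>2 / tp * (q r * s) + vp\<^sup>2 / (R * tp) * Q - p r)
      = R * (tp + q r) * s - R * tp / vp + Q" for Q
  proof -
    have "R * tp / vp\<^sup>2 * ((p r)\<^sup>2 * s + vp\<^sup>2 / tp * (q r * s) + vp\<^sup>2 / (R * tp) * Q - p r)
      = R * tp / vp\<^sup>2 * ((p r)\<^sup>2 * s - p r) + R * q r * s + Q"
      using R_pos tp_pos vp_pos by (simp add: field_simps)
    also have "(p r)\<^sup>2 * s - p r = vp * (vp * s - 1)"
    proof -
      have "(p r)\<^sup>2 * s - p r - vp * (vp * s - 1) = (p r - vp) * ((vp + p r) * s - 1)"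
        by (simp add: algebra_simps power2_eq_square)
      then show ?thesis unfolding s by simp
    qed
    also have "R * tp / vp\<^sup>2 * (vp * (vp * s - 1)) + R * q r * s + Q = R * (tp + q r) * s - R * tp / vp + Q"
      using vp_pos by (simp add: field_simps power2_eq_square)
    finally show ?thesis .
  qed
  then show ?thesis unfolding lhs unfolding mb g unfolding s_def by blast
qed

text \<open>The far-state parts of the terms linear in temperature and volume are constants and
  merely shift the free constant; this is why \<open>h\<close> can be written with the deviations
  \<open>p\<close> and \<open>q\<close>.\<close>

lemma energy_rhs:
  assumes r: "r0 \<le> r" and M: "M = u * mt p"
  shows "u * h u p q r - E = (M * cV * (tp + q r) + M * (R * tp / vp) * (vp + p r)
        + M ^ 3 * ((real k + 1) * (vp + p r) * I p r - (vp + p r)\<^sup>2 / 2 * (1 / r ^ Suc k)\<^sup>2)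
        + 2 * nu * (real k + 1) * M\<^sup>2 * (vp + p r)\<^sup>2 * (1 / r ^ Suc k) * (1 / r))
        - (E + M * cV * tp + M * (R * tp / vp) * vp)"
proof -
  have rpos: "0 < r" using r r0_pos by simp
  have J: "real (k + 1) * (vp + p r) * J p r * (1 / r ^ k) = (real k + 1) * (vp + p r) * I p r" using rpos by (simp add: J_def)
  have e: "u * (mt p * (a + M\<^sup>2 * b + d * M * e)) = M * a + M ^ 3 * b + d * M\<^sup>2 * e" for a b d e
    unfolding M by (simp add: algebra_simps power2_eq_square power3_eq_cube)
  have "u * h u p q r = M * (cV * q r + (R * tp / vp) * p r)
     + M ^ 3 * ((real k + 1) * (vp + p r) * I p r - (vp + p r)\<^sup>2 / 2 * (1 / r ^ Suc k)\<^sup>2)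
     + (2 * nu * (real k + 1)) * M\<^sup>2 * ((vp + p r)\<^sup>2 * ((1 / r ^ Suc k) * (1 / r)))"
    unfolding h_def J powers_W M[symmetric]
    by (rule trans[OF _ e]) (simp only: of_nat_add of_nat_1 mult.assoc)
  moreover have "M * (cV * q r + a * p r) + x + y - E = (M * cV * (tp + q r) + M * a * (vp + p r) + x + y)
      - (E + M * cV * tp + M * a * vp)" for a x y
    by (simp add: algebra_simps)
  ultimately show ?thesis by (simp only: mult.assoc)
qed

end

context gas_small
begin

text \<open>Admissibility bounds \<open>q\<close> only by 1; \<open>K * d * c < tp\<close> is what
  keeps the temperature positive.\<close>

lemma solution_of_fixed_point:
  assumes mu: "mu = 2 * nu + lam" and tp: "K * d * c < tp"
    and b: "in_ball (K * d) p q" and s: "step u p0 q0 p q p q"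
  shows "stationary_sol (k + 2) r0 cV R nu lam kappa (1 / vp) 0 tp
    (\<lambda>r. 1 / (vp + p r)) (\<lambda>r. (u * mt p) * (vp + p r) * (1 / r ^ Suc k)) (\<lambda>r. tp + q r)"
proof -
  note adm = adm_ball[OF b]
  let ?p1 = "\<lambda>r. - (beta * r ^ Suc k / (u * mt p)) * (p r - g u p q r)"
  obtain E where q': "\<And>r. r0 \<le> r \<Longrightarrow> (q has_real_derivative (u * h u p q r - E) / (kappa * r ^ Suc k)) (at r within {r0..})"
    using s unfolding step_def by blast
  have p': "\<And>r. r0 \<le> r \<Longrightarrow> (p has_real_derivative ?p1 r) (at r within {r0..})"
    using s unfolding step_def by blast
  have lims: "(p \<longlongrightarrow> 0) at_top" "(q \<longlongrightarrow> 0) at_top"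
    using b k_pos tendsto_0_if_decay[of r0 p "K * d" k] tendsto_0_if_decay[of r0 q "K * d" k]
    unfolding in_ball_def by auto
  show ?thesis
  proof (rule stationary_if_first_order[OF r0_pos mu mu_pos kappa_pos u_mt_pos(2)[OF adm] vp_pos,
      where J = "I p" and P = "R * tp / vp" and E = "E + (u * mt p) * cV * tp + (u * mt p) * (R * tp / vp) * vp"])
    fix r assume r: "r0 \<le> r"
    show "((\<lambda>r. vp + p r) has_real_derivative ?p1 r) (at r within {r0..})"
      using DERIV_add[OF DERIV_const p'[OF r], of vp] by simp
    show "0 < vp + p r" by (rule adm_v(3)[OF adm r])
    show "((\<lambda>r. tp + q r) has_real_derivative (u * h u p q r - E) / (kappa * r ^ Suc k)) (at r within {r0..})"
      using DERIV_add[OF DERIV_const q'[OF r], of tp] by simp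
    show "0 < tp + q r"
    proof -
      have "\<bar>q r\<bar> \<le> K * d * (1 / r ^ k)" using b r by (simp add: in_ball_def)
      also have "\<dots> \<le> K * d * c" using w_le[OF r] K_pos d_pos by (intro mult_left_mono) auto
      finally show ?thesis using tp by linarith
    qed
    show "(I p has_real_derivative - ((vp + p r) * (1 / r ^ Suc k)\<^sup>2 * (1 / r))) (at r within {r0..})"
    proof -
      have "(vp + p r) / r ^ (2 * k + 3) = (vp + p r) * (1 / r ^ (2 * k + 3))" by simp
      also have "\<dots> = (vp + p r) * (1 / r ^ Suc k)\<^sup>2 * (1 / r)"
        using powers_W(3)[of r] by (simp only: mult.assoc)
      finally show ?thesis using I_deriv[OF adm r] by simp
    qed
    show "mu * (u * mt p * ?p1 r * (1 / r ^ Suc k)) = R * (tp + q r) * (1 / (vp + p r)) - R * tp / vp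
       + (u * mt p)\<^sup>2 * ((vp + p r) * (1 / r ^ Suc k)\<^sup>2 - (real k + 1) * I p r)"
      by (rule momentum_rhs[OF adm r u(1) refl])
    have "kappa * (r ^ Suc k * ((u * h u p q r - E) / (kappa * r ^ Suc k))) = u * h u p q r - E"
      using kappa_pos r r0_pos by simp
    then show "kappa * (r ^ Suc k * ((u * h u p q r - E) / (kappa * r ^ Suc k))) = (u * mt p * cV * (tp + q r) + u * mt p * (R * tp / vp) * (vp + p r)
        + (u * mt p) ^ 3 * ((real k + 1) * (vp + p r) * I p r - (vp + p r)\<^sup>2 / 2 * (1 / r ^ Suc k)\<^sup>2)
        + 2 * nu * (real k + 1) * (u * mt p)\<^sup>2 * (vp + p r)\<^sup>2 * (1 / r ^ Suc k) * (1 / r))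
        - (E + u * mt p * cV * tp + u * mt p * (R * tp / vp) * vp)"
      by (rule trans) (rule energy_rhs[OF r refl])
  next
    show "((\<lambda>r. vp + p r) \<longlongrightarrow> vp) at_top" using tendsto_add[OF tendsto_const lims(1), of vp] by simp
    show "((\<lambda>r. tp + q r) \<longlongrightarrow> tp) at_top" using tendsto_add[OF tendsto_const lims(2), of tp] by simp
  qed
qed

text \<open>The weighted bounds place the deviations in the ball, where \<open>I p\<close> can act
  as the tail integral of the reduction. The integrated identities are then solved for the
  derivatives of \<open>p\<close> and \<open>q\<close>.\<close>

lemma fixed_point_of_solution:
  assumes mu: "mu = 2 * nu + lam"
    and sol: "stationary_sol (k + 2) r0 cV R nu lam kappa (1 / vp) 0 tp rho w th"
    and bc: "w r0 = u" "th r0 = tp + q0" "0 < u \<Longrightarrow> rho r0 = 1 / (vp + p0)"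
    and le: "\<And>r. r0 \<le> r \<Longrightarrow> \<bar>1 / rho r - vp\<bar> \<le> K * d / r ^ k" "\<And>r. r0 \<le> r \<Longrightarrow> \<bar>th r - tp\<bar> \<le> K * d / r ^ k"
  defines "p \<equiv> \<lambda>r. 1 / rho r - vp" and "q \<equiv> \<lambda>r. th r - tp"
  shows "in_ball (K * d) p q" "step u p0 q0 p q p q" "\<And>r. r0 \<le> r \<Longrightarrow> w r = (u * mt p) * (vp + p r) * (1 / r ^ Suc k)"
proof -
  have pos: "0 < rho r" if "r0 \<le> r" for r
    using sol that unfolding stationary_sol_def Let_def by blast
  obtain rho1 rho2 where rho1: "\<And>r. r0 \<le> r \<Longrightarrow> (rho has_real_derivative rho1 r) (at r within {r0..})"
     "\<And>r. r0 \<le> r \<Longrightarrow> (rho1 has_real_derivative rho2 r) (at r within {r0..})"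
    using sol C_infty_on_derivs[of r0 rho] unfolding stationary_sol_def Let_def by blast
  obtain th1 th2 where th1: "\<And>r. r0 \<le> r \<Longrightarrow> (th has_real_derivative th1 r) (at r within {r0..})"
     "\<And>r. r0 \<le> r \<Longrightarrow> (th1 has_real_derivative th2 r) (at r within {r0..})"
    using sol C_infty_on_derivs[of r0 th] unfolding stationary_sol_def Let_def by blast
  have cont: "continuous_on {r0..} rho" "continuous_on {r0..} th"
    using rho1(1) th1(1) by (auto intro!: DERIV_continuous_on)
  show ball: "in_ball (K * d) p q"
    unfolding in_ball_def p_def q_def using le pos
    by (auto intro!: continuous_intros cont) fastforce
  note adm = adm_ball[OF ball]
  have v: "vp + p r = 1 / rho r" for r by (simp add: p_def)
  have J: "(I p has_real_derivative - (1 / rho r * (1 / r ^ Suc k)\<^sup>2 * (1 / r))) (at r within {r0..})" if r: "r0 \<le> r" for r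
  proof -
    have "(vp + p r) / r ^ (2 * k + 3) = (vp + p r) * (1 / r ^ (2 * k + 3))" by simp
    also have "\<dots> = 1 / rho r * (1 / r ^ Suc k)\<^sup>2 * (1 / r)"
      using powers_W(3)[of r] unfolding v by (simp only: mult.assoc)
    finally show ?thesis using I_deriv[OF adm r] by simp
  qed
  have M: "r0 ^ Suc k * rho r0 * w r0 = u * mt p" using bc(1) by (simp add: mt_def v)
  have w0: "w r0 \<noteq> 0" using bc u by simp
  obtain v1 t1 E where
    v1: "\<And>r. r0 \<le> r \<Longrightarrow> ((\<lambda>r. 1 / rho r) has_real_derivative v1 r) (at r within {r0..})" and
    t1: "\<And>r. r0 \<le> r \<Longrightarrow> (th has_real_derivative t1 r) (at r within {r0..})" and
    w: "\<And>r. r0 \<le> r \<Longrightarrow> w r = u * mt p * (1 / rho r) * (1 / r ^ Suc k)" and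
    mom: "\<And>r. r0 \<le> r \<Longrightarrow> mu * (u * mt p * v1 r * (1 / r ^ Suc k)) = R * th r * (1 / (1 / rho r)) - R * tp / vp
        + (u * mt p)\<^sup>2 * (1 / rho r * (1 / r ^ Suc k)\<^sup>2 - (real k + 1) * I p r)" and
    en: "\<And>r. r0 \<le> r \<Longrightarrow> kappa * (r ^ Suc k * t1 r) = (u * mt p * cV * th r + u * mt p * (R * tp / vp) * (1 / rho r)
        + (u * mt p) ^ 3 * ((real k + 1) * (1 / rho r) * I p r - (1 / rho r)\<^sup>2 / 2 * (1 / r ^ Suc k)\<^sup>2)
        + 2 * nu * (real k + 1) * (u * mt p)\<^sup>2 * (1 / rho r)\<^sup>2 * (1 / r ^ Suc k) * (1 / r)) - E"
    by (rule first_order_if_stationary[OF refl refl refl refl M[symmetric] refl r0_pos mu mu_pos vp_pos w0 sol J I_lim[OF adm]])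
      (assumption, (rule that; simp only:))
  show "w r = (u * mt p) * (vp + p r) * (1 / r ^ Suc k)" if "r0 \<le> r" for r using w[OF that] unfolding v .
  \<comment> \<open>Inverse of the shift in \<open>energy_rhs\<close>: from the constant of the full
    flux to that of the deviations.\<close>
  define E0 where "E0 = E - (u * mt p) * cV * tp - (u * mt p) * (R * tp / vp) * vp"
  have E0: "E0 + (u * mt p) * cV * tp + (u * mt p) * (R * tp / vp) * vp = E" by (simp add: E0_def)
  have th: "th r = tp + q r" for r by (simp add: q_def)
  show "step u p0 q0 p q p q"
    unfolding step_def
  proof (intro conjI impI allI)
    show "\<exists>B. \<forall>r\<ge>r0. \<bar>p r\<bar> \<le> B / r ^ k \<and> \<bar>q r\<bar> \<le> B / r ^ k"
      using ball unfolding in_ball_def by blast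
    show "q r0 = q0" using bc by (simp add: q_def)
    show "p r0 = p0" if "0 < u" using bc(3)[OF that] by (simp add: p_def)
    have "(q has_real_derivative (u * h u p q r - E0) / (kappa * r ^ Suc k)) (at r within {r0..})" if r: "r0 \<le> r" for r
    proof -
      have "u * h u p q r - E0 = kappa * (r ^ Suc k * t1 r)"
        unfolding energy_rhs[OF r refl, where u = u and p = p and q = q and E = E0] E0 en[OF r] v th ..
      then have "(u * h u p q r - E0) / (kappa * r ^ Suc k) = t1 r" using kappa_pos r r0_pos by simp
      then show ?thesis using DERIV_diff[OF t1[OF r] DERIV_const[of tp]] unfolding q_def by simp
    qed
    then show "\<exists>E. \<forall>r\<ge>r0. (q has_real_derivative (u * h u p q r - E) / (kappa * r ^ Suc k)) (at r within {r0..})" by blast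
    fix r assume r: "r0 \<le> r"
    have "mu * (u * mt p * v1 r * (1 / r ^ Suc k))
      = mu * (u * mt p * (- (beta * r ^ Suc k / (u * mt p)) * (p r - g u p q r)) * (1 / r ^ Suc k))"
      unfolding momentum_rhs[OF adm r u(1) refl] mom[OF r] v th ..
    moreover have "mu * (a * x * z) = mu * (a * y * z) \<Longrightarrow> a \<noteq> 0 \<Longrightarrow> z \<noteq> 0 \<Longrightarrow> x = y" for a x y z
      using mu_pos by simp
    moreover have "1 / r ^ Suc k \<noteq> 0" using r r0_pos by simp
    ultimately have "v1 r = - (beta * r ^ Suc k / (u * mt p)) * (p r - g u p q r)"
      using u_mt_pos(2)[OF adm] by blast
    then show "(p has_real_derivative - (beta * r ^ Suc k / (u * mt p)) * (p r - g u p q r)) (at r within {r0..})"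
      using DERIV_diff[OF v1[OF r] DERIV_const[of vp]] unfolding p_def by simp
  qed
qed

lemma solution_unique:
  assumes mu: "mu = 2 * nu + lam"
    and "stationary_sol (k + 2) r0 cV R nu lam kappa (1 / vp) 0 tp rho w th"
      "w r0 = u" "th r0 = tp + q0" "0 < u \<Longrightarrow> rho r0 = 1 / (vp + p0)"
      "\<And>r. r0 \<le> r \<Longrightarrow> \<bar>1 / rho r - vp\<bar> \<le> K * d / r ^ k" "\<And>r. r0 \<le> r \<Longrightarrow> \<bar>th r - tp\<bar> \<le> K * d / r ^ k"
    and "stationary_sol (k + 2) r0 cV R nu lam kappa (1 / vp) 0 tp rho' w' th'"
      "w' r0 = u" "th' r0 = tp + q0" "0 < u \<Longrightarrow> rho' r0 = 1 / (vp + p0)"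
      "\<And>r. r0 \<le> r \<Longrightarrow> \<bar>1 / rho' r - vp\<bar> \<le> K * d / r ^ k" "\<And>r. r0 \<le> r \<Longrightarrow> \<bar>th' r - tp\<bar> \<le> K * d / r ^ k"
    and r: "r0 \<le> r"
  shows "rho' r = rho r \<and> w' r = w r \<and> th' r = th r"
proof -
  let ?p = "\<lambda>r. 1 / rho r - vp" and ?p' = "\<lambda>r. 1 / rho' r - vp" and ?q = "\<lambda>r. th r - tp" and ?q' = "\<lambda>r. th' r - tp"
  have b: "in_ball (K * d) ?p ?q" by (rule fixed_point_of_solution(1)[OF assms(1-7)])
  have s: "step u p0 q0 ?p ?q ?p ?q" by (rule fixed_point_of_solution(2)[OF assms(1-7)])
  have b': "in_ball (K * d) ?p' ?q'" by (rule fixed_point_of_solution(1)[OF assms(1) assms(8-13)])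
  have s': "step u p0 q0 ?p' ?q' ?p' ?q'" by (rule fixed_point_of_solution(2)[OF assms(1) assms(8-13)])
  have w: "w r = (u * mt ?p) * (vp + ?p r) * (1 / r ^ Suc k)"
    by (rule fixed_point_of_solution(3)[OF assms(1-7) r])
  have w': "w' r = (u * mt ?p') * (vp + ?p' r) * (1 / r ^ Suc k)"
    by (rule fixed_point_of_solution(3)[OF assms(1) assms(8-13) r])
  have eq: "1 / rho r = 1 / rho' r" "th r = th' r" if "r0 \<le> r" for r
    using fixed_point_unique[OF b b' s s' that] by auto
  have "rho r = rho' r" using eq(1)[OF r] by (metis inverse_eq_divide inverse_eq_iff_eq)
  \<comment> \<open>The mass flux sees \<open>p\<close> only through its value at \<open>r0\<close>,
    so equal volumes at \<open>r0\<close> and at \<open>r\<close> give equal velocities.\<close>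
  moreover have "w r = w' r" unfolding w w' mt_def eq(1)[OF r] eq(1)[OF order_refl] ..
  ultimately show ?thesis using eq(2)[OF r] by simp
qed

lemma solution_exists:
  assumes mu: "mu = 2 * nu + lam" and tp: "K * d * c < tp" and K: "16 * c ^ 4 \<le> K"
  obtains rho w th where "stationary_sol (k + 2) r0 cV R nu lam kappa (1 / vp) 0 tp rho w th"
    "w r0 = u" "th r0 = tp + q0" "0 < u \<Longrightarrow> rho r0 = 1 / (vp + p0)"
    "\<And>r. r0 \<le> r \<Longrightarrow> \<bar>rho r - 1 / vp\<bar> \<le> 2 / vp\<^sup>2 * (8 * c ^ 4 * d) / r ^ k"
    "\<And>r. r0 \<le> r \<Longrightarrow> \<bar>th r - tp\<bar> \<le> 8 * c ^ 4 * d / r ^ k"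
    "\<And>r. r0 \<le> r \<Longrightarrow> \<bar>u\<bar> * (r0 ^ Suc k / 3) / r ^ Suc k \<le> \<bar>w r\<bar>"
    "\<And>r. r0 \<le> r \<Longrightarrow> \<bar>w r\<bar> \<le> \<bar>u\<bar> * (3 * r0 ^ Suc k) / r ^ Suc k"
proof -
  obtain p q where s: "step u p0 q0 p q p q" and b8: "in_ball (8 * c ^ 4 * d) p q"
    using fixed_point_exists[OF K] by blast
  have b: "in_ball (K * d) p q"
  proof -
    have "0 < c ^ 4" using c_pos by simp
    then have "8 * c ^ 4 \<le> K" using K by linarith
    then have "8 * c ^ 4 * d / r ^ k \<le> K * d / r ^ k" if "r0 \<le> r" for r
      using d_pos that r0_pos by (intro divide_right_mono mult_right_mono) auto
    then show ?thesis using b8 unfolding in_ball_def by (meson order_trans)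
  qed
  note adm = adm_ball[OF b]
  note v = adm_v[OF adm]
  show ?thesis
  proof (rule that[OF solution_of_fixed_point[OF mu tp b s]])
    show "u * mt p * (vp + p r0) * (1 / r0 ^ Suc k) = u" using v(3)[of r0] r0_pos by (simp add: mt_def)
    show "tp + q r0 = tp + q0" "0 < u \<Longrightarrow> 1 / (vp + p r0) = 1 / (vp + p0)" using s unfolding step_def by auto
    fix r assume r: "r0 \<le> r"
    show "\<bar>tp + q r - tp\<bar> \<le> 8 * c ^ 4 * d / r ^ k" using b8 r unfolding in_ball_def by simp
    show "\<bar>1 / (vp + p r) - 1 / vp\<bar> \<le> 2 / vp\<^sup>2 * (8 * c ^ 4 * d) / r ^ k"
    proof -
      have "1 / (vp + p r) - 1 / vp = - (1 / (vp * (vp + p r)) * p r)"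
        using v(3)[OF r] vp_pos by (simp add: field_simps)
      then have "\<bar>1 / (vp + p r) - 1 / vp\<bar> = 1 / (vp * (vp + p r)) * \<bar>p r\<bar>"
        using v(3)[OF r] vp_pos by (simp add: abs_mult)
      also have "\<dots> \<le> 2 / vp\<^sup>2 * (8 * c ^ 4 * d / r ^ k)"
      proof (rule mult_mono)
        show "1 / (vp * (vp + p r)) \<le> 2 / vp\<^sup>2"
        proof -
          have "vp * (vp / 2) \<le> vp * (vp + p r)" using v(1)[OF r] vp_pos by (intro mult_left_mono) auto
          then have "1 / (vp * (vp + p r)) \<le> 1 / (vp * (vp / 2))" using v(3)[OF r] vp_pos by (intro divide_left_mono) auto
          then show ?thesis by (simp add: power2_eq_square)
        qed
      qed (use b8 r in \<open>auto simp: in_ball_def\<close>)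
      finally show ?thesis by simp
    qed
    \<comment> \<open>Both volumes lie between \<open>vp / 2\<close> and \<open>3 * vp / 2\<close>,
      so their ratio is between 1/3 and 3. As the volume flux is proportional to the volume, this
      yields the two-sided velocity bound.\<close>
    have vv: "0 < vp + p r" "0 < vp + p r0" "vp + p r \<le> 3 * (vp + p r0)" "vp + p r0 \<le> 3 * (vp + p r)"
      using v[OF r] v[of r0] by auto
    have w: "\<bar>u * mt p * (vp + p r) * (1 / r ^ Suc k)\<bar> = \<bar>u\<bar> * (r0 ^ Suc k * ((vp + p r) / (vp + p r0))) / r ^ Suc k"
      using vv r r0_pos by (simp add: mt_def abs_mult)
    have "1 / 3 \<le> (vp + p r) / (vp + p r0)" "(vp + p r) / (vp + p r0) \<le> 3"
      using vv by (simp_all add: field_simps)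
    then have x: "r0 ^ Suc k / 3 \<le> r0 ^ Suc k * ((vp + p r) / (vp + p r0))" "r0 ^ Suc k * ((vp + p r) / (vp + p r0)) \<le> 3 * r0 ^ Suc k"
      using r0_pos mult_left_mono[of "1 / 3" "(vp + p r) / (vp + p r0)" "r0 ^ Suc k"]
        mult_left_mono[of "(vp + p r) / (vp + p r0)" 3 "r0 ^ Suc k"] by auto
    show "\<bar>u\<bar> * (r0 ^ Suc k / 3) / r ^ Suc k \<le> \<bar>u * mt p * (vp + p r) * (1 / r ^ Suc k)\<bar>"
      unfolding w using x(1) r r0_pos by (intro divide_right_mono mult_left_mono) auto
    show "\<bar>u * mt p * (vp + p r) * (1 / r ^ Suc k)\<bar> \<le> \<bar>u\<bar> * (3 * r0 ^ Suc k) / r ^ Suc k"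
      unfolding w using x(2) r r0_pos by (intro divide_right_mono mult_left_mono) auto
  qed
qed

end

section \<open>Choice of the constants, and both boundary value problems\<close>

lemma inverse_diff_le:
  fixes rho v x :: real
  assumes "0 < rho" "0 < v" "\<bar>rho - 1 / v\<bar> \<le> x" "x \<le> 1 / (2 * v)"
  shows "\<bar>1 / rho - v\<bar> \<le> 2 * v\<^sup>2 * x"
proof -
  have "1 / v = 1 / (2 * v) + 1 / (2 * v)" using assms(2) by (simp add: field_simps)
  \<comment> \<open>The condition on \<open>x\<close> keeps \<open>rho\<close> above half of
    \<open>1 / v\<close>, so passing to the reciprocal costs at most the factor
    \<open>2 * v\<^sup>2\<close>.\<close>
  then have "1 / (2 * v) \<le> rho" using assms(3,4) by linarith
  then have inv: "1 / rho \<le> 2 * v" using assms by (simp add: field_simps)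
  have "1 / rho - v = - ((rho - 1 / v) * (v * (1 / rho)))" using assms by (simp add: field_simps)
  then have "\<bar>1 / rho - v\<bar> = \<bar>rho - 1 / v\<bar> * (v * (1 / rho))"
    using assms by (simp add: abs_mult)
  also have "\<dots> \<le> x * (v * (2 * v))" using assms inv by (intro mult_mono) auto
  finally show ?thesis by (simp add: power2_eq_square mult_ac)
qed

context gas_bounds
begin

text \<open>Inflow and outflow are treated together, with \<open>p0\<close> effective for
  \<open>0 < u\<close> alone. Its bound carries the factor \<open>2 * vp\<^sup>2\<close> that a
  density deviation of size \<open>S\<close> acquires as a volume deviation;
  \<open>eps \<le> 1 / (2 * vp)\<close> makes that conversion possible.\<close>

lemma well_posed:
  assumes mu: "mu = 2 * nu + lam"
  shows "\<exists>eps>0. \<exists>C>0. eps \<le> 1 / (2 * vp) \<and> (\<forall>u p0 q0 S. u \<noteq> 0 \<and> \<bar>u\<bar> \<le> S \<and> \<bar>q0\<bar> \<le> S \<and>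
      (0 < u \<longrightarrow> \<bar>p0\<bar> \<le> 2 * vp\<^sup>2 * S) \<and> S \<le> eps \<longrightarrow>
    (\<exists>rho w th. (stationary_sol (k + 2) r0 cV R nu lam kappa (1 / vp) 0 tp rho w th \<and>
        w r0 = u \<and> th r0 = tp + q0 \<and> (0 < u \<longrightarrow> rho r0 = 1 / (vp + p0)) \<and>
        (\<forall>r\<ge>r0. \<bar>rho r - 1 / vp\<bar> \<le> C / r ^ k * S \<and> \<bar>th r - tp\<bar> \<le> C / r ^ k * S \<and>
           \<bar>u\<bar> / (C * r ^ Suc k) \<le> \<bar>w r\<bar> \<and> \<bar>w r\<bar> \<le> C / r ^ Suc k * \<bar>u\<bar>)) \<and>
      (\<forall>rho' w' th'. stationary_sol (k + 2) r0 cV R nu lam kappa (1 / vp) 0 tp rho' w' th' \<and>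
        w' r0 = u \<and> th' r0 = tp + q0 \<and> (0 < u \<longrightarrow> rho' r0 = 1 / (vp + p0)) \<and>
        (\<forall>r\<ge>r0. \<bar>rho' r - 1 / vp\<bar> \<le> C / r ^ k * S \<and> \<bar>th' r - tp\<bar> \<le> C / r ^ k * S)
        \<longrightarrow> (\<forall>r\<ge>r0. rho' r = rho r \<and> w' r = w r \<and> th' r = th r))))"
proof -
  have c0: "0 < c" using c_ge(1) by simp
  \<comment> \<open>With \<open>d = a * S\<close>, the same \<open>d\<close> bounds \<open>u\<close>
    and \<open>q0\<close>, which are of size \<open>S\<close>, and \<open>p0\<close>, which is of
    size \<open>2 * vp\<^sup>2 * S\<close>.\<close>
  define a where "a = 1 + 2 * vp\<^sup>2"
  \<comment> \<open>Once the product is expanded, the summands serve the temperature, the density,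
    the upper and the lower velocity bound in turn. None involves \<open>K\<close>, so
    \<open>K\<close> may be chosen after \<open>C\<close>.\<close>
  define C where "C = a * (8 * c ^ 4) * (1 + 2 / vp\<^sup>2) + 3 * r0 ^ Suc k + 3 / r0 ^ Suc k"
  \<comment> \<open>Two demands: \<open>16 * c ^ 4\<close> for the self map, and \<open>C\<close> so
    that the ball contains every solution obeying the bounds in the uniqueness claim.\<close>
  define K where "K = 16 * c ^ 4 + C"
  \<comment> \<open>\<open>B\<close> adds up the coefficients of \<open>d\<close> in all smallness
    conditions, each normalised to have right-hand side 1, so that \<open>B * d \<le> 1\<close>
    implies all of them. The factor 2 in the last summand makes the temperature condition
    strict.\<close>
  define B where "B = 1 + K + K * K + 2 * K * c / vp + K * c + 2 * real k * c / (beta * r0 ^ (k + 2))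
    + 4 * (6 * K * c ^ 2 + 32 * c ^ 6) + 2 * K * c / tp"
  have a: "1 \<le> a" "2 * vp\<^sup>2 \<le> a" using vp_pos by (auto simp: a_def)
  have pos: "0 \<le> a * (8 * c ^ 4)" "0 \<le> a * (8 * c ^ 4) * (2 / vp\<^sup>2)" "0 < 3 * r0 ^ Suc k" "0 < 3 / r0 ^ Suc k"
    using a c0 r0_pos by auto
  have Ceq: "C = a * (8 * c ^ 4) + a * (8 * c ^ 4) * (2 / vp\<^sup>2) + 3 * r0 ^ Suc k + 3 / r0 ^ Suc k"
    by (simp add: C_def distrib_left)
  have C: "a * (8 * c ^ 4) \<le> C" "a * (8 * c ^ 4) * (2 / vp\<^sup>2) \<le> C" "3 * r0 ^ Suc k \<le> C" "3 / r0 ^ Suc k \<le> C" "0 < C"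
    using pos unfolding Ceq by linarith+
  have K: "16 * c ^ 4 \<le> K" "C \<le> K" "0 < K" using C c0 by (auto simp: K_def add_pos_pos)
  have Bn: "0 \<le> K" "0 \<le> K * K" "0 \<le> 2 * K * c / vp" "0 \<le> K * c" "0 \<le> 2 * real k * c / (beta * r0 ^ (k + 2))"
    "0 \<le> 4 * (6 * K * c ^ 2 + 32 * c ^ 6)" "0 \<le> 2 * K * c / tp"
    using K c0 vp_pos beta_pos r0_pos tp_pos by (auto intro!: divide_nonneg_nonneg mult_nonneg_nonneg add_nonneg_nonneg)
  then have B: "1 \<le> B" "K \<le> B" "K * K \<le> B" "2 * K * c / vp \<le> B" "K * c \<le> B" "2 * real k * c / (beta * r0 ^ (k + 2)) \<le> B"
    "4 * (6 * K * c ^ 2 + 32 * c ^ 6) \<le> B" "2 * K * c / tp \<le> B"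
    unfolding B_def by linarith+
  \<comment> \<open>The three entries ensure \<open>B * d \<le> 1\<close>, the conversion of
    boundary densities, and the applicability of \<open>inverse_diff_le\<close> to solutions obeying
    the bounds with \<open>C\<close>.\<close>
  define eps where "eps = min (1 / (B * a)) (min (1 / (2 * vp)) (r0 ^ k / (2 * vp * C)))"
  have eps: "0 < eps" "eps \<le> 1 / (B * a)" "eps \<le> 1 / (2 * vp)" "eps \<le> r0 ^ k / (2 * vp * C)"
    using B(1) a(1) vp_pos r0_pos C by (auto simp: eps_def)
  have main: "\<exists>rho w th. (stationary_sol (k + 2) r0 cV R nu lam kappa (1 / vp) 0 tp rho w th \<and>
        w r0 = u \<and> th r0 = tp + q0 \<and> (0 < u \<longrightarrow> rho r0 = 1 / (vp + p0)) \<and>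
        (\<forall>r\<ge>r0. \<bar>rho r - 1 / vp\<bar> \<le> C / r ^ k * S \<and> \<bar>th r - tp\<bar> \<le> C / r ^ k * S \<and>
           \<bar>u\<bar> / (C * r ^ Suc k) \<le> \<bar>w r\<bar> \<and> \<bar>w r\<bar> \<le> C / r ^ Suc k * \<bar>u\<bar>)) \<and>
      (\<forall>rho' w' th'. stationary_sol (k + 2) r0 cV R nu lam kappa (1 / vp) 0 tp rho' w' th' \<and>
        w' r0 = u \<and> th' r0 = tp + q0 \<and> (0 < u \<longrightarrow> rho' r0 = 1 / (vp + p0)) \<and>
        (\<forall>r\<ge>r0. \<bar>rho' r - 1 / vp\<bar> \<le> C / r ^ k * S \<and> \<bar>th' r - tp\<bar> \<le> C / r ^ k * S)
        \<longrightarrow> (\<forall>r\<ge>r0. rho' r = rho r \<and> w' r = w r \<and> th' r = th r))"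
    if u: "u \<noteq> 0" "\<bar>u\<bar> \<le> S" and q0: "\<bar>q0\<bar> \<le> S" and p0: "0 < u \<longrightarrow> \<bar>p0\<bar> \<le> 2 * vp\<^sup>2 * S" and S: "S \<le> eps" for u p0 q0 S
  proof -
    have S0: "0 < S" using u by linarith
    define d where "d = a * S"
    have Sd: "S \<le> d" "2 * vp\<^sup>2 * S \<le> d" using a S0 mult_right_mono[of 1 a S] mult_right_mono[of "2 * vp\<^sup>2" a S] by (auto simp: d_def)
    have d0: "0 < d" using a S0 by (simp add: d_def)
    have Bd: "B * d \<le> 1"
    proof -
      have "S \<le> 1 / (B * a)" using S eps(2) by linarith
      then have "S * (B * a) \<le> 1" using B(1) a(1) by (simp add: pos_le_divide_eq)
      then show ?thesis by (simp add: d_def mult_ac)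
    qed
    have sm: "x * d \<le> 1" if "x \<le> B" for x
      using mult_right_mono[OF that, of d] d0 Bd by linarith
    have vp2: "K * d * c \<le> vp / 2" using sm[OF B(4)] vp_pos by (simp add: field_simps)
    have tp2: "K * d * c < tp"
    proof -
      have "2 * (K * d * c) \<le> tp" using sm[OF B(8)] tp_pos by (simp add: field_simps)
      then show ?thesis using tp_pos by linarith
    qed
    have bt: "2 * real k * (d * c) \<le> beta * r0 ^ (k + 2)"
    proof -
      have "0 < beta * r0 ^ (k + 2)" using beta_pos r0_pos by simp
      then show ?thesis using sm[OF B(6)] by (simp add: pos_divide_le_eq mult_ac)
    qed
    interpret gas_small k r0 cV R nu mu kappa vp tp c K d u p0 q0
    proof unfold_locales
      show "0 < K" "0 < d" "u \<noteq> 0" by (fact K(3) d0 u(1))+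
      show "\<bar>u\<bar> \<le> d" "\<bar>q0\<bar> \<le> d" "0 < u \<Longrightarrow> \<bar>p0\<bar> \<le> d" using u q0 p0 Sd by auto
      show "d \<le> 1" "K * d \<le> 1" "K * K * d \<le> 1" using sm[OF B(1)] sm[OF B(2)] sm[OF B(3)] by auto
      show "K * d * c \<le> vp / 2" "2 * real k * (d * c) \<le> beta * r0 ^ (k + 2)" by (fact vp2 bt)+
      show "K * d * c \<le> 1" using sm[OF B(5)] by (simp add: mult_ac)
      show "(6 * K * c ^ 2 + 32 * c ^ 6) * d \<le> 1 / 4" using sm[OF B(7)] unfolding mult.assoc[of 4] by linarith
    qed
    have half: "C / r ^ k * S \<le> 1 / (2 * vp)" if "r0 \<le> r" for r
    proof -
      have "C / r ^ k * S \<le> C * (1 / r0 ^ k) * (r0 ^ k / (2 * vp * C))"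
        using mult_left_mono[OF inv_pow_le[OF that, of k], of C] C S S0 eps(4) that r0_pos by (intro mult_mono) auto
      then show ?thesis using C r0_pos by simp
    qed
    have ball: "\<bar>1 / rho r - vp\<bar> \<le> K * d / r ^ k" "\<bar>th r - tp\<bar> \<le> K * d / r ^ k"
      if "0 < rho r" "\<bar>rho r - 1 / vp\<bar> \<le> C / r ^ k * S" "\<bar>th r - tp\<bar> \<le> C / r ^ k * S" "r0 \<le> r" for rho th r
    proof -
      have "C * (2 * vp\<^sup>2 * S) \<le> K * d" "C * S \<le> K * d" using K C Sd S0 d0 by (auto intro!: mult_mono)
      then have le: "C * (2 * vp\<^sup>2 * S) / r ^ k \<le> K * d / r ^ k" "C * S / r ^ k \<le> K * d / r ^ k"
        using that r0_pos by (auto intro!: divide_right_mono)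
      have "\<bar>1 / rho r - vp\<bar> \<le> 2 * vp\<^sup>2 * (C / r ^ k * S)"
        by (rule inverse_diff_le[OF that(1) vp_pos that(2) half[OF that(4)]])
      then show "\<bar>1 / rho r - vp\<bar> \<le> K * d / r ^ k" using le(1) by (simp add: mult_ac)
      show "\<bar>th r - tp\<bar> \<le> K * d / r ^ k" using that(3) le(2) by simp
    qed
    have sol_pos: "0 < rho r" if "stationary_sol (k + 2) r0 cV R nu lam kappa (1 / vp) 0 tp rho w th" "r0 \<le> r" for rho w th r
      using that unfolding stationary_sol_def Let_def by blast
    obtain rho w th where sol: "stationary_sol (k + 2) r0 cV R nu lam kappa (1 / vp) 0 tp rho w th"
        "w r0 = u" "th r0 = tp + q0" "0 < u \<Longrightarrow> rho r0 = 1 / (vp + p0)"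
      and bd: "\<And>r. r0 \<le> r \<Longrightarrow> \<bar>rho r - 1 / vp\<bar> \<le> 2 / vp\<^sup>2 * (8 * c ^ 4 * d) / r ^ k"
        "\<And>r. r0 \<le> r \<Longrightarrow> \<bar>th r - tp\<bar> \<le> 8 * c ^ 4 * d / r ^ k"
        "\<And>r. r0 \<le> r \<Longrightarrow> \<bar>u\<bar> * (r0 ^ Suc k / 3) / r ^ Suc k \<le> \<bar>w r\<bar>"
        "\<And>r. r0 \<le> r \<Longrightarrow> \<bar>w r\<bar> \<le> \<bar>u\<bar> * (3 * r0 ^ Suc k) / r ^ Suc k"
      using solution_exists[OF mu tp2 K(1)] by blast
    have bdC: "\<bar>rho r - 1 / vp\<bar> \<le> C / r ^ k * S" "\<bar>th r - tp\<bar> \<le> C / r ^ k * S"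
        "\<bar>u\<bar> / (C * r ^ Suc k) \<le> \<bar>w r\<bar>" "\<bar>w r\<bar> \<le> C / r ^ Suc k * \<bar>u\<bar>" if r: "r0 \<le> r" for r
    proof -
      have rp: "0 < r" using r r0_pos by simp
      have "2 / vp\<^sup>2 * (8 * c ^ 4 * d) / r ^ k = (a * (8 * c ^ 4) * (2 / vp\<^sup>2)) * S / r ^ k"
        by (simp add: d_def mult_ac)
      also have "\<dots> \<le> C * S / r ^ k"
        using C(2) S0 rp by (intro divide_right_mono mult_right_mono) auto
      finally show "\<bar>rho r - 1 / vp\<bar> \<le> C / r ^ k * S" using bd(1)[OF r] by simp
      have "8 * c ^ 4 * d / r ^ k = (a * (8 * c ^ 4)) * S / r ^ k"
        by (simp add: d_def mult_ac)
      also have "\<dots> \<le> C * S / r ^ k"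
        using C(1) S0 rp by (intro divide_right_mono mult_right_mono) auto
      finally show "\<bar>th r - tp\<bar> \<le> C / r ^ k * S" using bd(2)[OF r] by simp
      have "1 / C \<le> r0 ^ Suc k / 3" using C(4,5) r0_pos by (simp add: field_simps)
      then have "\<bar>u\<bar> * (1 / C) / r ^ Suc k \<le> \<bar>u\<bar> * (r0 ^ Suc k / 3) / r ^ Suc k"
        using rp by (intro divide_right_mono mult_left_mono) auto
      moreover have "\<bar>u\<bar> / (C * r ^ Suc k) = \<bar>u\<bar> * (1 / C) / r ^ Suc k" by simp
      ultimately show "\<bar>u\<bar> / (C * r ^ Suc k) \<le> \<bar>w r\<bar>" using bd(3)[OF r] by linarith
      have "\<bar>u\<bar> * (3 * r0 ^ Suc k) / r ^ Suc k \<le> \<bar>u\<bar> * C / r ^ Suc k"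
        using C(3) rp by (intro divide_right_mono mult_left_mono) auto
      moreover have "C / r ^ Suc k * \<bar>u\<bar> = \<bar>u\<bar> * C / r ^ Suc k" by simp
      ultimately show "\<bar>w r\<bar> \<le> C / r ^ Suc k * \<bar>u\<bar>" using bd(4)[OF r] by linarith
    qed
    have uniq: "rho' r = rho r \<and> w' r = w r \<and> th' r = th r"
      if sol': "stationary_sol (k + 2) r0 cV R nu lam kappa (1 / vp) 0 tp rho' w' th'"
          "w' r0 = u" "th' r0 = tp + q0" "0 < u \<longrightarrow> rho' r0 = 1 / (vp + p0)"
        and bd': "\<forall>r\<ge>r0. \<bar>rho' r - 1 / vp\<bar> \<le> C / r ^ k * S \<and> \<bar>th' r - tp\<bar> \<le> C / r ^ k * S"
        and r: "r0 \<le> r" for rho' w' th' r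
    proof (rule solution_unique[OF mu sol _ _ sol'(1-3) _ _ _ r])
      fix r assume r: "r0 \<le> r"
      show "\<bar>1 / rho r - vp\<bar> \<le> K * d / r ^ k" "\<bar>th r - tp\<bar> \<le> K * d / r ^ k"
        using ball[where rho = rho and th = th, OF sol_pos[OF sol(1) r] bdC(1,2)[OF r] r] .
      show "\<bar>1 / rho' r - vp\<bar> \<le> K * d / r ^ k" "\<bar>th' r - tp\<bar> \<le> K * d / r ^ k"
        using ball[where rho = rho' and th = th', OF sol_pos[OF sol'(1) r]] bd' r by blast+
    qed (use sol'(4) in auto)
    show ?thesis
      by (intro exI[of _ rho] exI[of _ w] exI[of _ th] conjI allI impI) (use sol bdC uniq in blast)+
  qed
  show ?thesis
    by (intro exI[of _ eps] exI[of _ C] conjI allI impI eps C main) (simp_all add: eps C(5))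
qed

end

theorem theorem1p1:
  fixes n :: nat and r0 cV R nu lam kappa rho_p theta_p :: real
  assumes "n \<ge> 3" and "r0 > 0" and "cV > 0" and "R > 0" and "nu > 0"
    and "2 * nu + real n * lam \<ge> 0" and "kappa > 0" and "2 * nu + lam > 0"
    and "rho_p > 0" and "theta_p > 0"
  shows "\<exists>eps0 > 0. \<exists>C > 0.
    (\<forall>rho_m u_m theta_m. u_m > 0 \<and> rho_m > 0 \<and> theta_m > 0 \<and>
        \<bar>u_m\<bar> + \<bar>rho_m - rho_p\<bar> + \<bar>theta_m - theta_p\<bar> \<le> eps0 \<longrightarrow>
      (\<exists>rho u theta.
         (stationary_sol n r0 cV R nu lam kappa rho_p 0 theta_p rho u theta \<and>
          rho r0 = rho_m \<and> u r0 = u_m \<and> theta r0 = theta_m \<and>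
          (\<forall>r\<ge>r0.
             \<bar>rho r - rho_p\<bar> \<le> C / r^(n-2) * (\<bar>u_m\<bar> + \<bar>rho_m - rho_p\<bar> + \<bar>theta_m - theta_p\<bar>) \<and>
             \<bar>theta r - theta_p\<bar> \<le> C / r^(n-2) * (\<bar>u_m\<bar> + \<bar>rho_m - rho_p\<bar> + \<bar>theta_m - theta_p\<bar>) \<and>
             \<bar>u_m\<bar> / (C * r^(n-1)) \<le> \<bar>u r\<bar> \<and> \<bar>u r\<bar> \<le> C / r^(n-1) * \<bar>u_m\<bar>)) \<and>
         (\<forall>rho' u' theta'.
            (stationary_sol n r0 cV R nu lam kappa rho_p 0 theta_p rho' u' theta' \<and>
             rho' r0 = rho_m \<and> u' r0 = u_m \<and> theta' r0 = theta_m \<and>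
             (\<forall>r\<ge>r0.
                \<bar>rho' r - rho_p\<bar> \<le> C / r^(n-2) * (\<bar>u_m\<bar> + \<bar>rho_m - rho_p\<bar> + \<bar>theta_m - theta_p\<bar>) \<and>
                \<bar>theta' r - theta_p\<bar> \<le> C / r^(n-2) * (\<bar>u_m\<bar> + \<bar>rho_m - rho_p\<bar> + \<bar>theta_m - theta_p\<bar>) \<and>
                \<bar>u_m\<bar> / (C * r^(n-1)) \<le> \<bar>u' r\<bar> \<and> \<bar>u' r\<bar> \<le> C / r^(n-1) * \<bar>u_m\<bar>))
            \<longrightarrow> (\<forall>r\<ge>r0. rho' r = rho r \<and> u' r = u r \<and> theta' r = theta r)))) \<and>
    (\<forall>u_m theta_m. u_m < 0 \<and> theta_m > 0 \<and>
        \<bar>u_m\<bar> + \<bar>theta_m - theta_p\<bar> \<le> eps0 \<longrightarrow>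
      (\<exists>rho u theta.
         (stationary_sol n r0 cV R nu lam kappa rho_p 0 theta_p rho u theta \<and>
          u r0 = u_m \<and> theta r0 = theta_m \<and>
          (\<forall>r\<ge>r0.
             \<bar>rho r - rho_p\<bar> \<le> C / r^(n-2) * (\<bar>u_m\<bar> + \<bar>theta_m - theta_p\<bar>) \<and>
             \<bar>theta r - theta_p\<bar> \<le> C / r^(n-2) * (\<bar>u_m\<bar> + \<bar>theta_m - theta_p\<bar>) \<and>
             \<bar>u_m\<bar> / (C * r^(n-1)) \<le> \<bar>u r\<bar> \<and> \<bar>u r\<bar> \<le> C / r^(n-1) * \<bar>u_m\<bar>)) \<and>
         (\<forall>rho' u' theta'.
            (stationary_sol n r0 cV R nu lam kappa rho_p 0 theta_p rho' u' theta' \<and>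
             u' r0 = u_m \<and> theta' r0 = theta_m \<and>
             (\<forall>r\<ge>r0.
                \<bar>rho' r - rho_p\<bar> \<le> C / r^(n-2) * (\<bar>u_m\<bar> + \<bar>theta_m - theta_p\<bar>) \<and>
                \<bar>theta' r - theta_p\<bar> \<le> C / r^(n-2) * (\<bar>u_m\<bar> + \<bar>theta_m - theta_p\<bar>) \<and>
                \<bar>u_m\<bar> / (C * r^(n-1)) \<le> \<bar>u' r\<bar> \<and> \<bar>u' r\<bar> \<le> C / r^(n-1) * \<bar>u_m\<bar>))
            \<longrightarrow> (\<forall>r\<ge>r0. rho' r = rho r \<and> u' r = u r \<and> theta' r = theta r))))"
proof -
  define k where "k = n - 2"
  have n: "n = k + 2" "n - 2 = k" "n - 1 = Suc k" "0 < k" using assms(1) by (auto simp: k_def)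
  define vp where "vp = 1 / rho_p"
  have vp: "0 < vp" "1 / vp = rho_p" using assms(9) by (auto simp: vp_def)
  interpret gas_parameters k r0 cV R nu "2 * nu + lam" kappa vp theta_p
    by unfold_locales (use assms n vp in auto)
  obtain c where "gas_bounds k r0 cV R nu (2 * nu + lam) kappa vp theta_p c"
    using gas_bounds_exists by blast
  then interpret gas_bounds k r0 cV R nu "2 * nu + lam" kappa vp theta_p c .
  obtain eps C where eps: "0 < eps" "eps \<le> 1 / (2 * vp)" and C: "0 < C"
    and wp: "\<And>u p0 q0 S. u \<noteq> 0 \<and> \<bar>u\<bar> \<le> S \<and> \<bar>q0\<bar> \<le> S \<and> (0 < u \<longrightarrow> \<bar>p0\<bar> \<le> 2 * vp\<^sup>2 * S) \<and> S \<le> eps \<Longrightarrow>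
    (\<exists>rho w th. (stationary_sol n r0 cV R nu lam kappa rho_p 0 theta_p rho w th \<and>
        w r0 = u \<and> th r0 = theta_p + q0 \<and> (0 < u \<longrightarrow> rho r0 = 1 / (vp + p0)) \<and>
        (\<forall>r\<ge>r0. \<bar>rho r - rho_p\<bar> \<le> C / r ^ k * S \<and> \<bar>th r - theta_p\<bar> \<le> C / r ^ k * S \<and>
           \<bar>u\<bar> / (C * r ^ Suc k) \<le> \<bar>w r\<bar> \<and> \<bar>w r\<bar> \<le> C / r ^ Suc k * \<bar>u\<bar>)) \<and>
      (\<forall>rho' w' th'. stationary_sol n r0 cV R nu lam kappa rho_p 0 theta_p rho' w' th' \<and>
        w' r0 = u \<and> th' r0 = theta_p + q0 \<and> (0 < u \<longrightarrow> rho' r0 = 1 / (vp + p0)) \<and>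
        (\<forall>r\<ge>r0. \<bar>rho' r - rho_p\<bar> \<le> C / r ^ k * S \<and> \<bar>th' r - theta_p\<bar> \<le> C / r ^ k * S)
        \<longrightarrow> (\<forall>r\<ge>r0. rho' r = rho r \<and> w' r = w r \<and> th' r = th r)))"
    using well_posed[OF refl] unfolding vp(2) n(1)[symmetric] by blast
  show ?thesis
    unfolding n(2,3)
  proof (rule exI[of _ eps], rule conjI[OF eps(1)], rule exI[of _ C], rule conjI[OF C], intro conjI allI impI, goal_cases)
    case (1 rho_m u_m theta_m)
    let ?S = "\<bar>u_m\<bar> + \<bar>rho_m - rho_p\<bar> + \<bar>theta_m - theta_p\<bar>"
    have le: "\<bar>rho_m - 1 / vp\<bar> \<le> ?S" "?S \<le> 1 / (2 * vp)" using 1 eps vp by auto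
    have rho: "1 / (vp + (1 / rho_m - vp)) = rho_m" and th: "theta_p + (theta_m - theta_p) = theta_m" by auto
    have "u_m \<noteq> 0 \<and> \<bar>u_m\<bar> \<le> ?S \<and> \<bar>theta_m - theta_p\<bar> \<le> ?S \<and> (0 < u_m \<longrightarrow> \<bar>1 / rho_m - vp\<bar> \<le> 2 * vp\<^sup>2 * ?S) \<and> ?S \<le> eps"
      using 1 inverse_diff_le[OF _ vp(1) le] by auto
    from wp[OF this, unfolded rho th] obtain rho w th where
      sol: "stationary_sol n r0 cV R nu lam kappa rho_p 0 theta_p rho w th" "w r0 = u_m" "th r0 = theta_m" "rho r0 = rho_m"
        "\<forall>r\<ge>r0. \<bar>rho r - rho_p\<bar> \<le> C / r ^ k * ?S \<and> \<bar>th r - theta_p\<bar> \<le> C / r ^ k * ?S \<and>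
           \<bar>u_m\<bar> / (C * r ^ Suc k) \<le> \<bar>w r\<bar> \<and> \<bar>w r\<bar> \<le> C / r ^ Suc k * \<bar>u_m\<bar>"
      and uniq: "\<And>rho' w' th'. stationary_sol n r0 cV R nu lam kappa rho_p 0 theta_p rho' w' th' \<Longrightarrow>
        w' r0 = u_m \<Longrightarrow> th' r0 = theta_m \<Longrightarrow> rho' r0 = rho_m \<Longrightarrow>
        (\<forall>r\<ge>r0. \<bar>rho' r - rho_p\<bar> \<le> C / r ^ k * ?S \<and> \<bar>th' r - theta_p\<bar> \<le> C / r ^ k * ?S)
        \<Longrightarrow> (\<forall>r\<ge>r0. rho' r = rho r \<and> w' r = w r \<and> th' r = th r)"
      using 1 by blast
    show ?case
      by (rule exI[of _ rho], rule exI[of _ w], rule exI[of _ th]) (use sol uniq in blast)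
  next
    case (2 u_m theta_m)
    let ?S = "\<bar>u_m\<bar> + \<bar>theta_m - theta_p\<bar>"
    have th: "theta_p + (theta_m - theta_p) = theta_m" by auto
    \<comment> \<open>No density is prescribed for outflow; 0 is inserted for \<open>p0\<close>, and
      the clauses guarded by \<open>0 < u_m\<close> are vacuous.\<close>
    have "u_m \<noteq> 0 \<and> \<bar>u_m\<bar> \<le> ?S \<and> \<bar>theta_m - theta_p\<bar> \<le> ?S \<and> (0 < u_m \<longrightarrow> \<bar>0\<bar> \<le> 2 * vp\<^sup>2 * ?S) \<and> ?S \<le> eps"
      using 2 by auto
    note ex = wp[OF this, unfolded th]
    have neg: "(0 < u_m) = False" using 2 by simp
    obtain rho w th where
      sol: "stationary_sol n r0 cV R nu lam kappa rho_p 0 theta_p rho w th \<and> w r0 = u_m \<and> th r0 = theta_m \<and>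
        (\<forall>r\<ge>r0. \<bar>rho r - rho_p\<bar> \<le> C / r ^ k * ?S \<and> \<bar>th r - theta_p\<bar> \<le> C / r ^ k * ?S \<and>
           \<bar>u_m\<bar> / (C * r ^ Suc k) \<le> \<bar>w r\<bar> \<and> \<bar>w r\<bar> \<le> C / r ^ Suc k * \<bar>u_m\<bar>)"
      and uniq: "\<forall>rho' w' th'. stationary_sol n r0 cV R nu lam kappa rho_p 0 theta_p rho' w' th' \<and>
        w' r0 = u_m \<and> th' r0 = theta_m \<and>
        (\<forall>r\<ge>r0. \<bar>rho' r - rho_p\<bar> \<le> C / r ^ k * ?S \<and> \<bar>th' r - theta_p\<bar> \<le> C / r ^ k * ?S)
        \<longrightarrow> (\<forall>r\<ge>r0. rho' r = rho r \<and> w' r = w r \<and> th' r = th r)"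
      using ex[unfolded neg simp_thms] by (elim exE conjE) (rule that; (intro conjI)?; assumption)
    show ?case
      by (rule exI[of _ rho], rule exI[of _ w], rule exI[of _ th]) (use sol uniq in blast)
  qed
qed

end
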